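(* Let $\mathcal{C}$ be a fusion category and let $G=U(\mathcal{C})$ be its universal grading group. Let $G_{ab}$ be the maximal abelian quotient group of $G$. There is an isomorphism between $\widehat{G_{ab}}$ and the group $\mathrm{Aut}_\otimes(\mathrm{id}_{\mathcal{C}})$.
   Context: $k$ is an algebraically closed field of characteristic $0$. A fusion category is a $k$-linear semisimple rigid tensor category with finitely many isomorphism classes of simple objects, finite-dimensional morphism spaces, and simple unit object. For an abelian group $A$, $\widehat{A}$ denotes its group of characters. $\mathrm{Aut}_\otimes(\mathrm{id}_{\mathcal{C}})$ is the (abelian) group of tensor automorphisms of the identity functor of $\mathcal{C}$; an element $\Phi$ is determined by nonzero scalars $\Phi(X)\in k$, one for each simple object $X$, such that $\Phi(X_1)\Phi(X_2)=\Phi(Y)$ whenever the simple object $Y$ is contained in $X_1\otimes X_2$. Universal grading group $U(\mathcal{C})$: let $R=K_0(\mathcal{C})$ be the Grothendieck ring with basis $B$ the isomorphism classes of simple objects. Let $R_{ad}$ be the smallest subring of $R$ that is spanned by a subset of $B$, is stable under duality, and contains $XX^*$ for all $X\in B$. A based $R_{ad}$-subbimodule of $R$ is the $\mathbb{Z}$-span of a subset of $B$ stable under left and right multiplication by $R_{ad}$. $R$ decomposes uniquely as a direct sum $R=\bigoplus_{a\in A}R_a$ of indecomposable based $R_{ad}$-subbimodules, and $A$ is a group with $ab=c$ if and only if $X_aX_b\in R_c$ for all $X_a\in R_a$, $X_b\in R_b$; its identity corresponds to the component $R_{ad}$. Then $U(\mathcal{C}):=A$. *)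

theory Defs
  imports
    "HOL-Algebra.Free_Abelian_Groups"
    "HOL-Algebra.Subrings"
    "HOL-Algebra.Module"
    "HOL-Algebra.Algebraic_Closure_Type"
begin

text \<open>The indexed notation for the polynomial variable would make the letter \<open>X\<close> unusable as a name.\<close>

no_notation var (\<open>X\<index>\<close>)

section \<open>Categories\<close>

record ('o, 'm) cat =
  Obj :: "'o set"
  Arr :: "'m set"
  src :: "'m \<Rightarrow> 'o"
  tgt :: "'m \<Rightarrow> 'o"
  Id :: "'o \<Rightarrow> 'm"
  Comp :: "'m \<Rightarrow> 'm \<Rightarrow> 'm" (infixr \<open>\<cdot>\<index>\<close> 75)

definition Mor :: "('o, 'm, 'z) cat_scheme \<Rightarrow> 'o \<Rightarrow> 'o \<Rightarrow> 'm set" where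
  "Mor C X Y = {f \<in> Arr C. src C f = X \<and> tgt C f = Y}"

locale category =
  fixes C :: "('o, 'm, 'z) cat_scheme" (structure)
  assumes src_closed: "f \<in> Arr C \<Longrightarrow> src C f \<in> Obj C"
    and tgt_closed: "f \<in> Arr C \<Longrightarrow> tgt C f \<in> Obj C"
    and Id_closed: "X \<in> Obj C \<Longrightarrow> Id C X \<in> Mor C X X"
    and Comp_closed: "\<lbrakk>f \<in> Mor C X Y; g \<in> Mor C Y Z\<rbrakk> \<Longrightarrow> g \<cdot> f \<in> Mor C X Z"
    and Id_left: "f \<in> Mor C X Y \<Longrightarrow> Id C Y \<cdot> f = f"
    and Id_right: "f \<in> Mor C X Y \<Longrightarrow> f \<cdot> Id C X = f"
    and Comp_assoc: "\<lbrakk>f \<in> Mor C W X; g \<in> Mor C X Y; h \<in> Mor C Y Z\<rbrakk>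
      \<Longrightarrow> (h \<cdot> g) \<cdot> f = h \<cdot> (g \<cdot> f)"

definition inverse_arrows :: "('o, 'm, 'z) cat_scheme \<Rightarrow> 'm \<Rightarrow> 'm \<Rightarrow> bool" where
  "inverse_arrows C f g \<longleftrightarrow> f \<in> Arr C \<and> g \<in> Mor C (tgt C f) (src C f) \<and>
     g \<cdot>\<^bsub>C\<^esub> f = Id C (src C f) \<and> f \<cdot>\<^bsub>C\<^esub> g = Id C (tgt C f)"

definition iso_arr :: "('o, 'm, 'z) cat_scheme \<Rightarrow> 'm \<Rightarrow> bool" where
  "iso_arr C f \<longleftrightarrow> (\<exists>g. inverse_arrows C f g)"

definition inv_arr :: "('o, 'm, 'z) cat_scheme \<Rightarrow> 'm \<Rightarrow> 'm" where
  "inv_arr C f = (THE g. inverse_arrows C f g)"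

definition isomorphic :: "('o, 'm, 'z) cat_scheme \<Rightarrow> 'o \<Rightarrow> 'o \<Rightarrow> bool" where
  "isomorphic C X Y \<longleftrightarrow> (\<exists>f \<in> Mor C X Y. iso_arr C f)"

definition iso_class :: "('o, 'm, 'z) cat_scheme \<Rightarrow> 'o \<Rightarrow> 'o set" where
  "iso_class C X = {Y \<in> Obj C. isomorphic C X Y}"

definition mono_arr :: "('o, 'm, 'z) cat_scheme \<Rightarrow> 'm \<Rightarrow> bool" where
  "mono_arr C f \<longleftrightarrow> f \<in> Arr C \<and>
     (\<forall>W. \<forall>g \<in> Mor C W (src C f). \<forall>h \<in> Mor C W (src C f). f \<cdot>\<^bsub>C\<^esub> g = f \<cdot>\<^bsub>C\<^esub> h \<longrightarrow> g = h)"

definition epi_arr :: "('o, 'm, 'z) cat_scheme \<Rightarrow> 'm \<Rightarrow> bool" where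
  "epi_arr C f \<longleftrightarrow> f \<in> Arr C \<and>
     (\<forall>W. \<forall>g \<in> Mor C (tgt C f) W. \<forall>h \<in> Mor C (tgt C f) W. g \<cdot>\<^bsub>C\<^esub> f = h \<cdot>\<^bsub>C\<^esub> f \<longrightarrow> g = h)"

definition zero_object :: "('o, 'm, 'z) cat_scheme \<Rightarrow> 'o \<Rightarrow> bool" where
  "zero_object C X \<longleftrightarrow> X \<in> Obj C \<and>
     (\<forall>Y \<in> Obj C. (\<exists>!f. f \<in> Mor C X Y) \<and> (\<exists>!f. f \<in> Mor C Y X))"

definition simple_object :: "('o, 'm, 'z) cat_scheme \<Rightarrow> 'o \<Rightarrow> bool" where
  "simple_object C X \<longleftrightarrow> X \<in> Obj C \<and> \<not> zero_object C X \<and>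
     (\<forall>Y \<in> Obj C. \<forall>f \<in> Mor C Y X. mono_arr C f \<longrightarrow> zero_object C Y \<or> iso_arr C f)"


section \<open>Linear and abelian categories\<close>

record ('o, 'm, 'k) linear_cat = "('o, 'm) cat" +
  Plus :: "'m \<Rightarrow> 'm \<Rightarrow> 'm"
  Zero :: "'o \<Rightarrow> 'o \<Rightarrow> 'm"
  Scale :: "'k \<Rightarrow> 'm \<Rightarrow> 'm"

text \<open>The multiplicative fields of the record type \<^typ>\<open>('a, 'b) module\<close> play no role
  for a module and are left unspecified.\<close>

definition hom_module :: "('o, 'm, 'k, 'z) linear_cat_scheme \<Rightarrow> 'o \<Rightarrow> 'o \<Rightarrow> ('k, 'm) module" where
  "hom_module C X Y = \<lparr>carrier = Mor C X Y, monoid.mult = undefined, one = undefined,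
     ring.zero = Zero C X Y, add = Plus C, module.smult = Scale C\<rparr>"

locale linear_category = category C
  for C :: "('o, 'm, 'k::field, 'z) linear_cat_scheme" (structure) +
  assumes hom_module: "\<lbrakk>X \<in> Obj C; Y \<in> Obj C\<rbrakk>
      \<Longrightarrow> Module.module (ring_of_type_algebra :: 'k ring) (hom_module C X Y)"
    and Comp_Plus_left: "\<lbrakk>f \<in> Mor C X Y; g \<in> Mor C Y Z; g' \<in> Mor C Y Z\<rbrakk>
      \<Longrightarrow> Plus C g g' \<cdot> f = Plus C (g \<cdot> f) (g' \<cdot> f)"
    and Comp_Plus_right: "\<lbrakk>f \<in> Mor C X Y; f' \<in> Mor C X Y; g \<in> Mor C Y Z\<rbrakk>
      \<Longrightarrow> g \<cdot> Plus C f f' = Plus C (g \<cdot> f) (g \<cdot> f')"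
    and Comp_Scale_left: "\<lbrakk>f \<in> Mor C X Y; g \<in> Mor C Y Z\<rbrakk>
      \<Longrightarrow> Scale C c g \<cdot> f = Scale C c (g \<cdot> f)"
    and Comp_Scale_right: "\<lbrakk>f \<in> Mor C X Y; g \<in> Mor C Y Z\<rbrakk>
      \<Longrightarrow> g \<cdot> Scale C c f = Scale C c (g \<cdot> f)"

definition is_kernel :: "('o, 'm, 'k, 'z) linear_cat_scheme \<Rightarrow> 'm \<Rightarrow> 'm \<Rightarrow> bool" where
  "is_kernel C i f \<longleftrightarrow> f \<in> Arr C \<and> i \<in> Mor C (src C i) (src C f) \<and>
     f \<cdot>\<^bsub>C\<^esub> i = Zero C (src C i) (tgt C f) \<and>
     (\<forall>W \<in> Obj C. \<forall>g \<in> Mor C W (src C f). f \<cdot>\<^bsub>C\<^esub> g = Zero C W (tgt C f) \<longrightarrow>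
        (\<exists>!u. u \<in> Mor C W (src C i) \<and> i \<cdot>\<^bsub>C\<^esub> u = g))"

definition is_cokernel :: "('o, 'm, 'k, 'z) linear_cat_scheme \<Rightarrow> 'm \<Rightarrow> 'm \<Rightarrow> bool" where
  "is_cokernel C p f \<longleftrightarrow> f \<in> Arr C \<and> p \<in> Mor C (tgt C f) (tgt C p) \<and>
     p \<cdot>\<^bsub>C\<^esub> f = Zero C (src C f) (tgt C p) \<and>
     (\<forall>W \<in> Obj C. \<forall>g \<in> Mor C (tgt C f) W. g \<cdot>\<^bsub>C\<^esub> f = Zero C (src C f) W \<longrightarrow>
        (\<exists>!u. u \<in> Mor C (tgt C p) W \<and> u \<cdot>\<^bsub>C\<^esub> p = g))"

text \<open>\<open>Z\<close> is a direct sum (biproduct) of the finite family \<open>Xs\<close>; for the empty list this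
  says that \<open>Z\<close> is a zero object.\<close>

definition is_direct_sum :: "('o, 'm, 'k, 'z) linear_cat_scheme \<Rightarrow> 'o \<Rightarrow> 'o list \<Rightarrow> bool" where
  "is_direct_sum C Z Xs \<longleftrightarrow> Z \<in> Obj C \<and> set Xs \<subseteq> Obj C \<and>
     (\<exists>\<iota> \<pi>.
        (\<forall>i < length Xs. \<iota> i \<in> Mor C (Xs ! i) Z \<and> \<pi> i \<in> Mor C Z (Xs ! i)) \<and>
        (\<forall>i < length Xs. \<forall>j < length Xs.
           \<pi> j \<cdot>\<^bsub>C\<^esub> \<iota> i = (if i = j then Id C (Xs ! i) else Zero C (Xs ! i) (Xs ! j))) \<and>
        (\<Oplus>\<^bsub>hom_module C Z Z\<^esub>i \<in> {..<length Xs}. \<iota> i \<cdot>\<^bsub>C\<^esub> \<pi> i) = Id C Z)"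

locale abelian_linear_category = linear_category C
  for C :: "('o, 'm, 'k::field, 'z) linear_cat_scheme" (structure) +
  assumes direct_sums: "set Xs \<subseteq> Obj C \<Longrightarrow> \<exists>Z. is_direct_sum C Z Xs"
    and kernels: "f \<in> Arr C \<Longrightarrow> \<exists>i. is_kernel C i f"
    and cokernels: "f \<in> Arr C \<Longrightarrow> \<exists>p. is_cokernel C p f"
    and mono_is_kernel: "mono_arr C i \<Longrightarrow> \<exists>f. is_kernel C i f"
    and epi_is_cokernel: "epi_arr C p \<Longrightarrow> \<exists>f. is_cokernel C p f"

locale semisimple_linear_category = abelian_linear_category C
  for C :: "('o, 'm, 'k::field, 'z) linear_cat_scheme" (structure) +
  assumes semisimple: "Z \<in> Obj C
      \<Longrightarrow> \<exists>Xs. (\<forall>X \<in> set Xs. simple_object C X) \<and> is_direct_sum C Z Xs"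


section \<open>Tensor categories\<close>

record ('o, 'm, 'k) tensor_cat = "('o, 'm, 'k) linear_cat" +
  Tens :: "'o \<Rightarrow> 'o \<Rightarrow> 'o" (infixr \<open>\<boxtimes>\<index>\<close> 80)
  TensArr :: "'m \<Rightarrow> 'm \<Rightarrow> 'm" (infixr \<open>\<boxtimes>\<^sub>m\<index>\<close> 80)
  Unit :: "'o"
  Assoc :: "'o \<Rightarrow> 'o \<Rightarrow> 'o \<Rightarrow> 'm"
  LUnit :: "'o \<Rightarrow> 'm"
  RUnit :: "'o \<Rightarrow> 'm"

locale tensor_category = linear_category C
  for C :: "('o, 'm, 'k::field, 'z) tensor_cat_scheme" (structure) +
  assumes Tens_closed: "\<lbrakk>X \<in> Obj C; Y \<in> Obj C\<rbrakk> \<Longrightarrow> X \<boxtimes> Y \<in> Obj C"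
    and TensArr_closed: "\<lbrakk>f \<in> Mor C X X'; g \<in> Mor C Y Y'\<rbrakk>
      \<Longrightarrow> f \<boxtimes>\<^sub>m g \<in> Mor C (X \<boxtimes> Y) (X' \<boxtimes> Y')"
    and Tens_Id: "\<lbrakk>X \<in> Obj C; Y \<in> Obj C\<rbrakk> \<Longrightarrow> Id C X \<boxtimes>\<^sub>m Id C Y = Id C (X \<boxtimes> Y)"
    and Tens_Comp: "\<lbrakk>f \<in> Mor C X X'; f' \<in> Mor C X' X''; g \<in> Mor C Y Y'; g' \<in> Mor C Y' Y''\<rbrakk>
      \<Longrightarrow> (f' \<cdot> f) \<boxtimes>\<^sub>m (g' \<cdot> g) = (f' \<boxtimes>\<^sub>m g') \<cdot> (f \<boxtimes>\<^sub>m g)"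
    and Tens_Plus_left: "\<lbrakk>f \<in> Mor C X X'; f' \<in> Mor C X X'; g \<in> Mor C Y Y'\<rbrakk>
      \<Longrightarrow> Plus C f f' \<boxtimes>\<^sub>m g = Plus C (f \<boxtimes>\<^sub>m g) (f' \<boxtimes>\<^sub>m g)"
    and Tens_Plus_right: "\<lbrakk>f \<in> Mor C X X'; g \<in> Mor C Y Y'; g' \<in> Mor C Y Y'\<rbrakk>
      \<Longrightarrow> f \<boxtimes>\<^sub>m Plus C g g' = Plus C (f \<boxtimes>\<^sub>m g) (f \<boxtimes>\<^sub>m g')"
    and Tens_Scale_left: "\<lbrakk>f \<in> Mor C X X'; g \<in> Mor C Y Y'\<rbrakk>
      \<Longrightarrow> Scale C c f \<boxtimes>\<^sub>m g = Scale C c (f \<boxtimes>\<^sub>m g)"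
    and Tens_Scale_right: "\<lbrakk>f \<in> Mor C X X'; g \<in> Mor C Y Y'\<rbrakk>
      \<Longrightarrow> f \<boxtimes>\<^sub>m Scale C c g = Scale C c (f \<boxtimes>\<^sub>m g)"
    and Unit_closed: "Unit C \<in> Obj C"
    and Assoc_closed: "\<lbrakk>X \<in> Obj C; Y \<in> Obj C; Z \<in> Obj C\<rbrakk>
      \<Longrightarrow> Assoc C X Y Z \<in> Mor C ((X \<boxtimes> Y) \<boxtimes> Z) (X \<boxtimes> (Y \<boxtimes> Z))"
    and Assoc_iso: "\<lbrakk>X \<in> Obj C; Y \<in> Obj C; Z \<in> Obj C\<rbrakk> \<Longrightarrow> iso_arr C (Assoc C X Y Z)"
    and Assoc_natural: "\<lbrakk>f \<in> Mor C X X'; g \<in> Mor C Y Y'; h \<in> Mor C Z Z'\<rbrakk>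
      \<Longrightarrow> Assoc C X' Y' Z' \<cdot> ((f \<boxtimes>\<^sub>m g) \<boxtimes>\<^sub>m h) = (f \<boxtimes>\<^sub>m (g \<boxtimes>\<^sub>m h)) \<cdot> Assoc C X Y Z"
    and LUnit_closed: "X \<in> Obj C \<Longrightarrow> LUnit C X \<in> Mor C (Unit C \<boxtimes> X) X"
    and LUnit_iso: "X \<in> Obj C \<Longrightarrow> iso_arr C (LUnit C X)"
    and LUnit_natural: "f \<in> Mor C X Y
      \<Longrightarrow> LUnit C Y \<cdot> (Id C (Unit C) \<boxtimes>\<^sub>m f) = f \<cdot> LUnit C X"
    and RUnit_closed: "X \<in> Obj C \<Longrightarrow> RUnit C X \<in> Mor C (X \<boxtimes> Unit C) X"
    and RUnit_iso: "X \<in> Obj C \<Longrightarrow> iso_arr C (RUnit C X)"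
    and RUnit_natural: "f \<in> Mor C X Y
      \<Longrightarrow> RUnit C Y \<cdot> (f \<boxtimes>\<^sub>m Id C (Unit C)) = f \<cdot> RUnit C X"
    and pentagon: "\<lbrakk>W \<in> Obj C; X \<in> Obj C; Y \<in> Obj C; Z \<in> Obj C\<rbrakk>
      \<Longrightarrow> Assoc C W X (Y \<boxtimes> Z) \<cdot> Assoc C (W \<boxtimes> X) Y Z =
          (Id C W \<boxtimes>\<^sub>m Assoc C X Y Z) \<cdot> (Assoc C W (X \<boxtimes> Y) Z \<cdot> (Assoc C W X Y \<boxtimes>\<^sub>m Id C Z))"
    and triangle: "\<lbrakk>X \<in> Obj C; Y \<in> Obj C\<rbrakk>
      \<Longrightarrow> (Id C X \<boxtimes>\<^sub>m LUnit C Y) \<cdot> Assoc C X (Unit C) Y = RUnit C X \<boxtimes>\<^sub>m Id C Y"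

text \<open>\<open>X'\<close> is a left dual of \<open>X\<close> (equivalently, \<open>X\<close> is a right dual of \<open>X'\<close>): evaluation
  \<open>X' \<otimes> X \<rightarrow> 1\<close> and coevaluation \<open>1 \<rightarrow> X \<otimes> X'\<close> satisfying the two zigzag identities.\<close>

definition is_left_dual :: "('o, 'm, 'k, 'z) tensor_cat_scheme \<Rightarrow> 'o \<Rightarrow> 'o \<Rightarrow> bool" where
  "is_left_dual C X' X \<longleftrightarrow> X \<in> Obj C \<and> X' \<in> Obj C \<and>
     (\<exists>ev \<in> Mor C (X' \<boxtimes>\<^bsub>C\<^esub> X) (Unit C). \<exists>coev \<in> Mor C (Unit C) (X \<boxtimes>\<^bsub>C\<^esub> X').
        RUnit C X \<cdot>\<^bsub>C\<^esub> ((Id C X \<boxtimes>\<^sub>m\<^bsub>C\<^esub> ev) \<cdot>\<^bsub>C\<^esub> (Assoc C X X' X \<cdot>\<^bsub>C\<^esub> (coev \<boxtimes>\<^sub>m\<^bsub>C\<^esub> Id C X)))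
          = LUnit C X \<and>
        LUnit C X' \<cdot>\<^bsub>C\<^esub> ((ev \<boxtimes>\<^sub>m\<^bsub>C\<^esub> Id C X') \<cdot>\<^bsub>C\<^esub>
            (inv_arr C (Assoc C X' X X') \<cdot>\<^bsub>C\<^esub> (Id C X' \<boxtimes>\<^sub>m\<^bsub>C\<^esub> coev)))
          = RUnit C X')"

locale fusion_category = semisimple_linear_category C + tensor_category C
  for C :: "('o, 'm, 'k::{alg_closed_field, field_char_0}, 'z) tensor_cat_scheme" (structure) +
  assumes left_duals: "X \<in> Obj C \<Longrightarrow> \<exists>X'. is_left_dual C X' X"
    and right_duals: "X \<in> Obj C \<Longrightarrow> \<exists>X'. is_left_dual C X X'"
    and finitely_many_simples: "finite (iso_class C ` {X. simple_object C X})"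
    and finite_dimensional: "\<lbrakk>X \<in> Obj C; Y \<in> Obj C\<rbrakk> \<Longrightarrow>
      \<exists>S. finite S \<and> S \<subseteq> Mor C X Y \<and>
        (\<forall>f \<in> Mor C X Y. \<exists>c. f = (\<Oplus>\<^bsub>hom_module C X Y\<^esub>s \<in> S. Scale C (c s) s))"
    and simple_Unit: "simple_object C (Unit C)"


section \<open>The Grothendieck ring\<close>

definition simple_classes :: "('o, 'm, 'z) cat_scheme \<Rightarrow> 'o set set" where
  "simple_classes C = iso_class C ` {X. simple_object C X}"

definition class_rep :: "'o set \<Rightarrow> 'o" where
  "class_rep X = (SOME x. x \<in> X)"

text \<open>The class of an object in the free abelian group on the simple classes: the sum of the
  classes of its simple summands. By Krull-Schmidt it does not depend on the decomposition.\<close>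

definition K0_class :: "('o, 'm, 'k, 'z) linear_cat_scheme \<Rightarrow> 'o \<Rightarrow> ('o set \<Rightarrow>\<^sub>0 int)" where
  "K0_class C Z = (SOME c. \<exists>Xs. (\<forall>X \<in> set Xs. simple_object C X) \<and> is_direct_sum C Z Xs \<and>
     c = (\<Sum>X \<leftarrow> Xs. frag_of (iso_class C X)))"

definition zspan :: "'b set \<Rightarrow> ('b \<Rightarrow>\<^sub>0 int) set" where
  "zspan S = carrier (free_Abelian_group S)"

definition K0 :: "('o, 'm, 'k, 'z) tensor_cat_scheme \<Rightarrow> ('o set \<Rightarrow>\<^sub>0 int) ring" where
  "K0 C = \<lparr>carrier = zspan (simple_classes C),
     monoid.mult = (\<lambda>x y. frag_extend (\<lambda>X. frag_extend (\<lambda>Y.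
        K0_class C (class_rep X \<boxtimes>\<^bsub>C\<^esub> class_rep Y)) y) x),
     one = frag_of (iso_class C (Unit C)), ring.zero = 0, add = (+)\<rparr>"

definition dual_class :: "('o, 'm, 'k, 'z) tensor_cat_scheme \<Rightarrow> 'o set \<Rightarrow> 'o set" where
  "dual_class C X = iso_class C (SOME X'. is_left_dual C X' (class_rep X))"

definition K0_dual :: "('o, 'm, 'k, 'z) tensor_cat_scheme \<Rightarrow> ('o set \<Rightarrow>\<^sub>0 int) \<Rightarrow> ('o set \<Rightarrow>\<^sub>0 int)" where
  "K0_dual C = frag_extend (\<lambda>X. frag_of (dual_class C X))"


section \<open>The universal grading group\<close>

definition R_ad :: "('o, 'm, 'k, 'z) tensor_cat_scheme \<Rightarrow> ('o set \<Rightarrow>\<^sub>0 int) set" where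
  "R_ad C = \<Inter> {H. subring H (K0 C) \<and> (\<exists>S \<subseteq> simple_classes C. H = zspan S) \<and>
     (\<forall>x \<in> H. K0_dual C x \<in> H) \<and>
     (\<forall>X \<in> simple_classes C. frag_of X \<otimes>\<^bsub>K0 C\<^esub> K0_dual C (frag_of X) \<in> H)}"

definition based_subbimodule ::
    "('o, 'm, 'k, 'z) tensor_cat_scheme \<Rightarrow> ('o set \<Rightarrow>\<^sub>0 int) set \<Rightarrow> bool" where
  "based_subbimodule C M \<longleftrightarrow> (\<exists>S \<subseteq> simple_classes C. M = zspan S) \<and>
     (\<forall>r \<in> R_ad C. \<forall>m \<in> M. r \<otimes>\<^bsub>K0 C\<^esub> m \<in> M \<and> m \<otimes>\<^bsub>K0 C\<^esub> r \<in> M)"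

text \<open>The subgroup \<open>M\<close> is the internal direct sum of the finite set \<open>F\<close> of subgroups.\<close>

definition internal_direct_sum :: "'a::ab_group_add set \<Rightarrow> 'a set set \<Rightarrow> bool" where
  "internal_direct_sum M F \<longleftrightarrow> finite F \<and>
     bij_betw (\<lambda>x. \<Sum>N \<in> F. x N) (\<Pi>\<^sub>E N \<in> F. N) M"

definition indecomposable_subbimodule ::
    "('o, 'm, 'k, 'z) tensor_cat_scheme \<Rightarrow> ('o set \<Rightarrow>\<^sub>0 int) set \<Rightarrow> bool" where
  "indecomposable_subbimodule C M \<longleftrightarrow> based_subbimodule C M \<and> M \<noteq> {0} \<and>
     \<not> (\<exists>M1 M2. based_subbimodule C M1 \<and> based_subbimodule C M2 \<and> M1 \<noteq> {0} \<and> M2 \<noteq> {0} \<and>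
          M1 \<noteq> M2 \<and> internal_direct_sum M {M1, M2})"

text \<open>The components \<open>R\<^sub>a\<close> of the unique decomposition of the Grothendieck ring.\<close>

definition grading_components ::
    "('o, 'm, 'k, 'z) tensor_cat_scheme \<Rightarrow> ('o set \<Rightarrow>\<^sub>0 int) set set" where
  "grading_components C = (THE F. (\<forall>M \<in> F. indecomposable_subbimodule C M) \<and>
     internal_direct_sum (carrier (K0 C)) F)"

text \<open>The index set of the decomposition is taken to be the set of its components.\<close>

definition universal_grading_group ::
    "('o, 'm, 'k, 'z) tensor_cat_scheme \<Rightarrow> ('o set \<Rightarrow>\<^sub>0 int) set monoid" where
  "universal_grading_group C = \<lparr>carrier = grading_components C,
     monoid.mult = (\<lambda>a b. THE c. c \<in> grading_components C \<and>
        (\<forall>x \<in> a. \<forall>y \<in> b. x \<otimes>\<^bsub>K0 C\<^esub> y \<in> c)),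
     one = R_ad C\<rparr>"


section \<open>Abelianization, characters, and automorphisms of the identity functor\<close>

definition abelianization :: "('a, 'b) monoid_scheme \<Rightarrow> 'a set monoid" where
  "abelianization G = G Mod derived G (carrier G)"

definition character_group :: "('a, 'b) monoid_scheme \<Rightarrow> ('a \<Rightarrow> 'k::field) monoid" where
  "character_group A = \<lparr>
     carrier = hom A (units_of (ring_of_type_algebra :: 'k ring)) \<inter> extensional (carrier A),
     monoid.mult = (\<lambda>\<chi> \<psi>. \<lambda>x \<in> carrier A. \<chi> x * \<psi> x),
     one = (\<lambda>x \<in> carrier A. 1)\<rparr>"

text \<open>Natural automorphisms of the identity functor compatible with the tensor product and the
  unit (the tensor structure of the identity functor consists of identities).\<close>

definition Aut_tensor_id :: "('o, 'm, 'k, 'z) tensor_cat_scheme \<Rightarrow> ('o \<Rightarrow> 'm) monoid" where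
  "Aut_tensor_id C = \<lparr>
     carrier = {\<Phi> \<in> extensional (Obj C).
       (\<forall>X \<in> Obj C. \<Phi> X \<in> Mor C X X \<and> iso_arr C (\<Phi> X)) \<and>
       (\<forall>X \<in> Obj C. \<forall>Y \<in> Obj C. \<forall>f \<in> Mor C X Y. \<Phi> Y \<cdot>\<^bsub>C\<^esub> f = f \<cdot>\<^bsub>C\<^esub> \<Phi> X) \<and>
       (\<forall>X \<in> Obj C. \<forall>Y \<in> Obj C. \<Phi> (X \<boxtimes>\<^bsub>C\<^esub> Y) = \<Phi> X \<boxtimes>\<^sub>m\<^bsub>C\<^esub> \<Phi> Y) \<and>
       \<Phi> (Unit C) = Id C (Unit C)},
     monoid.mult = (\<lambda>\<Phi> \<Psi>. \<lambda>X \<in> Obj C. \<Phi> X \<cdot>\<^bsub>C\<^esub> \<Psi> X),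
     one = (\<lambda>X \<in> Obj C. Id C X)\<rparr>"

end

theory Submission
  imports Defs
begin

text \<open>A tensor automorphism of the identity functor acts on each simple object by a scalar, by
  Schur's lemma, and naturality and compatibility with the tensor product say exactly that these
  scalars satisfy \<open>\<phi>(X) \<phi>(Y) = \<phi>(Z)\<close> whenever \<open>Z\<close> occurs in \<open>X \<otimes> Y\<close>. Conversely such scalars extend
  uniquely to all objects, because every object is a direct sum of simple ones
  (\<open>characters_iso_Aut\<close>). On the other hand the universal grading assigns to simple objects
  degrees in \<open>G\<close> such that \<open>deg X deg Y = deg Z\<close> whenever \<open>Z\<close> occurs in \<open>X \<otimes> Y\<close>, and it is universal
  for the problem at hand: the scalars \<open>\<phi>\<close>
  are \<open>1\<close> on all constituents of \<open>X \<otimes> X\<^sup>*\<close>, hence on the adjoint subring, hence constant on the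
  components of the grading. So they are the homomorphisms from \<open>G\<close> to the multiplicative group of
  the field, and these factor through the abelianization (\<open>characters_of_abelianization\<close>).

  Both halves use only which simple objects occur in a tensor product, not how often. The simple
  classes with this multivalued product form a polygroup. The construction of the grading and the
  description of these scalars as characters of \<open>G\<close> are carried out for polygroups. That the simple classes satisfy the polygroup
  axioms comes down to two facts: the constituents of \<open>Z \<otimes> W\<close> depend only on those of \<open>Z\<close> and \<open>W\<close>
  (\<open>support_functor\<close>), and a nonzero morphism \<open>Z \<rightarrow> X \<otimes> Y\<close> yields nonzero morphisms
  \<open>X\<^sup>* \<otimes> Z \<rightarrow> Y\<close> and \<open>X \<rightarrow> Z \<otimes> Y\<^sup>*\<close> (\<open>flat_left_inject\<close>, \<open>sharp_right_inject\<close>). In terms of the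
  polygroup, based subbimodules are spans of unions of degrees, so the indecomposable ones are the
  spans of single degrees, and these are the components of the grading.\<close>

section \<open>Polygroups and their universal grading\<close>

text \<open>The simple classes of a fusion category, with the product of two classes being the set of
  classes occurring in the tensor product, form what is known as a polygroup. Multiplicities are
  forgotten, and the universal grading group depends on nothing more.\<close>

locale polygroup =
  fixes P :: "'a set"
    and mult :: "'a \<Rightarrow> 'a \<Rightarrow> 'a set" (infixl \<open>\<star>\<close> 70)
    and unit :: 'a
    and bar :: "'a \<Rightarrow> 'a"
  assumes mult_closed: "\<lbrakk>x \<in> P; y \<in> P\<rbrakk> \<Longrightarrow> x \<star> y \<subseteq> P"
    and unit_closed: "unit \<in> P"
    and bar_closed: "x \<in> P \<Longrightarrow> bar x \<in> P"
    and mult_assoc: "\<lbrakk>x \<in> P; y \<in> P; z \<in> P\<rbrakk> \<Longrightarrow> (\<Union>w \<in> x \<star> y. w \<star> z) = (\<Union>w \<in> y \<star> z. x \<star> w)"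
    and unit_left: "x \<in> P \<Longrightarrow> unit \<star> x = {x}"
    and unit_right: "x \<in> P \<Longrightarrow> x \<star> unit = {x}"
    and reverse_left: "\<lbrakk>x \<in> P; y \<in> P; z \<in> x \<star> y\<rbrakk> \<Longrightarrow> y \<in> bar x \<star> z"
    and reverse_right: "\<lbrakk>x \<in> P; y \<in> P; z \<in> x \<star> y\<rbrakk> \<Longrightarrow> x \<in> z \<star> bar y"
begin

lemma unit_in_bar_left: "x \<in> P \<Longrightarrow> unit \<in> bar x \<star> x"
  using reverse_left[of x unit x] by (simp add: unit_right unit_closed)

lemma unit_in_bar_right: "x \<in> P \<Longrightarrow> unit \<in> x \<star> bar x"
  using reverse_right[of unit x x] by (simp add: unit_left unit_closed)

lemma bar_bar: "x \<in> P \<Longrightarrow> bar (bar x) = x"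
  using reverse_right[of x "bar x" unit] unit_in_bar_right[of x] unit_left[of "bar (bar x)"]
  by (simp add: bar_closed)

text \<open>A product cannot vanish, since multiplying it by \<open>bar x\<close> gives back \<open>y\<close>.\<close>

lemma mult_nonempty:
  assumes "x \<in> P" "y \<in> P"
  shows "x \<star> y \<noteq> {}"
proof -
  have "y \<in> (\<Union>w \<in> bar x \<star> x. w \<star> y)"
    using unit_in_bar_left[OF assms(1)] unit_left[OF assms(2)] by blast
  then show ?thesis
    using mult_assoc[of "bar x" x y] assms bar_closed by auto
qed

text \<open>Based subrings stable under duality that contain all \<open>X X\<^sup>*\<close> correspond to the following
  subsets; the smallest one plays the role of the adjoint subring.\<close>

definition adjoint_closed :: "'a set \<Rightarrow> bool" where
  "adjoint_closed S \<longleftrightarrow> S \<subseteq> P \<and> unit \<in> S \<and> (\<forall>x \<in> S. \<forall>y \<in> S. x \<star> y \<subseteq> S) \<and>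
     (\<forall>x \<in> S. bar x \<in> S) \<and> (\<forall>x \<in> P. x \<star> bar x \<subseteq> S)"

definition adjoint_core :: "'a set" where
  "adjoint_core = \<Inter> {S. adjoint_closed S}"

lemma adjoint_closed_whole: "adjoint_closed P"
  unfolding adjoint_closed_def using mult_closed unit_closed bar_closed by blast

lemma adjoint_closed_core: "adjoint_closed adjoint_core"
proof -
  have "adjoint_core \<subseteq> P"
    unfolding adjoint_core_def using adjoint_closed_whole by blast
  then show ?thesis
    unfolding adjoint_closed_def adjoint_core_def by blast
qed

lemma core_least: "adjoint_closed S \<Longrightarrow> adjoint_core \<subseteq> S"
  unfolding adjoint_core_def by blast

lemma core_subset: "a \<in> adjoint_core \<Longrightarrow> a \<in> P"
  and core_unit: "unit \<in> adjoint_core"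
  and core_mult: "\<lbrakk>a \<in> adjoint_core; b \<in> adjoint_core; c \<in> a \<star> b\<rbrakk> \<Longrightarrow> c \<in> adjoint_core"
  and core_bar: "a \<in> adjoint_core \<Longrightarrow> bar a \<in> adjoint_core"
  and core_mult_bar: "\<lbrakk>x \<in> P; c \<in> x \<star> bar x\<rbrakk> \<Longrightarrow> c \<in> adjoint_core"
  using adjoint_closed_core unfolding adjoint_closed_def by blast+

text \<open>The degree of \<open>x\<close> is encoded as the set of all elements that share it, like the coset of a
  subgroup.\<close>

definition degree :: "'a \<Rightarrow> 'a set" where
  "degree x = (\<Union>a \<in> adjoint_core. a \<star> x)"

lemma degree_subset: "x \<in> P \<Longrightarrow> degree x \<subseteq> P"
  unfolding degree_def using core_subset mult_closed by blast

lemma degree_self: "x \<in> P \<Longrightarrow> x \<in> degree x"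
  unfolding degree_def using core_unit unit_left by blast

lemma degree_mono:
  assumes "x \<in> P" "y \<in> degree x"
  shows "degree y \<subseteq> degree x"
proof
  fix z assume "z \<in> degree y"
  then obtain a b where ab: "a \<in> adjoint_core" "z \<in> a \<star> y" "b \<in> adjoint_core" "y \<in> b \<star> x"
    using assms unfolding degree_def by blast
  then have "z \<in> (\<Union>w \<in> a \<star> b. w \<star> x)"
    using mult_assoc[of a b x] assms core_subset by blast
  then show "z \<in> degree x"
    unfolding degree_def using ab core_mult by blast
qed

lemma degree_eqI:
  assumes "x \<in> P" "y \<in> degree x"
  shows "degree y = degree x"
proof
  obtain a where a: "a \<in> adjoint_core" "y \<in> a \<star> x"
    using assms unfolding degree_def by blast
  then have "x \<in> bar a \<star> y"
    using reverse_left assms core_subset by blast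
  then have "x \<in> degree y"
    using a core_bar unfolding degree_def by blast
  then show "degree x \<subseteq> degree y"
    using degree_mono assms degree_subset by blast
qed (rule degree_mono[OF assms])

lemma degree_eq_iff: "\<lbrakk>x \<in> P; y \<in> P\<rbrakk> \<Longrightarrow> degree y = degree x \<longleftrightarrow> y \<in> degree x"
  using degree_eqI degree_self by blast

lemma degree_unit: "degree unit = adjoint_core"
  unfolding degree_def using unit_right core_subset by auto

text \<open>If \<open>z\<close> and \<open>z'\<close> both occur in \<open>x \<star> y\<close>, then \<open>y\<close> occurs in \<open>bar x \<star> z\<close> and hence \<open>z'\<close> occurs
  in \<open>(x \<star> bar x) \<star> z\<close>, whose left factor lies in the core.\<close>

lemma degree_mult_unique:
  assumes "x \<in> P" "y \<in> P" "z \<in> x \<star> y" "z' \<in> x \<star> y"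
  shows "degree z' = degree z"
proof -
  have z: "z \<in> P" using assms mult_closed by blast
  have "y \<in> bar x \<star> z" using reverse_left assms by blast
  then have "z' \<in> (\<Union>w \<in> x \<star> bar x. w \<star> z)"
    using mult_assoc[of x "bar x" z] assms bar_closed z by blast
  then have "z' \<in> degree z"
    unfolding degree_def using core_mult_bar assms by blast
  then show ?thesis using degree_eqI z by blast
qed

text \<open>Degrees are defined by multiplication by the core on the left. That right multiplication
  gives the same partition holds because the elements that preserve all degrees from the right
  form one of the sets over which the core is the intersection.\<close>

lemma degree_mult_core:
  assumes "x \<in> P" "a \<in> adjoint_core" "z \<in> x \<star> a"
  shows "degree z = degree x"
proof -
  let ?S = "{a \<in> P. \<forall>x \<in> P. x \<star> a \<subseteq> degree x}"
  have "adjoint_closed ?S"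
    unfolding adjoint_closed_def
  proof (intro conjI ballI subsetI)
    fix a assume "a \<in> ?S" then show "a \<in> P" by blast
  next
    show "unit \<in> ?S" using unit_closed unit_right degree_self by auto
  next
    fix a b c assume ab: "a \<in> ?S" "b \<in> ?S" "c \<in> a \<star> b"
    have "x \<star> c \<subseteq> degree x" if x: "x \<in> P" for x
    proof
      fix z assume "z \<in> x \<star> c"
      then have "z \<in> (\<Union>w \<in> x \<star> a. w \<star> b)"
        using mult_assoc[of x a b] ab x by blast
      then obtain w where w: "w \<in> x \<star> a" "z \<in> w \<star> b" by blast
      then have "w \<in> degree x" using ab x by blast
      moreover from this have "z \<in> degree w" using ab x w degree_subset by blast
      ultimately show "z \<in> degree x" using degree_mono x by blast
    qed
    then show "c \<in> ?S" using ab mult_closed by blast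
  next
    fix a assume a: "a \<in> ?S"
    have "x \<star> bar a \<subseteq> degree x" if x: "x \<in> P" for x
    proof
      fix z assume z: "z \<in> x \<star> bar a"
      then have zP: "z \<in> P" using mult_closed x a bar_closed by blast
      have "x \<in> z \<star> a" using reverse_right[of x "bar a" z] z a x bar_closed bar_bar by auto
      then have "x \<in> degree z" using a zP by blast
      then show "z \<in> degree x" using degree_eq_iff zP x by blast
    qed
    then show "bar a \<in> ?S" using a bar_closed by blast
  next
    fix y c assume y: "y \<in> P" "c \<in> y \<star> bar y"
    have "x \<star> c \<subseteq> degree x" if x: "x \<in> P" for x
    proof
      fix z assume "z \<in> x \<star> c"
      then have "z \<in> (\<Union>w \<in> x \<star> y. w \<star> bar y)"
        using mult_assoc[of x y "bar y"] y x bar_closed by blast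
      then obtain w where w: "w \<in> x \<star> y" "z \<in> w \<star> bar y" by blast
      then have wP: "w \<in> P" using mult_closed x y by blast
      have "x \<in> w \<star> bar y" using reverse_right w x y by blast
      then have "degree z = degree x"
        using degree_mult_unique[of w "bar y"] w wP y bar_closed by blast
      then show "z \<in> degree x" using degree_self w wP y bar_closed mult_closed by blast
    qed
    then show "c \<in> ?S" using y mult_closed bar_closed by blast
  qed
  then have "a \<in> ?S" using core_least assms by blast
  then show ?thesis using assms degree_eqI by blast
qed

lemma degree_mult_cong_left:
  assumes "x \<in> P" "x' \<in> degree x" "y \<in> P" "z \<in> x \<star> y" "z' \<in> x' \<star> y"
  shows "degree z' = degree z"
proof -
  obtain a where a: "a \<in> adjoint_core" "x' \<in> a \<star> x"
    using assms unfolding degree_def by blast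
  then have "z' \<in> (\<Union>w \<in> x \<star> y. a \<star> w)"
    using mult_assoc[of a x y] assms core_subset by blast
  then obtain w where w: "w \<in> x \<star> y" "z' \<in> a \<star> w" by blast
  then have "w \<in> P" using mult_closed assms by blast
  moreover have "z' \<in> degree w" using w a unfolding degree_def by blast
  ultimately have "degree z' = degree w" by (rule degree_eqI)
  then show ?thesis using degree_mult_unique assms w by blast
qed

text \<open>On the left, a change of \<open>x\<close> within its degree multiplies the product by an element of the
  core. On the right, \<open>y' \<in> a \<star> y\<close> with \<open>a\<close> in the core is absorbed into \<open>x'\<close>, whose degree is
  unchanged by \<open>degree_mult_core\<close>.\<close>

lemma degree_mult_cong:
  assumes "x \<in> P" "x' \<in> degree x" "y \<in> P" "y' \<in> degree y" "z \<in> x \<star> y" "z' \<in> x' \<star> y'"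
  shows "degree z' = degree z"
proof -
  have P: "x' \<in> P" "y' \<in> P" using assms degree_subset by blast+
  obtain a where a: "a \<in> adjoint_core" "y' \<in> a \<star> y"
    using assms unfolding degree_def by blast
  then have "z' \<in> (\<Union>w \<in> x' \<star> a. w \<star> y)"
    using mult_assoc[of x' a y] assms P core_subset by blast
  then obtain w where w: "w \<in> x' \<star> a" "z' \<in> w \<star> y" by blast
  have wP: "w \<in> P" using w P a core_subset mult_closed by blast
  have "degree w = degree x'" using degree_mult_core P a w by blast
  also have "\<dots> = degree x" using degree_eqI assms by blast
  finally have "w \<in> degree x" using degree_self wP by blast
  then show ?thesis using degree_mult_cong_left assms w by blast
qed

text \<open>For the polygroup of simple classes these are the families of scalars by which the tensor
  automorphisms of the identity functor act.\<close>

definition is_character :: "('a \<Rightarrow> 'k::field) \<Rightarrow> bool" where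
  "is_character \<phi> \<longleftrightarrow> (\<forall>x \<in> P. \<phi> x \<noteq> 0) \<and>
     (\<forall>x \<in> P. \<forall>y \<in> P. \<forall>z \<in> x \<star> y. \<phi> x * \<phi> y = \<phi> z)"

lemma is_characterD:
  assumes "is_character \<phi>"
  shows "x \<in> P \<Longrightarrow> \<phi> x \<noteq> 0" and "\<lbrakk>x \<in> P; y \<in> P; z \<in> x \<star> y\<rbrakk> \<Longrightarrow> \<phi> z = \<phi> x * \<phi> y"
  using assms unfolding is_character_def by metis+

lemma character_unit:
  assumes "is_character (\<phi> :: 'a \<Rightarrow> 'k::field)"
  shows "\<phi> unit = 1"
  using is_characterD(2)[OF assms unit_closed unit_closed, of unit]
    is_characterD(1)[OF assms unit_closed]
  by (simp add: unit_left unit_closed)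

lemma character_bar:
  assumes "is_character (\<phi> :: 'a \<Rightarrow> 'k::field)" "x \<in> P"
  shows "\<phi> x * \<phi> (bar x) = 1"
  using is_characterD(2)[OF assms(1) assms(2) bar_closed[OF assms(2)] unit_in_bar_right[OF assms(2)]]
    character_unit[OF assms(1)] by simp

text \<open>The elements on which a character is \<open>1\<close> are among the sets over which the core is the
  intersection, because \<open>\<phi> x * \<phi> (bar x) = \<phi> unit\<close>.\<close>

lemma character_core:
  assumes \<phi>: "is_character (\<phi> :: 'a \<Rightarrow> 'k::field)" and "a \<in> adjoint_core"
  shows "\<phi> a = 1"
proof -
  have "adjoint_closed {a \<in> P. \<phi> a = 1}"
    unfolding adjoint_closed_def
  proof (intro conjI ballI)
    show "unit \<in> {a \<in> P. \<phi> a = 1}" using unit_closed character_unit[OF \<phi>] by simp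
  next
    fix x y assume xy: "x \<in> {a \<in> P. \<phi> a = 1}" "y \<in> {a \<in> P. \<phi> a = 1}"
    show "x \<star> y \<subseteq> {a \<in> P. \<phi> a = 1}"
    proof
      fix z assume "z \<in> x \<star> y"
      then show "z \<in> {a \<in> P. \<phi> a = 1}"
        using xy mult_closed is_characterD(2)[OF \<phi>, of x y z] by auto
    qed
  next
    fix x assume "x \<in> {a \<in> P. \<phi> a = 1}"
    then show "bar x \<in> {a \<in> P. \<phi> a = 1}" using bar_closed character_bar[OF \<phi>, of x] by simp
  next
    fix x assume x: "x \<in> P"
    show "x \<star> bar x \<subseteq> {a \<in> P. \<phi> a = 1}"
    proof
      fix z assume "z \<in> x \<star> bar x"
      then show "z \<in> {a \<in> P. \<phi> a = 1}"
        using x bar_closed mult_closed is_characterD(2)[OF \<phi>, of x "bar x" z]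
          character_bar[OF \<phi>, of x] by auto
    qed
  qed blast
  then show ?thesis using core_least assms by blast
qed

lemma character_degree:
  assumes \<phi>: "is_character (\<phi> :: 'a \<Rightarrow> 'k::field)" and "x \<in> P" "y \<in> P" "degree x = degree y"
  shows "\<phi> x = \<phi> y"
proof -
  have "x \<in> degree y" using degree_eq_iff assms by blast
  then obtain a where "a \<in> adjoint_core" "x \<in> a \<star> y"
    unfolding degree_def by blast
  then show ?thesis
    using is_characterD(2)[OF \<phi>, of a y x] character_core[OF \<phi>] core_subset assms by auto
qed

definition characters :: "('a \<Rightarrow> 'k::field) monoid" where
  "characters = \<lparr>carrier = {\<phi> \<in> extensional P. is_character \<phi>},
     monoid.mult = (\<lambda>\<phi> \<psi>. \<lambda>x \<in> P. \<phi> x * \<psi> x), one = (\<lambda>x \<in> P. 1)\<rparr>"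

end

text \<open>The grading group is given up to a renaming \<open>gr\<close> of the degrees, because in the group of a
  fusion category a degree is represented by its span in the Grothendieck ring.\<close>

locale universal_grading = polygroup +
  fixes G :: "('g, 'h) monoid_scheme" and gr :: "'a \<Rightarrow> 'g"
  assumes carrier_grading: "carrier G = gr ` P"
    and grade_mult: "\<lbrakk>x \<in> P; y \<in> P; z \<in> x \<star> y\<rbrakk> \<Longrightarrow> gr x \<otimes>\<^bsub>G\<^esub> gr y = gr z"
    and grade_unit: "\<one>\<^bsub>G\<^esub> = gr unit"
    and grade_eq_iff: "\<lbrakk>x \<in> P; y \<in> P\<rbrakk> \<Longrightarrow> gr x = gr y \<longleftrightarrow> degree x = degree y"
begin

text \<open>Associativity and inverses are those of the polygroup; \<open>mult_nonempty\<close> provides the elements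
  through which they are transferred.\<close>

lemma grading_group: "group G"
proof (rule groupI)
  fix g h assume "g \<in> carrier G" "h \<in> carrier G"
  then obtain x y where xy: "x \<in> P" "y \<in> P" "g = gr x" "h = gr y"
    unfolding carrier_grading by blast
  moreover obtain z where "z \<in> x \<star> y" using mult_nonempty xy by blast
  ultimately show "g \<otimes>\<^bsub>G\<^esub> h \<in> carrier G"
    using grade_mult[of x y z] mult_closed unfolding carrier_grading by auto
next
  show "\<one>\<^bsub>G\<^esub> \<in> carrier G" unfolding grade_unit carrier_grading using unit_closed by blast
next
  fix g h k assume "g \<in> carrier G" "h \<in> carrier G" "k \<in> carrier G"
  then obtain x y z where xyz: "x \<in> P" "y \<in> P" "z \<in> P" "g = gr x" "h = gr y" "k = gr z"
    unfolding carrier_grading by blast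
  obtain v where v: "v \<in> x \<star> y" using mult_nonempty xyz by blast
  then have vP: "v \<in> P" using mult_closed xyz by blast
  obtain u where u: "u \<in> v \<star> z" using mult_nonempty xyz vP by blast
  then obtain w where w: "w \<in> y \<star> z" "u \<in> x \<star> w"
    using mult_assoc[of x y z] xyz v by blast
  then have wP: "w \<in> P" using mult_closed xyz by blast
  show "g \<otimes>\<^bsub>G\<^esub> h \<otimes>\<^bsub>G\<^esub> k = g \<otimes>\<^bsub>G\<^esub> (h \<otimes>\<^bsub>G\<^esub> k)"
    using grade_mult[of x y v] grade_mult[of v z u] grade_mult[of y z w] grade_mult[of x w u]
      xyz u v w vP wP by simp
next
  fix g assume "g \<in> carrier G"
  then obtain x where x: "x \<in> P" "g = gr x" unfolding carrier_grading by blast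
  then show "\<one>\<^bsub>G\<^esub> \<otimes>\<^bsub>G\<^esub> g = g"
    using grade_mult[of unit x x] unit_left unit_closed by (simp add: grade_unit)
next
  fix g assume "g \<in> carrier G"
  then obtain x where x: "x \<in> P" "g = gr x" unfolding carrier_grading by blast
  then have "gr (bar x) \<otimes>\<^bsub>G\<^esub> g = \<one>\<^bsub>G\<^esub>"
    using grade_mult[of "bar x" x unit] bar_closed unit_in_bar_left by (simp add: grade_unit)
  then show "\<exists>h \<in> carrier G. h \<otimes>\<^bsub>G\<^esub> g = \<one>\<^bsub>G\<^esub>"
    unfolding carrier_grading using x bar_closed by blast
qed

end

lemma carrier_units_of_type_algebra:
  "carrier (units_of (ring_of_type_algebra :: 'k::field ring)) = {c. c \<noteq> 0}"
proof -
  have "(c::'k) \<noteq> 0 \<Longrightarrow> \<exists>d. d * c = 1" for c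
    by (metis left_inverse)
  then show ?thesis
    by (auto simp: units_of_def Units_def ring_of_type_algebra_def mult.commute)
qed

lemma mult_units_of_type_algebra:
  "monoid.mult (units_of (ring_of_type_algebra :: 'k::field ring)) = (*)"
  by (simp add: units_of_def ring_of_type_algebra_def)

lemma comm_group_units_of_type_algebra:
  "comm_group (units_of (ring_of_type_algebra :: 'k::field ring))"
proof -
  interpret cring "ring_of_type_algebra :: 'k ring" by (rule cring_from_type_algebra)
  show ?thesis by (rule units_comm_group)
qed

text \<open>Commutators go to the unit under a homomorphism to an abelian group, so the homomorphism
  factors through the abelianization.\<close>

lemma (in group) hom_factors_abelianization:
  assumes H: "comm_group H" and h: "h \<in> hom G H"
  obtains g where "g \<in> hom (abelianization G) H"
    "\<And>x. x \<in> carrier G \<Longrightarrow> g (derived G (carrier G) #> x) = h x"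
proof -
  interpret H: comm_group H by (rule H)
  interpret h: group_hom G H h
    using h H.is_group is_group by (simp add: group_hom_def group_hom_axioms_def)
  have "derived G (carrier G) \<subseteq> kernel G H h"
    unfolding derived_def
  proof (rule generate_subgroup_incl[OF _ h.subgroup_kernel])
    have "h (x \<otimes> y \<otimes> inv x \<otimes> inv y) = \<one>\<^bsub>H\<^esub>" if "x \<in> carrier G" "y \<in> carrier G" for x y
      using that by (simp add: H.m_comm[of "h x" "h y"] H.m_assoc)
    then show "derived_set G (carrier G) \<subseteq> kernel G H h"
      by (auto simp: kernel_def)
  qed
  from h.FactGroup_universal_kernel[OF derived_self_is_normal this] that
  show thesis unfolding abelianization_def by metis
qed

context universal_grading
begin

text \<open>A homomorphism on the abelianization is pulled back along
  \<open>P \<rightarrow> G \<rightarrow> G\<^sub>a\<^sub>b\<close>. This is a bijection because a character of the polygroup is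
  constant on degrees, and thus defines a homomorphism on \<open>G\<close>.\<close>

lemma characters_of_abelianization:
  "(character_group (abelianization G) :: ('g set \<Rightarrow> 'k::field) monoid)
    \<cong> (characters :: ('a \<Rightarrow> 'k) monoid)"
proof -
  interpret group G by (rule grading_group)
  define D where "D = derived G (carrier G)"
  interpret D: normal D G unfolding D_def by (rule derived_self_is_normal)
  let ?A = "abelianization G" and ?K = "units_of (ring_of_type_algebra :: 'k ring)"
  define q where "q = (\<lambda>x. D #>\<^bsub>G\<^esub> gr x)"
  have carr: "carrier ?A = q ` P"
    unfolding q_def D_def abelianization_def carrier_FactGroup carrier_grading by blast
  have grP: "gr x \<in> carrier G" if "x \<in> P" for x using that carrier_grading by blast
  have q_mult: "q x \<otimes>\<^bsub>?A\<^esub> q y = q z" if "x \<in> P" "y \<in> P" "z \<in> x \<star> y" for x y z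
    using D.rcos_sum[OF grP grP] grade_mult[OF that] that
    by (simp add: q_def abelianization_def flip: D_def)
  interpret A: group ?A
    unfolding abelianization_def D_def[symmetric] by (rule D.factorgroup_is_group)
  let ?CG = "character_group ?A :: ('g set \<Rightarrow> 'k) monoid"
  define \<Theta> where "\<Theta> = (\<lambda>\<chi> :: 'g set \<Rightarrow> 'k. \<lambda>x \<in> P. \<chi> (q x))"
  have CG_carrier: "carrier ?CG = hom ?A ?K \<inter> extensional (carrier ?A)"
    by (simp add: character_group_def)
  have "\<Theta> \<in> iso ?CG characters"
  proof (rule isoI)
    show "\<Theta> \<in> hom ?CG characters"
    proof (rule homI)
      fix \<chi> assume \<chi>: "\<chi> \<in> carrier ?CG"
      then have hom: "\<chi> \<in> hom ?A ?K" by (simp add: CG_carrier)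
      have "\<chi> (q x) \<noteq> 0" if "x \<in> P" for x
        using hom_in_carrier[OF hom, of "q x"] that carr carrier_units_of_type_algebra by auto
      moreover have "\<chi> (q x) * \<chi> (q y) = \<chi> (q z)" if "x \<in> P" "y \<in> P" "z \<in> x \<star> y" for x y z
        using hom_mult[OF hom, of "q x" "q y"] that carr q_mult[OF that]
        by (simp add: mult_units_of_type_algebra)
      moreover have "z \<in> P" if "x \<in> P" "y \<in> P" "z \<in> x \<star> y" for x y z
        using that mult_closed by blast
      ultimately have "is_character (\<Theta> \<chi>)"
        unfolding is_character_def \<Theta>_def by (metis restrict_apply')
      then show "\<Theta> \<chi> \<in> carrier characters"
        by (simp add: characters_def \<Theta>_def)
    next
      fix \<chi> \<psi> assume "\<chi> \<in> carrier ?CG" "\<psi> \<in> carrier ?CG"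
      show "\<Theta> (\<chi> \<otimes>\<^bsub>?CG\<^esub> \<psi>) = \<Theta> \<chi> \<otimes>\<^bsub>characters\<^esub> \<Theta> \<psi>"
        using carr by (auto simp: \<Theta>_def characters_def character_group_def fun_eq_iff)
    qed
    show "bij_betw \<Theta> (carrier ?CG) (carrier characters)"
      unfolding bij_betw_def
    proof (intro conjI)
      show "inj_on \<Theta> (carrier ?CG)"
      proof (rule inj_onI)
        fix \<chi> \<psi> assume *: "\<chi> \<in> carrier ?CG" "\<psi> \<in> carrier ?CG" "\<Theta> \<chi> = \<Theta> \<psi>"
        show "\<chi> = \<psi>"
        proof (rule extensionalityI[of _ "carrier ?A"])
          fix a assume "a \<in> carrier ?A"
          then obtain x where "x \<in> P" "a = q x" using carr by blast
          then show "\<chi> a = \<psi> a" using fun_cong[OF *(3), of x] by (simp add: \<Theta>_def)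
        qed (use * CG_carrier in auto)
      qed
      have "\<phi> \<in> \<Theta> ` carrier ?CG" if \<phi>: "\<phi> \<in> carrier characters" for \<phi> :: "'a \<Rightarrow> 'k"
      proof -
        have ch: "is_character \<phi>" and ext: "\<phi> \<in> extensional P"
          using \<phi> by (auto simp: characters_def)
        define h where "h = (\<lambda>g. \<phi> (SOME x. x \<in> P \<and> gr x = g))"
        have h_gr: "h (gr x) = \<phi> x" if "x \<in> P" for x
        proof -
          have "(SOME y. y \<in> P \<and> gr y = gr x) \<in> P \<and> gr (SOME y. y \<in> P \<and> gr y = gr x) = gr x"
            by (rule someI[of _ x]) (use that in auto)
          then show ?thesis
            unfolding h_def using character_degree[OF ch] grade_eq_iff that by blast
        qed
        have "h \<in> hom G ?K"
        proof (rule homI)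
          fix g assume "g \<in> carrier G"
          then show "h g \<in> carrier ?K"
            using is_characterD(1)[OF ch] h_gr
            by (auto simp: carrier_grading carrier_units_of_type_algebra)
        next
          fix g g' assume "g \<in> carrier G" "g' \<in> carrier G"
          then obtain x y where xy: "x \<in> P" "y \<in> P" "g = gr x" "g' = gr y"
            unfolding carrier_grading by blast
          obtain z where "z \<in> x \<star> y" using mult_nonempty xy by blast
          moreover from this have "z \<in> P" using mult_closed xy by blast
          ultimately show "h (g \<otimes>\<^bsub>G\<^esub> g') = h g \<otimes>\<^bsub>?K\<^esub> h g'"
            using xy h_gr grade_mult[of x y z] is_characterD(2)[OF ch, of x y z]
            by (simp add: mult_units_of_type_algebra)
        qed
        from hom_factors_abelianization[OF comm_group_units_of_type_algebra this]
        obtain k where k: "k \<in> hom ?A ?K" "\<And>g. g \<in> carrier G \<Longrightarrow> k (D #>\<^bsub>G\<^esub> g) = h g"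
          unfolding D_def by blast
        let ?\<chi> = "restrict k (carrier ?A)"
        have "?\<chi> \<in> carrier ?CG"
          unfolding CG_carrier using k(1) A.is_group by (auto simp: hom_def)
        moreover have "\<phi> = \<Theta> ?\<chi>"
        proof (rule extensionalityI[of _ P])
          fix x assume x: "x \<in> P"
          then have "q x \<in> carrier ?A" using carr by blast
          then show "\<phi> x = \<Theta> ?\<chi> x" using x k(2)[OF grP] h_gr by (simp add: \<Theta>_def q_def)
        qed (use ext in \<open>auto simp: \<Theta>_def\<close>)
        ultimately show ?thesis by blast
      qed
      moreover have "\<Theta> ` carrier ?CG \<subseteq> carrier characters"
        using \<open>\<Theta> \<in> hom ?CG characters\<close> by (auto simp: hom_def)
      ultimately show "\<Theta> ` carrier ?CG = carrier characters" by blast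
    qed
  qed
  then show ?thesis by (rule is_isoI)
qed

end

section \<open>Isomorphisms\<close>

context category
begin

lemma MorD: "f \<in> Mor C X Y \<Longrightarrow> X \<in> Obj C" "f \<in> Mor C X Y \<Longrightarrow> Y \<in> Obj C"
  "f \<in> Mor C X Y \<Longrightarrow> f \<in> Arr C" "f \<in> Mor C X Y \<Longrightarrow> src C f = X" "f \<in> Mor C X Y \<Longrightarrow> tgt C f = Y"
  using src_closed tgt_closed by (auto simp: Mor_def)

lemma inverse_arrows_iff:
  "f \<in> Mor C X Y \<Longrightarrow>
    inverse_arrows C f g \<longleftrightarrow> g \<in> Mor C Y X \<and> g \<cdot> f = Id C X \<and> f \<cdot> g = Id C Y"
  unfolding inverse_arrows_def using MorD by simp

lemma iso_arr_iff:
  "f \<in> Mor C X Y \<Longrightarrow> iso_arr C f \<longleftrightarrow> (\<exists>g \<in> Mor C Y X. g \<cdot> f = Id C X \<and> f \<cdot> g = Id C Y)"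
  unfolding iso_arr_def using inverse_arrows_iff by blast

lemma iso_arrI:
  "\<lbrakk>f \<in> Mor C X Y; g \<in> Mor C Y X; g \<cdot> f = Id C X; f \<cdot> g = Id C Y\<rbrakk> \<Longrightarrow> iso_arr C f"
  using iso_arr_iff by blast

lemma inverse_unique:
  assumes "f \<in> Mor C X Y" "g \<in> Mor C Y X" "h \<in> Mor C Y X" "g \<cdot> f = Id C X" "f \<cdot> h = Id C Y"
  shows "g = h"
  using Comp_assoc[of h Y X f Y g X] assms Id_left Id_right by simp

lemma inv_arr:
  assumes "f \<in> Mor C X Y" "iso_arr C f"
  shows "inv_arr C f \<in> Mor C Y X" "inv_arr C f \<cdot> f = Id C X" "f \<cdot> inv_arr C f = Id C Y"
proof -
  obtain g where g: "inverse_arrows C f g" using assms(2) unfolding iso_arr_def by blast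
  have "\<exists>!g. inverse_arrows C f g"
    using g inverse_arrows_iff[OF assms(1)] inverse_unique[OF assms(1)] by metis
  from theI'[OF this] show "inv_arr C f \<in> Mor C Y X" "inv_arr C f \<cdot> f = Id C X"
    "f \<cdot> inv_arr C f = Id C Y"
    unfolding inv_arr_def inverse_arrows_iff[OF assms(1)] by blast+
qed

lemma iso_arr_inv:
  "\<lbrakk>f \<in> Mor C X Y; iso_arr C f\<rbrakk> \<Longrightarrow> iso_arr C (inv_arr C f)"
  using inv_arr iso_arrI by metis

lemma iso_arr_Id: "X \<in> Obj C \<Longrightarrow> iso_arr C (Id C X)"
  using Id_closed Id_left iso_arrI by metis

lemma inv_arr_Comp_cancel:
  assumes i: "i \<in> Mor C Y Z" "iso_arr C i"
  shows "f \<in> Mor C X Y \<Longrightarrow> inv_arr C i \<cdot> (i \<cdot> f) = f"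
    and "f \<in> Mor C X Z \<Longrightarrow> i \<cdot> (inv_arr C i \<cdot> f) = f"
    and "g \<in> Mor C Z W \<Longrightarrow> (g \<cdot> i) \<cdot> inv_arr C i = g"
    and "g \<in> Mor C Y W \<Longrightarrow> (g \<cdot> inv_arr C i) \<cdot> i = g"
proof -
  note j = inv_arr[OF i]
  show "inv_arr C i \<cdot> (i \<cdot> f) = f" if "f \<in> Mor C X Y"
    using Comp_assoc[OF that i(1) j(1)] j(2) Id_left[OF that] by simp
  show "i \<cdot> (inv_arr C i \<cdot> f) = f" if "f \<in> Mor C X Z"
    using Comp_assoc[OF that j(1) i(1)] j(3) Id_left[OF that] by simp
  show "(g \<cdot> i) \<cdot> inv_arr C i = g" if "g \<in> Mor C Z W"
    using Comp_assoc[OF j(1) i(1) that] j(3) Id_right[OF that] by simp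
  show "(g \<cdot> inv_arr C i) \<cdot> i = g" if "g \<in> Mor C Y W"
    using Comp_assoc[OF i(1) j(1) that] j(2) Id_right[OF that] by simp
qed

lemma iso_arr_Comp:
  assumes f: "f \<in> Mor C X Y" "iso_arr C f" and g: "g \<in> Mor C Y Z" "iso_arr C g"
  shows "iso_arr C (g \<cdot> f)"
proof (rule iso_arrI)
  let ?f = "inv_arr C f" and ?g = "inv_arr C g"
  note f' = inv_arr[OF f] and g' = inv_arr[OF g]
  show gf: "g \<cdot> f \<in> Mor C X Z" and fg: "?f \<cdot> ?g \<in> Mor C Z X"
    using Comp_closed f g f' g' by blast+
  show "(?f \<cdot> ?g) \<cdot> (g \<cdot> f) = Id C X"
    using Comp_assoc[OF gf g'(1) f'(1)] inv_arr_Comp_cancel(1)[OF g f(1)] f'(2) by simp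
  show "(g \<cdot> f) \<cdot> (?f \<cdot> ?g) = Id C Z"
    using Comp_assoc[OF fg f(1) g(1)] inv_arr_Comp_cancel(2)[OF f g'(1)] g'(3) by simp
qed

lemma Comp_iso_cancel_left:
  assumes "i \<in> Mor C Y Z" "iso_arr C i" "f \<in> Mor C X Y" "g \<in> Mor C X Y" "i \<cdot> f = i \<cdot> g"
  shows "f = g"
  using inv_arr_Comp_cancel(1)[OF assms(1,2,3)] inv_arr_Comp_cancel(1)[OF assms(1,2,4)] assms(5)
  by metis

lemma Comp_iso_cancel_right:
  assumes "i \<in> Mor C X Y" "iso_arr C i" "f \<in> Mor C Y Z" "g \<in> Mor C Y Z" "f \<cdot> i = g \<cdot> i"
  shows "f = g"
  using inv_arr_Comp_cancel(3)[OF assms(1,2,3)] inv_arr_Comp_cancel(3)[OF assms(1,2,4)] assms(5)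
  by metis

lemma isomorphicI: "\<lbrakk>f \<in> Mor C X Y; iso_arr C f\<rbrakk> \<Longrightarrow> isomorphic C X Y"
  unfolding isomorphic_def by blast

lemma isomorphic_refl: "X \<in> Obj C \<Longrightarrow> isomorphic C X X"
  using isomorphicI Id_closed iso_arr_Id by blast

lemma isomorphic_sym: "isomorphic C X Y \<Longrightarrow> isomorphic C Y X"
  unfolding isomorphic_def using inv_arr(1) iso_arr_inv by blast

lemma isomorphic_trans: "\<lbrakk>isomorphic C X Y; isomorphic C Y Z\<rbrakk> \<Longrightarrow> isomorphic C X Z"
  unfolding isomorphic_def using iso_arr_Comp Comp_closed by blast

lemma iso_class_eq_iff:
  "\<lbrakk>X \<in> Obj C; Y \<in> Obj C\<rbrakk> \<Longrightarrow> iso_class C X = iso_class C Y \<longleftrightarrow> isomorphic C X Y"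
  unfolding iso_class_def using isomorphic_refl isomorphic_sym isomorphic_trans by blast

lemma class_rep_iso_class:
  assumes "X \<in> Obj C"
  shows "class_rep (iso_class C X) \<in> Obj C" "isomorphic C X (class_rep (iso_class C X))"
proof -
  have "X \<in> iso_class C X" using assms isomorphic_refl by (simp add: iso_class_def)
  then have "class_rep (iso_class C X) \<in> iso_class C X" unfolding class_rep_def by (rule someI)
  then show "class_rep (iso_class C X) \<in> Obj C" "isomorphic C X (class_rep (iso_class C X))"
    by (auto simp: iso_class_def)
qed

end


section \<open>Arithmetic of morphisms\<close>

lemma hom_module_simps [simp]:
  "carrier (hom_module C X Y) = Mor C X Y"
  "\<zero>\<^bsub>hom_module C X Y\<^esub> = Zero C X Y"
  "f \<oplus>\<^bsub>hom_module C X Y\<^esub> g = Plus C f g"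
  "module.smult (hom_module C X Y) = Scale C"
  by (simp_all add: hom_module_def)

context linear_category
begin

lemma abelian_group_Mor: "\<lbrakk>X \<in> Obj C; Y \<in> Obj C\<rbrakk> \<Longrightarrow> abelian_group (hom_module C X Y)"
  using hom_module module.axioms(2) by blast

lemma Plus_closed: "\<lbrakk>f \<in> Mor C X Y; g \<in> Mor C X Y\<rbrakk> \<Longrightarrow> Plus C f g \<in> Mor C X Y"
  using abelian_monoid.a_closed[OF abelian_group.axioms(1)[OF abelian_group_Mor], of X Y f g] MorD by simp

lemma Zero_closed: "\<lbrakk>X \<in> Obj C; Y \<in> Obj C\<rbrakk> \<Longrightarrow> Zero C X Y \<in> Mor C X Y"
  using abelian_monoid.zero_closed[OF abelian_group.axioms(1)[OF abelian_group_Mor], of X Y] by simp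

lemma Scale_closed: "f \<in> Mor C X Y \<Longrightarrow> Scale C c f \<in> Mor C X Y"
  using module.smult_closed[OF hom_module, of X Y c f] MorD by (simp add: ring_of_type_algebra_def)

lemma Plus_Zero_left: "f \<in> Mor C X Y \<Longrightarrow> Plus C (Zero C X Y) f = f"
  using abelian_monoid.l_zero[OF abelian_group.axioms(1)[OF abelian_group_Mor], of X Y f] MorD by simp

lemma Plus_commute: "\<lbrakk>f \<in> Mor C X Y; g \<in> Mor C X Y\<rbrakk> \<Longrightarrow> Plus C f g = Plus C g f"
  using abelian_monoid.a_comm[OF abelian_group.axioms(1)[OF abelian_group_Mor], of X Y f g] MorD by simp

lemma Plus_assoc: "\<lbrakk>f \<in> Mor C X Y; g \<in> Mor C X Y; h \<in> Mor C X Y\<rbrakk>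
    \<Longrightarrow> Plus C (Plus C f g) h = Plus C f (Plus C g h)"
  using abelian_monoid.a_assoc[OF abelian_group.axioms(1)[OF abelian_group_Mor], of X Y f g h] MorD by simp

lemma Plus_Zero_right: "f \<in> Mor C X Y \<Longrightarrow> Plus C f (Zero C X Y) = f"
  using Plus_Zero_left Plus_commute Zero_closed MorD by metis

lemma Plus_left_commute: "\<lbrakk>f \<in> Mor C X Y; g \<in> Mor C X Y; h \<in> Mor C X Y\<rbrakk>
    \<Longrightarrow> Plus C f (Plus C g h) = Plus C g (Plus C f h)"
  using Plus_assoc[of f X Y g h] Plus_assoc[of g X Y f h] Plus_commute[of f X Y g] by simp

lemma Scale_add: "f \<in> Mor C X Y \<Longrightarrow> Scale C (a + b) f = Plus C (Scale C a f) (Scale C b f)"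
  using module.smult_l_distr[OF hom_module, of X Y a b f] MorD by (simp add: ring_of_type_algebra_def)

lemma Scale_Plus: "\<lbrakk>f \<in> Mor C X Y; g \<in> Mor C X Y\<rbrakk>
    \<Longrightarrow> Scale C a (Plus C f g) = Plus C (Scale C a f) (Scale C a g)"
  using module.smult_r_distr[OF hom_module, of X Y a f g] MorD by (simp add: ring_of_type_algebra_def)

lemma Scale_Scale: "f \<in> Mor C X Y \<Longrightarrow> Scale C a (Scale C b f) = Scale C (a * b) f"
  using module.smult_assoc1[OF hom_module, of X Y a b f] MorD by (simp add: ring_of_type_algebra_def)

lemma Scale_one: "f \<in> Mor C X Y \<Longrightarrow> Scale C 1 f = f"
  using module.smult_one[OF hom_module, of X Y f] MorD by (simp add: ring_of_type_algebra_def)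

lemma Plus_right_cancel_Zero:
  assumes f: "f \<in> Mor C X Y" and g: "g \<in> Mor C X Y" and eq: "Plus C f g = g"
  shows "f = Zero C X Y"
proof -
  interpret M: abelian_group "hom_module C X Y" using abelian_group_Mor f MorD by blast
  show ?thesis using M.add.r_cancel_one[of g f] f g eq by simp
qed

lemma Scale_0:
  assumes "f \<in> Mor C X Y"
  shows "Scale C 0 f = Zero C X Y"
proof (rule Plus_right_cancel_Zero)
  show "Plus C (Scale C 0 f) f = f"
    using Scale_add[OF assms, of 0 1] Scale_one[OF assms] by simp
qed (use assms Scale_closed in auto)

lemma Scale_Zero: "\<lbrakk>X \<in> Obj C; Y \<in> Obj C\<rbrakk> \<Longrightarrow> Scale C c (Zero C X Y) = Zero C X Y"
  using Scale_0[OF Zero_closed] Scale_Scale[OF Zero_closed, of X Y c 0] by simp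

lemma Scale_eq_Zero_iff:
  assumes "f \<in> Mor C X Y" "f \<noteq> Zero C X Y"
  shows "Scale C c f = Zero C X Y \<longleftrightarrow> c = 0"
proof
  assume *: "Scale C c f = Zero C X Y"
  show "c = 0"
  proof (rule ccontr)
    assume "c \<noteq> 0"
    then have "f = Scale C (inverse c) (Scale C c f)"
      using Scale_Scale[OF assms(1), of "inverse c" c] Scale_one[OF assms(1)] by simp
    then show False using * assms Scale_Zero MorD by metis
  qed
qed (simp add: Scale_0[OF assms(1)])

text \<open>Subtraction is not part of the record; \<open>f - g\<close> is written as \<open>f + (-1) g\<close>.\<close>

lemma Plus_neg_eq_Zero_iff:
  assumes f: "f \<in> Mor C X Y" and g: "g \<in> Mor C X Y"
  shows "Plus C f (Scale C (-1) g) = Zero C X Y \<longleftrightarrow> f = g"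
proof -
  have *: "Plus C (Scale C (-1) g) g = Zero C X Y"
    using Scale_add[OF g, of "-1" 1] Scale_one[OF g] Scale_0[OF g] by simp
  have "Plus C (Plus C f (Scale C (-1) g)) g = f"
    using Plus_assoc[OF f Scale_closed[OF g] g] * Plus_Zero_right[OF f] by simp
  then show ?thesis
    using * Plus_Zero_left[OF g] Plus_commute[OF g Scale_closed[OF g]] by auto
qed

lemma Scale_cancel:
  assumes "f \<in> Mor C X Y" "f \<noteq> Zero C X Y" "Scale C a f = Scale C b f"
  shows "a = b"
proof -
  have "Scale C (a - b) f = Plus C (Scale C a f) (Scale C (-1) (Scale C b f))"
    using Scale_add[OF assms(1), of a "-b"] Scale_Scale[OF assms(1)] by simp
  then show ?thesis
    using Plus_neg_eq_Zero_iff[of "Scale C a f" X Y "Scale C b f"] Scale_closed assms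
      Scale_eq_Zero_iff[OF assms(1,2), of "a - b"] by auto
qed

lemma Comp_Zero_right: "\<lbrakk>g \<in> Mor C Y Z; X \<in> Obj C\<rbrakk> \<Longrightarrow> g \<cdot> Zero C X Y = Zero C X Z"
  using Comp_Scale_right[OF Zero_closed, of X Y g Z 0] Scale_0 MorD Comp_closed Zero_closed by metis

lemma Comp_Zero_left: "\<lbrakk>f \<in> Mor C X Y; Z \<in> Obj C\<rbrakk> \<Longrightarrow> Zero C Y Z \<cdot> f = Zero C X Z"
  using Comp_Scale_left[OF _ Zero_closed, of f X Y Z 0] Scale_0 MorD Comp_closed Zero_closed by metis

text \<open>Decompositions of identities into sums are used through this closure principle, so that the
  sums themselves never have to be rearranged.\<close>

lemma finsum_Mor_induct [consumes 3, case_names mem Zero Plus]: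
  assumes "finite A" "X \<in> Obj C" "Y \<in> Obj C"
    and mem: "\<And>i. i \<in> A \<Longrightarrow> f i \<in> Mor C X Y \<and> Q (f i)"
    and Zero: "Q (Zero C X Y)"
    and Plus: "\<And>g h. \<lbrakk>g \<in> Mor C X Y; h \<in> Mor C X Y; Q g; Q h\<rbrakk> \<Longrightarrow> Q (Plus C g h)"
  shows "(\<Oplus>\<^bsub>hom_module C X Y\<^esub>i \<in> A. f i) \<in> Mor C X Y \<and> Q (\<Oplus>\<^bsub>hom_module C X Y\<^esub>i \<in> A. f i)"
  using assms(1) mem
proof (induction A)
  interpret M: abelian_group "hom_module C X Y" using abelian_group_Mor assms by blast
  case empty
  then show ?case using Zero Zero_closed assms M.finsum_empty by auto
next
  interpret M: abelian_group "hom_module C X Y" using abelian_group_Mor assms by blast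
  case (insert i A)
  then have "(\<Oplus>\<^bsub>hom_module C X Y\<^esub>j \<in> insert i A. f j)
      = Plus C (f i) (\<Oplus>\<^bsub>hom_module C X Y\<^esub>j \<in> A. f j)"
    using M.finsum_insert[of A i f] by (auto simp: Pi_iff)
  then show ?case using insert Plus Plus_closed by auto
qed

lemma zero_object_iff:
  assumes "X \<in> Obj C"
  shows "zero_object C X \<longleftrightarrow> Id C X = Zero C X X"
proof
  assume "zero_object C X"
  then show "Id C X = Zero C X X"
    unfolding zero_object_def using Id_closed Zero_closed assms by blast
next
  assume *: "Id C X = Zero C X X"
  have "f = Zero C X Y" if "f \<in> Mor C X Y" for f Y
    using Id_right[OF that] * Comp_Zero_right[OF that assms] by simp
  moreover have "f = Zero C Y X" if "f \<in> Mor C Y X" for f Y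
    using Id_left[OF that] * Comp_Zero_left[OF that assms] by simp
  ultimately show "zero_object C X"
    unfolding zero_object_def using assms Zero_closed by blast
qed

lemma simple_Obj: "simple_object C X \<Longrightarrow> X \<in> Obj C"
  unfolding simple_object_def by blast

lemma simple_Id_nonzero: "simple_object C X \<Longrightarrow> Id C X \<noteq> Zero C X X"
  unfolding simple_object_def using zero_object_iff by blast

lemma iso_nonzero:
  assumes "simple_object C X" "f \<in> Mor C X Y" "iso_arr C f"
  shows "f \<noteq> Zero C X Y"
  using inv_arr[OF assms(2,3)] Comp_Zero_right[of "inv_arr C f" Y X X] simple_Id_nonzero[OF assms(1)]
    simple_Obj[OF assms(1)] by auto

lemma simple_isomorphic:
  assumes X: "simple_object C X" and iso: "isomorphic C X Y"
  shows "simple_object C Y"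
proof -
  obtain i where i: "i \<in> Mor C X Y" "iso_arr C i" using iso unfolding isomorphic_def by blast
  note j = inv_arr[OF i]
  have Y: "Y \<in> Obj C" using i MorD by blast
  show ?thesis
    unfolding simple_object_def
  proof (intro conjI ballI impI)
    show "\<not> zero_object C Y"
    proof
      assume "zero_object C Y"
      then have "i = Zero C X Y" using zero_object_iff Y i Id_left Comp_Zero_left by metis
      then show False using iso_nonzero X i by blast
    qed
  next
    fix W f assume W: "W \<in> Obj C" and f: "f \<in> Mor C W Y" and mono: "mono_arr C f"
    let ?f = "inv_arr C i \<cdot> f"
    have f': "?f \<in> Mor C W X" using j f Comp_closed by blast
    have "mono_arr C ?f"
      unfolding mono_arr_def
    proof (intro conjI allI ballI impI)
      show "?f \<in> Arr C" using f' MorD by blast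
    next
      fix V g h assume "g \<in> Mor C V (src C ?f)" "h \<in> Mor C V (src C ?f)" and eq: "?f \<cdot> g = ?f \<cdot> h"
      then have gh: "g \<in> Mor C V W" "h \<in> Mor C V W" using f' MorD by metis+
      then have "f \<cdot> g = f \<cdot> h"
        using eq Comp_assoc[OF gh(1) f j(1)] Comp_assoc[OF gh(2) f j(1)]
          Comp_iso_cancel_left[OF j(1) iso_arr_inv[OF i] Comp_closed[OF gh(1) f] Comp_closed[OF gh(2) f]]
        by simp
      then show "g = h" using mono gh f MorD unfolding mono_arr_def by metis
    qed
    then consider "zero_object C W" | "iso_arr C ?f"
      using X f' W unfolding simple_object_def by blast
    then show "zero_object C W \<or> iso_arr C f"
    proof cases
      case 2
      have "i \<cdot> ?f = f" using Comp_assoc[OF f j(1) i(1)] j(3) Id_left[OF f] by simp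
      then show ?thesis using iso_arr_Comp[OF f' 2 i] by simp
    qed blast
  qed (rule Y)
qed

end


section \<open>Schur's lemma and decompositions into simple objects\<close>

context abelian_linear_category
begin

text \<open>If two morphisms agree after \<open>f\<close>, their difference factors through the kernel.\<close>

lemma mono_if_kernel_zero:
  assumes f: "f \<in> Mor C X Y" and k: "is_kernel C i f" and K: "zero_object C (src C i)"
  shows "mono_arr C f"
  unfolding mono_arr_def
proof (intro conjI allI ballI impI)
  show "f \<in> Arr C" using f MorD by blast
next
  fix W g h assume "g \<in> Mor C W (src C f)" "h \<in> Mor C W (src C f)" and eq: "f \<cdot> g = f \<cdot> h"
  then have g: "g \<in> Mor C W X" and h: "h \<in> Mor C W X" using MorD f by metis+
  let ?d = "Plus C g (Scale C (-1) h)"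
  have d: "?d \<in> Mor C W X" using g h Plus_closed Scale_closed by blast
  have W: "W \<in> Obj C" using g MorD by blast
  have "f \<cdot> ?d = Plus C (f \<cdot> g) (Scale C (-1) (f \<cdot> h))"
    using Comp_Plus_right[OF g Scale_closed[OF h] f] Comp_Scale_right[OF h f] by simp
  also have "\<dots> = Zero C W Y"
    using Plus_neg_eq_Zero_iff eq Comp_closed[OF g f] Comp_closed[OF h f] by metis
  finally obtain u where u: "u \<in> Mor C W (src C i)" "i \<cdot> u = ?d"
    using k d W f MorD unfolding is_kernel_def by metis
  have "u = Zero C W (src C i)"
    using K W u(1) Zero_closed MorD unfolding zero_object_def by blast
  then have "?d = Zero C W X"
    using u k f MorD Comp_Zero_right W unfolding is_kernel_def by metis
  then show "g = h" using Plus_neg_eq_Zero_iff g h by blast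
qed

lemma kernel_mono:
  assumes k: "is_kernel C i f"
  shows "mono_arr C i"
proof -
  have i: "i \<in> Mor C (src C i) (src C f)" and f: "f \<in> Mor C (src C f) (tgt C f)"
    and z: "f \<cdot> i = Zero C (src C i) (tgt C f)"
    using k unfolding is_kernel_def Mor_def by auto
  show ?thesis
    unfolding mono_arr_def
  proof (intro conjI allI ballI impI)
    show "i \<in> Arr C" using i MorD by blast
  next
    fix W g h assume g: "g \<in> Mor C W (src C i)" and h: "h \<in> Mor C W (src C i)" and eq: "i \<cdot> g = i \<cdot> h"
    have W: "W \<in> Obj C" using g MorD by blast
    have "f \<cdot> (i \<cdot> g) = Zero C W (tgt C f)"
      using Comp_assoc[OF g i f] z Comp_Zero_left[OF g] f MorD by metis
    then have "\<exists>!u. u \<in> Mor C W (src C i) \<and> i \<cdot> u = i \<cdot> g"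
      using k W Comp_closed[OF g i] unfolding is_kernel_def by blast
    then show "g = h" using g h eq by metis
  qed
qed

text \<open>The kernel of \<open>f\<close> is a subobject of the simple object \<open>X\<close>; it is not all of \<open>X\<close> as \<open>f\<close> is
  nonzero, so it vanishes and \<open>f\<close> is a nonzero subobject of the simple object \<open>Y\<close>.\<close>

theorem schur_iso:
  assumes X: "simple_object C X" and Y: "simple_object C Y"
    and f: "f \<in> Mor C X Y" "f \<noteq> Zero C X Y"
  shows "iso_arr C f"
proof -
  obtain i where k: "is_kernel C i f" using kernels[OF MorD(3)[OF f(1)]] by blast
  then have i: "i \<in> Mor C (src C i) X" and z: "f \<cdot> i = Zero C (src C i) Y"
    using MorD(4,5)[OF f(1)] by (simp_all add: is_kernel_def)
  have "zero_object C (src C i) \<or> iso_arr C i"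
    using X i kernel_mono[OF k] MorD unfolding simple_object_def by metis
  then have "zero_object C (src C i)"
  proof
    assume iso: "iso_arr C i"
    have "f \<cdot> i = Zero C X Y \<cdot> i" using z Comp_Zero_left[OF i] f MorD by metis
    then have "f = Zero C X Y"
      using Comp_iso_cancel_right[OF i iso f(1)] Zero_closed f MorD by metis
    then show ?thesis using f by blast
  qed
  then have "mono_arr C f" using mono_if_kernel_zero k f by blast
  then show ?thesis using X Y f simple_Obj unfolding simple_object_def by blast
qed

end

context linear_category
begin

text \<open>The sum formula for \<open>Id C Z\<close> in the form in which it is used: a property of endomorphisms
  of \<open>Z\<close> that is preserved by addition holds for the identity as soon as it holds for all
  \<open>\<iota> i \<cdot> \<pi> i\<close>.\<close>

lemma direct_sumE:
  assumes "is_direct_sum C Z Xs"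
  obtains \<iota> \<pi> where
    "\<And>i. i < length Xs \<Longrightarrow> \<iota> i \<in> Mor C (Xs ! i) Z"
    "\<And>i. i < length Xs \<Longrightarrow> \<pi> i \<in> Mor C Z (Xs ! i)"
    "\<And>i. i < length Xs \<Longrightarrow> \<pi> i \<cdot> \<iota> i = Id C (Xs ! i)"
    "\<And>i j. \<lbrakk>i < length Xs; j < length Xs; i \<noteq> j\<rbrakk> \<Longrightarrow> \<pi> j \<cdot> \<iota> i = Zero C (Xs ! i) (Xs ! j)"
    "\<And>Q. \<lbrakk>\<And>i. i < length Xs \<Longrightarrow> Q (\<iota> i \<cdot> \<pi> i); Q (Zero C Z Z);
        \<And>g h. \<lbrakk>g \<in> Mor C Z Z; h \<in> Mor C Z Z; Q g; Q h\<rbrakk> \<Longrightarrow> Q (Plus C g h)\<rbrakk> \<Longrightarrow> Q (Id C Z)"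
proof -
  obtain \<iota> \<pi> where
    mor: "\<And>i. i < length Xs \<Longrightarrow> \<iota> i \<in> Mor C (Xs ! i) Z \<and> \<pi> i \<in> Mor C Z (Xs ! i)"
    and pi_iota: "\<And>i j. \<lbrakk>i < length Xs; j < length Xs\<rbrakk> \<Longrightarrow>
           \<pi> j \<cdot> \<iota> i = (if i = j then Id C (Xs ! i) else Zero C (Xs ! i) (Xs ! j))"
    and sum: "(\<Oplus>\<^bsub>hom_module C Z Z\<^esub>i \<in> {..<length Xs}. \<iota> i \<cdot> \<pi> i) = Id C Z"
    using assms unfolding is_direct_sum_def by blast
  have Z: "Z \<in> Obj C" using assms unfolding is_direct_sum_def by blast
  show thesis
  proof (rule that)
    fix Q :: "'m \<Rightarrow> bool"
    assume "\<And>i. i < length Xs \<Longrightarrow> Q (\<iota> i \<cdot> \<pi> i)" "Q (Zero C Z Z)"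
      "\<And>g h. \<lbrakk>g \<in> Mor C Z Z; h \<in> Mor C Z Z; Q g; Q h\<rbrakk> \<Longrightarrow> Q (Plus C g h)"
    moreover have "\<iota> i \<cdot> \<pi> i \<in> Mor C Z Z" if "i < length Xs" for i
      using mor[OF that] Comp_closed by blast
    ultimately show "Q (Id C Z)"
      using finsum_Mor_induct[of "{..<length Xs}" Z Z "\<lambda>i. \<iota> i \<cdot> \<pi> i" Q] sum Z by simp
  qed (use mor pi_iota in auto)
qed

end

context semisimple_linear_category
begin

text \<open>Simple objects detect equality of morphisms, since identities are sums of endomorphisms that
  factor through simple objects. This replaces most computations with explicit decompositions.\<close>

lemma mor_eq_on_simples:
  assumes f: "f \<in> Mor C Z W" and g: "g \<in> Mor C Z W"
    and eq: "\<And>X u. \<lbrakk>simple_object C X; u \<in> Mor C X Z\<rbrakk> \<Longrightarrow> f \<cdot> u = g \<cdot> u"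
  shows "f = g"
proof -
  have Z: "Z \<in> Obj C" and W: "W \<in> Obj C" using f MorD by auto
  obtain Xs where Xs: "\<forall>X \<in> set Xs. simple_object C X" and "is_direct_sum C Z Xs"
    using semisimple Z by blast
  from this(2) show ?thesis
  proof (cases rule: direct_sumE)
    case (1 \<iota> \<pi>)
    have "f \<cdot> Id C Z = g \<cdot> Id C Z"
    proof (rule "1"(5)[of "\<lambda>e. f \<cdot> e = g \<cdot> e"])
      fix i assume i: "i < length Xs"
      then have "f \<cdot> \<iota> i = g \<cdot> \<iota> i" using eq[OF _ 1(1)[OF i]] Xs by simp
      then show "f \<cdot> \<iota> i \<cdot> \<pi> i = g \<cdot> \<iota> i \<cdot> \<pi> i"
        using Comp_assoc[OF 1(2)[OF i] 1(1)[OF i] f] Comp_assoc[OF 1(2)[OF i] 1(1)[OF i] g] by simp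
    next
      show "f \<cdot> Zero C Z Z = g \<cdot> Zero C Z Z" using Comp_Zero_right f g Z by simp
    next
      fix a b assume "a \<in> Mor C Z Z" "b \<in> Mor C Z Z" "f \<cdot> a = g \<cdot> a" "f \<cdot> b = g \<cdot> b"
      then show "f \<cdot> Plus C a b = g \<cdot> Plus C a b" using Comp_Plus_right f g by metis
    qed
    then show ?thesis using Id_right f g by simp
  qed
qed

lemma mor_eq_into_simples:
  assumes f: "f \<in> Mor C W Z" and g: "g \<in> Mor C W Z"
    and eq: "\<And>X p. \<lbrakk>simple_object C X; p \<in> Mor C Z X\<rbrakk> \<Longrightarrow> p \<cdot> f = p \<cdot> g"
  shows "f = g"
proof -
  have Z: "Z \<in> Obj C" and W: "W \<in> Obj C" using f MorD by auto
  obtain Xs where Xs: "\<forall>X \<in> set Xs. simple_object C X" and "is_direct_sum C Z Xs"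
    using semisimple Z by blast
  from this(2) show ?thesis
  proof (cases rule: direct_sumE)
    case (1 \<iota> \<pi>)
    have "Id C Z \<cdot> f = Id C Z \<cdot> g"
    proof (rule "1"(5)[of "\<lambda>e. e \<cdot> f = e \<cdot> g"])
      fix i assume i: "i < length Xs"
      then have "\<pi> i \<cdot> f = \<pi> i \<cdot> g" using eq[OF _ 1(2)[OF i]] Xs by simp
      then show "(\<iota> i \<cdot> \<pi> i) \<cdot> f = (\<iota> i \<cdot> \<pi> i) \<cdot> g"
        using Comp_assoc[OF f 1(2)[OF i] 1(1)[OF i]] Comp_assoc[OF g 1(2)[OF i] 1(1)[OF i]] by simp
    next
      show "Zero C Z Z \<cdot> f = Zero C Z Z \<cdot> g" using Comp_Zero_left f g Z by simp
    next
      fix a b assume "a \<in> Mor C Z Z" "b \<in> Mor C Z Z" "a \<cdot> f = a \<cdot> g" "b \<cdot> f = b \<cdot> g"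
      then show "Plus C a b \<cdot> f = Plus C a b \<cdot> g" using Comp_Plus_left f g by metis
    qed
    then show ?thesis using Id_left f g by simp
  qed
qed

text \<open>Some morphism from \<open>Z\<close> to a simple object does not kill \<open>u\<close>, and by Schur's lemma the
  composite is invertible.\<close>

lemma simple_retraction:
  assumes X: "simple_object C X" and u: "u \<in> Mor C X Z" "u \<noteq> Zero C X Z"
  obtains p where "p \<in> Mor C Z X" "p \<cdot> u = Id C X"
proof -
  have XZ: "X \<in> Obj C" "Z \<in> Obj C" using u MorD by auto
  obtain Y q where Y: "simple_object C Y" and q: "q \<in> Mor C Z Y" "q \<cdot> u \<noteq> q \<cdot> Zero C X Z"
    using mor_eq_into_simples[OF u(1) Zero_closed[OF XZ]] u(2) by blast
  have qu: "q \<cdot> u \<in> Mor C X Y" using u q Comp_closed by blast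
  have "q \<cdot> u \<noteq> Zero C X Y" using q Comp_Zero_right XZ by metis
  then have iso: "iso_arr C (q \<cdot> u)" using schur_iso X Y qu by blast
  note j = inv_arr[OF qu iso]
  show thesis
  proof (rule that)
    show "inv_arr C (q \<cdot> u) \<cdot> q \<in> Mor C Z X" using q j Comp_closed by blast
    show "(inv_arr C (q \<cdot> u) \<cdot> q) \<cdot> u = Id C X" using Comp_assoc[OF u(1) q(1) j(1)] j(2) by simp
  qed
qed

lemma simple_section:
  assumes X: "simple_object C X" and p: "p \<in> Mor C Z X" "p \<noteq> Zero C Z X"
  obtains u where "u \<in> Mor C X Z" "p \<cdot> u = Id C X"
proof -
  have XZ: "X \<in> Obj C" "Z \<in> Obj C" using p MorD by auto
  obtain Y v where Y: "simple_object C Y" and v: "v \<in> Mor C Y Z" "p \<cdot> v \<noteq> Zero C Z X \<cdot> v"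
    using mor_eq_on_simples[OF p(1) Zero_closed[OF XZ(2,1)]] p(2) by blast
  have pv: "p \<cdot> v \<in> Mor C Y X" using v p Comp_closed by blast
  have "p \<cdot> v \<noteq> Zero C Y X" using v Comp_Zero_left XZ by metis
  then have iso: "iso_arr C (p \<cdot> v)" using schur_iso X Y pv by blast
  note j = inv_arr[OF pv iso]
  show thesis
  proof (rule that)
    show "v \<cdot> inv_arr C (p \<cdot> v) \<in> Mor C X Z" using v j Comp_closed by blast
    show "p \<cdot> v \<cdot> inv_arr C (p \<cdot> v) = Id C X" using Comp_assoc[OF j(1) v(1) p(1)] j(3) by simp
  qed
qed

end

text \<open>The classes of the simple constituents. Defining them by nonzero morphisms makes them
  independent of the choice of a decomposition.\<close>

definition support :: "('o, 'm, 'k, 'z) linear_cat_scheme \<Rightarrow> 'o \<Rightarrow> 'o set set" where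
  "support C Z = iso_class C ` {X. simple_object C X \<and> (\<exists>u \<in> Mor C X Z. u \<noteq> Zero C X Z)}"

lemma support_subset: "support C Z \<subseteq> simple_classes C"
  unfolding support_def simple_classes_def by blast

context linear_category
begin

lemma nonzero_Comp_iso_right:
  assumes "i \<in> Mor C X Y" "iso_arr C i" "u \<in> Mor C Y Z" "u \<noteq> Zero C Y Z"
  shows "u \<cdot> i \<noteq> Zero C X Z"
proof -
  have "Zero C X Z = Zero C Y Z \<cdot> i" using Comp_Zero_left[OF assms(1)] assms(3) MorD by metis
  then show ?thesis
    using Comp_iso_cancel_right[OF assms(1,2,3)] assms(1,3,4) Zero_closed MorD by metis
qed

lemma nonzero_Comp_iso_left:
  assumes "i \<in> Mor C Y Z" "iso_arr C i" "u \<in> Mor C X Y" "u \<noteq> Zero C X Y"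
  shows "i \<cdot> u \<noteq> Zero C X Z"
proof -
  have "Zero C X Z = i \<cdot> Zero C X Y" using Comp_Zero_right[OF assms(1)] assms(3) MorD by metis
  then show ?thesis
    using Comp_iso_cancel_left[OF assms(1,2,3)] assms(1,3,4) Zero_closed MorD by metis
qed

lemma support_iff:
  assumes X: "simple_object C X"
  shows "iso_class C X \<in> support C Z \<longleftrightarrow> (\<exists>u \<in> Mor C X Z. u \<noteq> Zero C X Z)"
proof
  assume "iso_class C X \<in> support C Z"
  then obtain Y u where Y: "simple_object C Y" "iso_class C X = iso_class C Y"
    and u: "u \<in> Mor C Y Z" "u \<noteq> Zero C Y Z"
    unfolding support_def by auto
  then have "isomorphic C X Y" using iso_class_eq_iff X simple_Obj by blast
  then obtain i where "i \<in> Mor C X Y" "iso_arr C i" unfolding isomorphic_def by blast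
  then show "\<exists>u \<in> Mor C X Z. u \<noteq> Zero C X Z"
    using u nonzero_Comp_iso_right Comp_closed by blast
qed (use X in \<open>auto simp: support_def\<close>)

lemma support_isomorphic_subset:
  assumes "isomorphic C Z W"
  shows "support C Z \<subseteq> support C W"
proof
  fix c assume "c \<in> support C Z"
  then obtain X u where X: "simple_object C X" "c = iso_class C X"
    and u: "u \<in> Mor C X Z" "u \<noteq> Zero C X Z"
    unfolding support_def by auto
  obtain i where "i \<in> Mor C Z W" "iso_arr C i" using assms unfolding isomorphic_def by blast
  then have "i \<cdot> u \<in> Mor C X W" "i \<cdot> u \<noteq> Zero C X W"
    using u nonzero_Comp_iso_left Comp_closed by blast+
  then show "c \<in> support C W" using X support_iff by blast
qed

lemma support_isomorphic: "isomorphic C Z W \<Longrightarrow> support C Z = support C W"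
  using support_isomorphic_subset isomorphic_sym by blast

lemma simple_class_rep:
  assumes "c \<in> simple_classes C"
  shows "simple_object C (class_rep c)" "iso_class C (class_rep c) = c"
proof -
  obtain X where X: "simple_object C X" "c = iso_class C X"
    using assms unfolding simple_classes_def by blast
  note X' = simple_Obj[OF X(1)]
  show "simple_object C (class_rep c)"
    using simple_isomorphic class_rep_iso_class(2)[OF X'] X by simp
  show "iso_class C (class_rep c) = c"
    using class_rep_iso_class[OF X'] iso_class_eq_iff[OF X'] X by auto
qed

end

context semisimple_linear_category
begin

lemma support_simple:
  assumes "simple_object C X"
  shows "support C X = {iso_class C X}"
proof
  show "{iso_class C X} \<subseteq> support C X"
    using support_iff[OF assms] simple_Id_nonzero[OF assms] Id_closed simple_Obj[OF assms] by blast
  show "support C X \<subseteq> {iso_class C X}"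
  proof
    fix c assume "c \<in> support C X"
    then obtain Y u where Y: "simple_object C Y" "c = iso_class C Y"
      and u: "u \<in> Mor C Y X" "u \<noteq> Zero C Y X"
      unfolding support_def by auto
    then have "isomorphic C Y X" using schur_iso assms isomorphicI by blast
    then show "c \<in> {iso_class C X}" using Y iso_class_eq_iff simple_Obj assms by simp
  qed
qed

lemma support_direct_sum:
  assumes simple: "\<forall>X \<in> set Xs. simple_object C X" and sum: "is_direct_sum C Z Xs"
  shows "support C Z = iso_class C ` set Xs"
  using sum
proof (cases rule: direct_sumE)
  case (1 \<iota> \<pi>)
  have Z: "Z \<in> Obj C" using sum unfolding is_direct_sum_def by blast
  show ?thesis
  proof
    show "iso_class C ` set Xs \<subseteq> support C Z"
    proof
      fix c assume "c \<in> iso_class C ` set Xs"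
      then obtain i where i: "i < length Xs" "c = iso_class C (Xs ! i)"
        by (auto simp: in_set_conv_nth)
      have s: "simple_object C (Xs ! i)" using simple i by simp
      have "\<iota> i \<noteq> Zero C (Xs ! i) Z"
        using 1(3)[OF i(1)] Comp_Zero_right[OF 1(2)[OF i(1)]] simple_Id_nonzero[OF s] simple_Obj[OF s]
        by metis
      then show "c \<in> support C Z" using support_iff s 1(1) i by blast
    qed
  next
    show "support C Z \<subseteq> iso_class C ` set Xs"
    proof
      fix c assume "c \<in> support C Z"
      then obtain Y u where Y: "simple_object C Y" "c = iso_class C Y"
        and u: "u \<in> Mor C Y Z" "u \<noteq> Zero C Y Z"
        unfolding support_def by auto
      have YO: "Y \<in> Obj C" using Y simple_Obj by blast
      have "\<exists>i < length Xs. \<pi> i \<cdot> u \<noteq> Zero C Y (Xs ! i)"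
      proof (rule ccontr)
        assume *: "\<not> ?thesis"
        have "Id C Z \<cdot> u = Zero C Y Z"
        proof (rule 1(5)[of "\<lambda>e. e \<cdot> u = Zero C Y Z"])
          fix i assume i: "i < length Xs"
          then show "(\<iota> i \<cdot> \<pi> i) \<cdot> u = Zero C Y Z"
            using * Comp_assoc[OF u(1) 1(2)[OF i] 1(1)[OF i]] Comp_Zero_right[OF 1(1)[OF i] YO] by simp
        next
          show "Zero C Z Z \<cdot> u = Zero C Y Z" using Comp_Zero_left u Z by blast
        next
          fix g h assume "g \<in> Mor C Z Z" "h \<in> Mor C Z Z" "g \<cdot> u = Zero C Y Z" "h \<cdot> u = Zero C Y Z"
          then show "Plus C g h \<cdot> u = Zero C Y Z"
            using Comp_Plus_left[OF u(1)] Plus_Zero_left[OF Zero_closed[OF YO Z]] by simp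
        qed
        then show False using u Id_left by simp
      qed
      then obtain i where i: "i < length Xs" "\<pi> i \<cdot> u \<noteq> Zero C Y (Xs ! i)" by blast
      have s: "simple_object C (Xs ! i)" using simple i by simp
      then have "isomorphic C Y (Xs ! i)"
        using schur_iso[OF Y(1) s Comp_closed[OF u(1) 1(2)[OF i(1)]] i(2)]
          isomorphicI Comp_closed[OF u(1) 1(2)[OF i(1)]] by blast
      then have "c = iso_class C (Xs ! i)" using Y iso_class_eq_iff YO simple_Obj s by blast
      then show "c \<in> iso_class C ` set Xs" using i by simp
    qed
  qed
qed

text \<open>\<open>K0_class\<close> chooses a decomposition. Its support does not depend on the choice, which is all
  that the grading needs to know about the Grothendieck ring.\<close>

lemma keys_K0_class:
  assumes "Z \<in> Obj C"
  shows "Poly_Mapping.keys (K0_class C Z) = support C Z"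
proof -
  let ?P = "\<lambda>c. \<exists>Xs. (\<forall>X \<in> set Xs. simple_object C X) \<and> is_direct_sum C Z Xs \<and>
     c = (\<Sum>X \<leftarrow> Xs. frag_of (iso_class C X))"
  have "\<exists>c. ?P c" using semisimple[OF assms] by blast
  then have "?P (K0_class C Z)" unfolding K0_class_def by (rule someI_ex)
  then obtain Xs where Xs: "\<forall>X \<in> set Xs. simple_object C X" "is_direct_sum C Z Xs"
    "K0_class C Z = (\<Sum>X \<leftarrow> Xs. frag_of (iso_class C X))" by blast
  \<comment> \<open>Nothing cancels, because all coefficients are nonnegative.\<close>
  have "Poly_Mapping.lookup (\<Sum>X \<leftarrow> Ys. frag_of (iso_class C X)) c \<ge> 0 \<and>
      (Poly_Mapping.lookup (\<Sum>X \<leftarrow> Ys. frag_of (iso_class C X)) c > 0 \<longleftrightarrow> c \<in> iso_class C ` set Ys)" for Ys c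
    by (induction Ys) (auto simp: lookup_add)
  note coeff = this
  have "c \<in> Poly_Mapping.keys (\<Sum>X \<leftarrow> Xs. frag_of (iso_class C X)) \<longleftrightarrow> c \<in> iso_class C ` set Xs" for c
    using coeff[of Xs c] by (auto simp only: in_keys_iff order_le_less less_irrefl)
  then have "Poly_Mapping.keys (K0_class C Z) = iso_class C ` set Xs"
    unfolding Xs(3) by blast
  then show ?thesis using support_direct_sum Xs by simp
qed

lemma support_nonempty:
  assumes "Z \<in> Obj C" "\<not> zero_object C Z"
  shows "support C Z \<noteq> {}"
proof
  assume *: "support C Z = {}"
  have "Id C Z = Zero C Z Z"
  proof (rule mor_eq_on_simples)
    fix X u assume X: "simple_object C X" and u: "u \<in> Mor C X Z"
    then have "u = Zero C X Z" using * support_iff by blast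
    then show "Id C Z \<cdot> u = Zero C Z Z \<cdot> u"
      using u Id_left Comp_Zero_left assms by metis
  qed (use assms Id_closed Zero_closed in auto)
  then show False using zero_object_iff assms by blast
qed

end


section \<open>Endomorphisms of simple objects\<close>

text \<open>Gaussian elimination: an equation with a nonzero coefficient is used to eliminate one unknown.\<close>

lemma homogeneous_system_solvable:
  fixes c :: "'j \<Rightarrow> 's \<Rightarrow> 'k::field"
  assumes "finite S" "finite J" "card S < card J"
  shows "\<exists>a. (\<exists>j \<in> J. a j \<noteq> 0) \<and> (\<forall>s \<in> S. (\<Sum>j \<in> J. a j * c j s) = 0)"
  using assms
proof (induction S arbitrary: J c)
  case empty
  then have "J \<noteq> {}" by auto
  then show ?case by (intro exI[of _ "\<lambda>_. 1"]) auto
next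
  case (insert s S)
  show ?case
  proof (cases "\<forall>j \<in> J. c j s = 0")
    case True
    obtain a where "\<exists>j \<in> J. a j \<noteq> 0" "\<forall>s \<in> S. (\<Sum>j \<in> J. a j * c j s) = 0"
      using insert.IH[of J c] insert.hyps insert.prems by (metis Suc_lessD card_insert_disjoint)
    then show ?thesis using True by (intro exI[of _ a]) auto
  next
    case False
    then obtain k where k: "k \<in> J" "c k s \<noteq> 0" by blast
    let ?J = "J - {k}"
    have "card S < card ?J" using insert k by simp
    then obtain a where a: "\<exists>j \<in> ?J. a j \<noteq> 0"
      "\<And>t. t \<in> S \<Longrightarrow> (\<Sum>j \<in> ?J. a j * (c j t - c j s / c k s * c k t)) = 0"
      using insert.IH[of ?J "\<lambda>j t. c j t - c j s / c k s * c k t"] insert.prems by auto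
    define m where "m = (\<Sum>j \<in> ?J. a j * c j s) / c k s"
    define b where "b = a(k := - m)"
    have b_sum: "(\<Sum>j \<in> J. b j * c j t) = (\<Sum>j \<in> ?J. a j * c j t) - m * c k t" for t
    proof -
      have "(\<Sum>j \<in> J. b j * c j t) = b k * c k t + (\<Sum>j \<in> ?J. b j * c j t)"
        using sum.remove[OF insert.prems(1) k(1)] by blast
      also have "(\<Sum>j \<in> ?J. b j * c j t) = (\<Sum>j \<in> ?J. a j * c j t)"
        by (rule sum.cong) (auto simp: b_def)
      finally show ?thesis by (simp add: b_def)
    qed
    have "(\<Sum>j \<in> J. b j * c j t) = 0" if "t \<in> S" for t
      using a(2)[OF that] unfolding b_sum m_def
      by (simp add: right_diff_distrib sum_subtractf sum_divide_distrib sum_distrib_right mult.assoc)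
    moreover have "(\<Sum>j \<in> J. b j * c j s) = 0"
      unfolding b_sum m_def using k by simp
    ultimately show ?thesis
      using a(1) by (intro exI[of _ b]) (auto simp: b_def)
  qed
qed

context fusion_category
begin

text \<open>Horner evaluation of a polynomial at an endomorphism.\<close>

definition poly_at :: "'o \<Rightarrow> 'm \<Rightarrow> 'k poly \<Rightarrow> 'm" where
  "poly_at X f p = fold_coeffs (\<lambda>a e. Plus C (Scale C a (Id C X)) (f \<cdot> e)) p (Zero C X X)"

lemma poly_at_0: "poly_at X f 0 = Zero C X X"
  by (simp add: poly_at_def)

lemma poly_at_pCons:
  assumes f: "f \<in> Mor C X X"
  shows "poly_at X f (pCons a p) = Plus C (Scale C a (Id C X)) (f \<cdot> poly_at X f p)"
proof (cases "a = 0 \<and> p = 0")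
  case True
  have X: "X \<in> Obj C" using f MorD by blast
  then show ?thesis
    using True f by (simp add: poly_at_0 Scale_0[OF Id_closed] Comp_Zero_right Plus_Zero_left Zero_closed)
qed (auto simp: poly_at_def)

lemma poly_at_closed:
  assumes f: "f \<in> Mor C X X"
  shows "poly_at X f p \<in> Mor C X X"
proof (induction p)
  case 0
  then show ?case using f MorD Zero_closed by (simp add: poly_at_0)
next
  case (pCons a p)
  then show ?case
    using f MorD Plus_closed Scale_closed Id_closed Comp_closed by (simp add: poly_at_pCons)
qed

lemma poly_at_add:
  assumes f: "f \<in> Mor C X X"
  shows "poly_at X f (p + q) = Plus C (poly_at X f p) (poly_at X f q)"
proof (induction p q rule: poly_induct2)
  case 0
  then show ?case using f MorD Zero_closed Plus_Zero_left by (simp add: poly_at_0)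
next
  case (pCons a p b q)
  let ?I = "Id C X" and ?p = "poly_at X f p" and ?q = "poly_at X f q"
  have X: "X \<in> Obj C" using f MorD by blast
  note I = Id_closed[OF X]
  note cl = poly_at_closed[OF f] Scale_closed[OF I] Comp_closed[OF poly_at_closed[OF f] f] Plus_closed
  have "Plus C (Plus C (Scale C a ?I) (Scale C b ?I)) (Plus C (f \<cdot> ?p) (f \<cdot> ?q))
      = Plus C (Plus C (Scale C a ?I) (f \<cdot> ?p)) (Plus C (Scale C b ?I) (f \<cdot> ?q))"
    by (simp add: Plus_assoc[of _ X X] Plus_left_commute[of "Scale C b ?I" X X "f \<cdot> ?p"] cl)
  then show ?case
    using pCons by (simp add: poly_at_pCons[OF f] Scale_add[OF I] Comp_Plus_right[OF cl(1) cl(1) f])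
qed

lemma poly_at_smult:
  assumes f: "f \<in> Mor C X X"
  shows "poly_at X f (smult a p) = Scale C a (poly_at X f p)"
proof (induction p)
  case 0
  then show ?case using f MorD Scale_Zero by (simp add: poly_at_0)
next
  case (pCons b p)
  have X: "X \<in> Obj C" using f MorD by blast
  note I = Id_closed[OF X]
  show ?case
    using pCons(2) by (simp add: poly_at_pCons[OF f] Scale_Plus[OF Scale_closed[OF I]
      Comp_closed[OF poly_at_closed[OF f] f]] Scale_Scale[OF I] Comp_Scale_right[OF poly_at_closed[OF f] f])
qed

text \<open>The endomorphisms form a space spanned by finitely many vectors, so the powers of \<open>f\<close> are
  linearly dependent.\<close>

lemma annihilating_poly:
  assumes f: "f \<in> Mor C X X"
  obtains p where "p \<noteq> 0" "poly_at X f p = Zero C X X"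
proof -
  have X: "X \<in> Obj C" using f MorD by blast
  interpret M: Module.module "ring_of_type_algebra :: 'k ring" "hom_module C X X"
    using hom_module X by blast
  obtain S where S: "finite S" "S \<subseteq> Mor C X X"
    and span: "\<And>g. g \<in> Mor C X X \<Longrightarrow> \<exists>c. g = (\<Oplus>\<^bsub>hom_module C X X\<^esub>s \<in> S. Scale C (c s) s)"
    using finite_dimensional[OF X X] by metis
  \<comment> \<open>The coordinates in the spanning set are not unique, but the combination map is linear, and
    a relation between coordinate vectors gives a relation between the powers of \<open>f\<close>.\<close>
  define comb where "comb = (\<lambda>c :: 'm \<Rightarrow> 'k. \<Oplus>\<^bsub>hom_module C X X\<^esub>s \<in> S. Scale C (c s) s)"
  have sc: "(\<lambda>s. Scale C (c s) s) \<in> S \<rightarrow> Mor C X X" for c using S Scale_closed by blast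
  have comb_add: "comb (\<lambda>s. c s + d s) = Plus C (comb c) (comb d)" for c d
  proof -
    have "comb (\<lambda>s. c s + d s) = (\<Oplus>\<^bsub>hom_module C X X\<^esub>s \<in> S. Scale C (c s) s \<oplus>\<^bsub>hom_module C X X\<^esub> Scale C (d s) s)"
      unfolding comb_def
      by (rule M.finsum_cong') (use S Scale_add Scale_closed Plus_closed in \<open>auto simp: subset_eq\<close>)
    then show ?thesis
      using M.finsum_addf[of "\<lambda>s. Scale C (c s) s" S "\<lambda>s. Scale C (d s) s"] sc by (simp add: comb_def)
  qed
  have comb_scale: "comb (\<lambda>s. a * c s) = Scale C a (comb c)" for a c
  proof -
    have "comb (\<lambda>s. a * c s) = (\<Oplus>\<^bsub>hom_module C X X\<^esub>s \<in> S. a \<odot>\<^bsub>hom_module C X X\<^esub> Scale C (c s) s)"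
      unfolding comb_def
      by (rule M.finsum_cong') (use S Scale_Scale Scale_closed in \<open>auto simp: subset_eq\<close>)
    then show ?thesis
      using M.finsum_smult_ldistr[OF S(1), of a "\<lambda>s. Scale C (c s) s"] sc
      by (simp add: comb_def ring_of_type_algebra_def)
  qed
  have comb_0: "comb (\<lambda>s. 0) = Zero C X X"
    using comb_scale[of 0 "\<lambda>s. 0"] Scale_0[of "comb (\<lambda>s. 0)" X X] M.finsum_closed[of _ S] sc
    by (simp add: comb_def)
  have "\<forall>j. \<exists>c. poly_at X f (monom 1 j) = comb c"
    unfolding comb_def using span poly_at_closed[OF f] by blast
  then obtain c where c: "\<And>j. poly_at X f (monom 1 j) = comb (c j)" by metis
  let ?J = "{..card S}"
  obtain a where a: "\<exists>j \<in> ?J. a j \<noteq> 0" "\<forall>s \<in> S. (\<Sum>j \<in> ?J. a j * c j s) = 0"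
    using homogeneous_system_solvable[OF S(1), of ?J c] by auto
  let ?p = "\<Sum>j \<in> ?J. monom (a j) j"
  have "poly_at X f (\<Sum>j \<in> J. monom (a j) j) = comb (\<lambda>s. \<Sum>j \<in> J. a j * c j s)" if "finite J" for J
    using that
  proof induction
    case empty
    then show ?case by (simp add: poly_at_0 comb_0)
  next
    case (insert j J)
    have "monom (a j) j = smult (a j) (monom 1 j)" by (simp add: smult_monom)
    then show ?case
      using insert by (simp add: poly_at_add[OF f] poly_at_smult[OF f] c comb_add comb_scale)
  qed
  then have "poly_at X f ?p = comb (\<lambda>s. \<Sum>j \<in> ?J. a j * c j s)" by blast
  also have "\<dots> = comb (\<lambda>s. 0)"
    unfolding comb_def
    by (rule M.finsum_cong') (use a(2) S Scale_closed in \<open>auto simp: subset_eq\<close>)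
  finally have "poly_at X f ?p = Zero C X X" using comb_0 by simp
  moreover have "?p \<noteq> 0"
  proof -
    obtain j where j: "j \<in> ?J" "a j \<noteq> 0" using a(1) by blast
    then have "coeff ?p j = a j" by (simp add: coeff_sum if_distrib cong: if_cong)
    then show ?thesis using j by auto
  qed
  ultimately show thesis using that by blast
qed

text \<open>Take an annihilating polynomial \<open>p\<close> of minimal degree and a root \<open>\<mu>\<close> of it, say
  \<open>p = (x - \<mu>) q\<close>. Then \<open>f - \<mu>\<close> kills \<open>q(f)\<close>, which is nonzero by minimality, so \<open>f - \<mu>\<close> is not
  invertible and thus zero.\<close>

theorem schur_scalar:
  assumes X: "simple_object C X" and f: "f \<in> Mor C X X"
  obtains c where "f = Scale C c (Id C X)"
proof -
  have XO: "X \<in> Obj C" using simple_Obj X by blast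
  note I = Id_closed[OF XO]
  let ?P = "\<lambda>p. p \<noteq> 0 \<and> poly_at X f p = Zero C X X"
  obtain p where p: "?P p" and min: "\<And>q. ?P q \<Longrightarrow> degree p \<le> degree q"
    using annihilating_poly[OF f] ex_has_least_nat[of ?P _ degree] by metis
  have "degree p \<noteq> 0"
  proof
    assume "degree p = 0"
    then obtain a where a: "p = [:a:]" using degree_0_id by metis
    then have "Scale C a (Id C X) = Zero C X X"
      using p f XO Scale_closed[OF I]
      by (simp add: poly_at_pCons poly_at_0 Comp_Zero_right Plus_Zero_right)
    then show False using Scale_eq_Zero_iff[OF I simple_Id_nonzero[OF X]] a p by simp
  qed
  then obtain \<mu> where "poly p \<mu> = 0" using alg_closed_imp_poly_has_root[of p] by auto
  then obtain q where q: "p = [:-\<mu>, 1:] * q" using poly_eq_0_iff_dvd dvdE by metis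
  have "q \<noteq> 0" using p q by auto
  moreover have "degree p = Suc (degree q)" unfolding q using \<open>q \<noteq> 0\<close> degree_mult_eq[of "[:-\<mu>, 1:]" q]
    by (simp del: mult_pCons_left)
  ultimately have eq: "poly_at X f q \<noteq> Zero C X X" using min[of q] by auto
  let ?g = "Plus C f (Scale C (-1) (Scale C \<mu> (Id C X)))" and ?e = "poly_at X f q"
  note e = poly_at_closed[OF f, of q]
  note cl = Scale_closed[OF I] Scale_closed[OF Scale_closed[OF I]]
  have g: "?g \<in> Mor C X X" using f cl Plus_closed by blast
  have pq: "p = pCons 0 q + smult (-\<mu>) q" using q by simp
  have "poly_at X f p = Plus C (f \<cdot> ?e) (Scale C (-\<mu>) ?e)"
    unfolding pq poly_at_add[OF f] poly_at_smult[OF f] poly_at_pCons[OF f] Scale_0[OF I]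
      Plus_Zero_left[OF Comp_closed[OF e f]] ..
  also have "\<dots> = ?g \<cdot> ?e"
    using Comp_Plus_left[OF e f cl(2)] Comp_Scale_left[OF e cl(1)] Comp_Scale_left[OF e I]
      Id_left[OF e] Scale_Scale[OF e] by simp
  finally have ge: "?g \<cdot> ?e = Zero C X X" using p by simp
  have "?g = Zero C X X"
  proof (rule ccontr)
    assume "?g \<noteq> Zero C X X"
    then have "iso_arr C ?g" using schur_iso X g by blast
    then show False using nonzero_Comp_iso_left[OF g _ e eq] ge by blast
  qed
  then have "f = Scale C \<mu> (Id C X)" using Plus_neg_eq_Zero_iff f cl by blast
  then show thesis using that by blast
qed

end

section \<open>Duality\<close>

text \<open>Computations with composites of many morphisms are done by rewriting. For this the typing
  premises have to be stated in terms of \<open>src\<close> and \<open>tgt\<close>, so that the intermediate objects do not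
  occur as free variables.\<close>

context category
begin

lemma Arr_Mor: "f \<in> Arr C \<Longrightarrow> f \<in> Mor C (src C f) (tgt C f)"
  by (simp add: Mor_def)

lemma Mor_iff: "f \<in> Mor C X Y \<longleftrightarrow> f \<in> Arr C \<and> src C f = X \<and> tgt C f = Y"
  by (simp add: Mor_def)

lemma arr_Comp:
  assumes "f \<in> Arr C" "g \<in> Arr C" "tgt C f = src C g"
  shows "g \<cdot> f \<in> Arr C" "src C (g \<cdot> f) = src C f" "tgt C (g \<cdot> f) = tgt C g"
  using Comp_closed[of f "src C f" "src C g" g "tgt C g"] assms by (simp_all add: Mor_def)

lemma arr_Id: "X \<in> Obj C \<Longrightarrow> Id C X \<in> Arr C" "X \<in> Obj C \<Longrightarrow> src C (Id C X) = X"
  "X \<in> Obj C \<Longrightarrow> tgt C (Id C X) = X"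
  using Id_closed by (simp_all add: Mor_def)

lemma arr_Comp_assoc:
  "\<lbrakk>f \<in> Arr C; g \<in> Arr C; h \<in> Arr C; tgt C f = src C g; tgt C g = src C h\<rbrakk>
    \<Longrightarrow> (h \<cdot> g) \<cdot> f = h \<cdot> (g \<cdot> f)"
  using Comp_assoc[of f "src C f" "src C g" g "src C h" h "tgt C h"] by (simp add: Mor_def)

lemma arr_Id_left: "\<lbrakk>f \<in> Arr C; tgt C f = Y\<rbrakk> \<Longrightarrow> Id C Y \<cdot> f = f"
  using Id_left Arr_Mor by blast

lemma arr_Id_right: "\<lbrakk>f \<in> Arr C; src C f = X\<rbrakk> \<Longrightarrow> f \<cdot> Id C X = f"
  using Id_right Arr_Mor by blast

lemmas arr_simps = arr_Comp arr_Id arr_Comp_assoc arr_Id_left arr_Id_right src_closed tgt_closed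

lemma iso_of_square:
  assumes k: "k \<in> Mor C Y Z" and i: "i \<in> Mor C X Y" "iso_arr C i"
    and j: "j \<in> Mor C X Z" "iso_arr C j" and eq: "k \<cdot> i = j"
  shows "iso_arr C k"
proof -
  have "k = j \<cdot> inv_arr C i" using inv_arr_Comp_cancel(3)[OF i k] eq by simp
  then show ?thesis using iso_arr_Comp[OF inv_arr(1)[OF i] iso_arr_inv[OF i] j] by simp
qed

lemma iso_of_square':
  assumes k: "k \<in> Mor C X Y" and i: "i \<in> Mor C Y Z" "iso_arr C i"
    and j: "j \<in> Mor C X Z" "iso_arr C j" and eq: "i \<cdot> k = j"
  shows "iso_arr C k"
proof -
  have "k = inv_arr C i \<cdot> j" using inv_arr_Comp_cancel(1)[OF i k] eq by simp
  then show ?thesis using iso_arr_Comp[OF j inv_arr(1)[OF i] iso_arr_inv[OF i]] by simp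
qed

end

context tensor_category
begin

lemma arr_Tens:
  assumes "f \<in> Arr C" "g \<in> Arr C"
  shows "f \<boxtimes>\<^sub>m g \<in> Arr C" "src C (f \<boxtimes>\<^sub>m g) = src C f \<boxtimes> src C g"
    "tgt C (f \<boxtimes>\<^sub>m g) = tgt C f \<boxtimes> tgt C g"
  using TensArr_closed[OF Arr_Mor Arr_Mor, OF assms] by (simp_all add: Mor_def)

lemma arr_interchange:
  "\<lbrakk>f \<in> Arr C; f' \<in> Arr C; g \<in> Arr C; g' \<in> Arr C; tgt C f = src C f'; tgt C g = src C g'\<rbrakk>
    \<Longrightarrow> (f' \<boxtimes>\<^sub>m g') \<cdot> (f \<boxtimes>\<^sub>m g) = (f' \<cdot> f) \<boxtimes>\<^sub>m (g' \<cdot> g)"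
  using Tens_Comp[of f "src C f" "src C f'" f' "tgt C f'" g "src C g" "src C g'" g' "tgt C g'"]
  by (simp add: Mor_def)

lemma arr_interchange':
  assumes "f \<in> Arr C" "f' \<in> Arr C" "g \<in> Arr C" "g' \<in> Arr C" "tgt C f = src C f'" "tgt C g = src C g'"
    "x \<in> Arr C" "tgt C x = src C f \<boxtimes> src C g"
  shows "(f' \<boxtimes>\<^sub>m g') \<cdot> ((f \<boxtimes>\<^sub>m g) \<cdot> x) = ((f' \<cdot> f) \<boxtimes>\<^sub>m (g' \<cdot> g)) \<cdot> x"
  using assms by (simp add: arr_simps arr_Tens flip: arr_interchange arr_Comp_assoc)

lemma arr_Assoc:
  assumes "X \<in> Obj C" "Y \<in> Obj C" "Z \<in> Obj C"
  shows "Assoc C X Y Z \<in> Arr C" "src C (Assoc C X Y Z) = (X \<boxtimes> Y) \<boxtimes> Z"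
    "tgt C (Assoc C X Y Z) = X \<boxtimes> (Y \<boxtimes> Z)"
    "inv_arr C (Assoc C X Y Z) \<in> Arr C" "src C (inv_arr C (Assoc C X Y Z)) = X \<boxtimes> (Y \<boxtimes> Z)"
    "tgt C (inv_arr C (Assoc C X Y Z)) = (X \<boxtimes> Y) \<boxtimes> Z"
    "inv_arr C (Assoc C X Y Z) \<cdot> Assoc C X Y Z = Id C ((X \<boxtimes> Y) \<boxtimes> Z)"
    "Assoc C X Y Z \<cdot> inv_arr C (Assoc C X Y Z) = Id C (X \<boxtimes> (Y \<boxtimes> Z))"
  using Assoc_closed[OF assms] inv_arr[OF Assoc_closed Assoc_iso, OF assms assms]
  by (simp_all add: Mor_def)

lemma arr_Assoc_cancel:
  assumes "X \<in> Obj C" "Y \<in> Obj C" "Z \<in> Obj C" "f \<in> Arr C"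
  shows "tgt C f = (X \<boxtimes> Y) \<boxtimes> Z \<Longrightarrow> inv_arr C (Assoc C X Y Z) \<cdot> (Assoc C X Y Z \<cdot> f) = f"
    "tgt C f = X \<boxtimes> (Y \<boxtimes> Z) \<Longrightarrow> Assoc C X Y Z \<cdot> (inv_arr C (Assoc C X Y Z) \<cdot> f) = f"
  using inv_arr_Comp_cancel[OF Assoc_closed Assoc_iso, OF assms(1-3) assms(1-3)] Arr_Mor[OF assms(4)]
  by metis+

lemma arr_unitors: "Unit C \<in> Obj C" "\<lbrakk>X \<in> Obj C; Y \<in> Obj C\<rbrakk> \<Longrightarrow> X \<boxtimes> Y \<in> Obj C"
  "X \<in> Obj C \<Longrightarrow> LUnit C X \<in> Arr C" "X \<in> Obj C \<Longrightarrow> src C (LUnit C X) = Unit C \<boxtimes> X"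
  "X \<in> Obj C \<Longrightarrow> tgt C (LUnit C X) = X"
  "X \<in> Obj C \<Longrightarrow> RUnit C X \<in> Arr C" "X \<in> Obj C \<Longrightarrow> src C (RUnit C X) = X \<boxtimes> Unit C"
  "X \<in> Obj C \<Longrightarrow> tgt C (RUnit C X) = X"
  using LUnit_closed RUnit_closed Unit_closed Tens_closed by (simp_all add: Mor_def)

lemmas tens_simps = arr_simps arr_Tens arr_Assoc arr_Assoc_cancel arr_unitors Tens_Id

lemma arr_Assoc_natural:
  assumes "f \<in> Arr C" "g \<in> Arr C" "h \<in> Arr C"
  shows "Assoc C (tgt C f) (tgt C g) (tgt C h) \<cdot> ((f \<boxtimes>\<^sub>m g) \<boxtimes>\<^sub>m h)
    = (f \<boxtimes>\<^sub>m (g \<boxtimes>\<^sub>m h)) \<cdot> Assoc C (src C f) (src C g) (src C h)"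
  using Assoc_natural[OF Arr_Mor Arr_Mor Arr_Mor, OF assms] .

lemma inv_Assoc_natural:
  assumes "f \<in> Arr C" "g \<in> Arr C" "h \<in> Arr C"
  shows "inv_arr C (Assoc C (tgt C f) (tgt C g) (tgt C h)) \<cdot> (f \<boxtimes>\<^sub>m (g \<boxtimes>\<^sub>m h))
    = ((f \<boxtimes>\<^sub>m g) \<boxtimes>\<^sub>m h) \<cdot> inv_arr C (Assoc C (src C f) (src C g) (src C h))"
proof -
  let ?A = "Assoc C (src C f) (src C g) (src C h)" and ?B = "Assoc C (tgt C f) (tgt C g) (tgt C h)"
  have "inv_arr C ?B \<cdot> (f \<boxtimes>\<^sub>m (g \<boxtimes>\<^sub>m h)) = inv_arr C ?B \<cdot> (((f \<boxtimes>\<^sub>m (g \<boxtimes>\<^sub>m h)) \<cdot> ?A) \<cdot> inv_arr C ?A)"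
    using assms by (simp add: tens_simps)
  also have "\<dots> = inv_arr C ?B \<cdot> ((?B \<cdot> ((f \<boxtimes>\<^sub>m g) \<boxtimes>\<^sub>m h)) \<cdot> inv_arr C ?A)"
    using arr_Assoc_natural[OF assms] by simp
  also have "\<dots> = ((f \<boxtimes>\<^sub>m g) \<boxtimes>\<^sub>m h) \<cdot> inv_arr C ?A"
    using assms by (simp add: tens_simps)
  finally show ?thesis .
qed

lemma iso_Tens:
  assumes f: "f \<in> Mor C X X'" "iso_arr C f" and g: "g \<in> Mor C Y Y'" "iso_arr C g"
  shows "iso_arr C (f \<boxtimes>\<^sub>m g)"
proof (rule iso_arrI)
  note f' = inv_arr[OF f] and g' = inv_arr[OF g]
  show "f \<boxtimes>\<^sub>m g \<in> Mor C (X \<boxtimes> Y) (X' \<boxtimes> Y')" using f g TensArr_closed by blast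
  show "inv_arr C f \<boxtimes>\<^sub>m inv_arr C g \<in> Mor C (X' \<boxtimes> Y') (X \<boxtimes> Y)" using f' g' TensArr_closed by blast
  show "(inv_arr C f \<boxtimes>\<^sub>m inv_arr C g) \<cdot> (f \<boxtimes>\<^sub>m g) = Id C (X \<boxtimes> Y)"
    using Tens_Comp[OF f(1) f'(1) g(1) g'(1)] f'(2) g'(2) Tens_Id[OF MorD(1)[OF f(1)] MorD(1)[OF g(1)]]
    by simp
  show "(f \<boxtimes>\<^sub>m g) \<cdot> (inv_arr C f \<boxtimes>\<^sub>m inv_arr C g) = Id C (X' \<boxtimes> Y')"
    using Tens_Comp[OF f'(1) f(1) g'(1) g(1)] f'(3) g'(3) Tens_Id[OF MorD(2)[OF f(1)] MorD(2)[OF g(1)]]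
    by simp
qed

lemma Tens_Zero_right:
  assumes "f \<in> Mor C X X'" "Y \<in> Obj C" "Y' \<in> Obj C"
  shows "f \<boxtimes>\<^sub>m Zero C Y Y' = Zero C (X \<boxtimes> Y) (X' \<boxtimes> Y')"
  using Tens_Scale_right[OF assms(1) Zero_closed[OF assms(2,3)], of 0] Scale_0[OF Zero_closed[OF assms(2,3)]]
    Scale_0[OF TensArr_closed[OF assms(1) Zero_closed[OF assms(2,3)]]] by simp

lemma Tens_Zero_left:
  assumes "g \<in> Mor C Y Y'" "X \<in> Obj C" "X' \<in> Obj C"
  shows "Zero C X X' \<boxtimes>\<^sub>m g = Zero C (X \<boxtimes> Y) (X' \<boxtimes> Y')"
  using Tens_Scale_left[OF Zero_closed[OF assms(2,3)] assms(1), of 0] Scale_0[OF Zero_closed[OF assms(2,3)]]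
    Scale_0[OF TensArr_closed[OF Zero_closed[OF assms(2,3)] assms(1)]] by simp

lemma Unit_Tens_inject:
  assumes f: "f \<in> Mor C X Y" and g: "g \<in> Mor C X Y"
    and eq: "Id C (Unit C) \<boxtimes>\<^sub>m f = Id C (Unit C) \<boxtimes>\<^sub>m g"
  shows "f = g"
proof -
  have X: "X \<in> Obj C" using f MorD by blast
  have "f \<cdot> LUnit C X = g \<cdot> LUnit C X" using LUnit_natural[OF f] LUnit_natural[OF g] eq by simp
  then show ?thesis using Comp_iso_cancel_right[OF LUnit_closed[OF X] LUnit_iso[OF X] f g] by blast
qed

lemma Tens_Unit_inject:
  assumes f: "f \<in> Mor C X Y" and g: "g \<in> Mor C X Y"
    and eq: "f \<boxtimes>\<^sub>m Id C (Unit C) = g \<boxtimes>\<^sub>m Id C (Unit C)"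
  shows "f = g"
proof -
  have X: "X \<in> Obj C" using f MorD by blast
  have "f \<cdot> RUnit C X = g \<cdot> RUnit C X" using RUnit_natural[OF f] RUnit_natural[OF g] eq by simp
  then show ?thesis using Comp_iso_cancel_right[OF RUnit_closed[OF X] RUnit_iso[OF X] f g] by blast
qed

end

text \<open>Evaluation and coevaluation are fixed here, since \<open>is_left_dual\<close> only asserts their existence.\<close>

locale left_dual = tensor_category C for C :: "('o, 'm, 'k::field, 'z) tensor_cat_scheme" (structure) +
  fixes D X ev coev
  assumes obj: "X \<in> Obj C" "D \<in> Obj C"
    and ev: "ev \<in> Mor C (D \<boxtimes> X) (Unit C)"
    and coev: "coev \<in> Mor C (Unit C) (X \<boxtimes> D)"
    and zigzag1: "RUnit C X \<cdot> ((Id C X \<boxtimes>\<^sub>m ev) \<cdot> (Assoc C X D X \<cdot> (coev \<boxtimes>\<^sub>m Id C X))) = LUnit C X"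
    and zigzag2: "LUnit C D \<cdot> ((ev \<boxtimes>\<^sub>m Id C D) \<cdot>
       (inv_arr C (Assoc C D X D) \<cdot> (Id C D \<boxtimes>\<^sub>m coev))) = RUnit C D"
begin

lemma ev_arr: "ev \<in> Arr C" "src C ev = D \<boxtimes> X" "tgt C ev = Unit C"
  and coev_arr: "coev \<in> Arr C" "src C coev = Unit C" "tgt C coev = X \<boxtimes> D"
  using ev coev by (simp_all add: Mor_def)

lemmas dual_simps = tens_simps obj ev_arr coev_arr

text \<open>By the zigzag identities these two composites are identities up to unitors, hence invertible.\<close>

definition zig where "zig = (Id C X \<boxtimes>\<^sub>m ev) \<cdot> (Assoc C X D X \<cdot> (coev \<boxtimes>\<^sub>m Id C X))"
definition zag where "zag = (ev \<boxtimes>\<^sub>m Id C D) \<cdot> (inv_arr C (Assoc C D X D) \<cdot> (Id C D \<boxtimes>\<^sub>m coev))"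

lemma zig_Mor: "zig \<in> Mor C (Unit C \<boxtimes> X) (X \<boxtimes> Unit C)"
  and zag_Mor: "zag \<in> Mor C (D \<boxtimes> Unit C) (Unit C \<boxtimes> D)"
  by (simp_all add: Mor_iff zig_def zag_def dual_simps)

lemma zig_iso: "iso_arr C zig"
  using iso_of_square'[OF zig_Mor RUnit_closed RUnit_iso LUnit_closed LUnit_iso] zigzag1 obj
  by (simp add: zig_def)

lemma zag_iso: "iso_arr C zag"
  using iso_of_square'[OF zag_Mor LUnit_closed LUnit_iso RUnit_closed RUnit_iso] zigzag2 obj
  by (simp add: zag_def)

text \<open>Up to unitors, \<open>flat_left\<close> maps \<open>Hom(Z, X \<otimes> Y)\<close> to \<open>Hom(D \<otimes> Z, Y)\<close> and \<open>sharp_left\<close> maps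
  \<open>Hom(D \<otimes> Z, Y)\<close> to \<open>Hom(Z, X \<otimes> Y)\<close>. The unitors are left out, so their composites are not
  identities. They are composites with a fixed isomorphism, which is enough for injectivity and
  avoids coherence theorems for the unit object.\<close>

definition flat_left :: "'o \<Rightarrow> 'm \<Rightarrow> 'm" where
  "flat_left Y f = (ev \<boxtimes>\<^sub>m Id C Y) \<cdot> (inv_arr C (Assoc C D X Y) \<cdot> (Id C D \<boxtimes>\<^sub>m f))"

definition sharp_left :: "'o \<Rightarrow> 'm \<Rightarrow> 'm" where
  "sharp_left Z h = (Id C X \<boxtimes>\<^sub>m h) \<cdot> (Assoc C X D Z \<cdot> (coev \<boxtimes>\<^sub>m Id C Z))"

lemma flat_left_Mor:
  "\<lbrakk>f \<in> Mor C Z (X \<boxtimes> Y); Y \<in> Obj C\<rbrakk> \<Longrightarrow> flat_left Y f \<in> Mor C (D \<boxtimes> Z) (Unit C \<boxtimes> Y)"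
  using src_closed by (auto simp: Mor_iff flat_left_def dual_simps)

lemma sharp_left_Mor:
  "\<lbrakk>h \<in> Mor C (D \<boxtimes> Z) Y; Z \<in> Obj C\<rbrakk> \<Longrightarrow> sharp_left Z h \<in> Mor C (Unit C \<boxtimes> Z) (X \<boxtimes> Y)"
  by (auto simp: Mor_iff sharp_left_def dual_simps)

text \<open>By naturality and the pentagon identity the composite becomes, between two associators, the
  zigzag \<open>zig\<close> tensored with \<open>Y\<close>.\<close>

lemma sharp_flat_Id_iso:
  assumes Y: "Y \<in> Obj C"
  shows "iso_arr C (sharp_left (X \<boxtimes> Y) (flat_left Y (Id C (X \<boxtimes> Y))))" (is "iso_arr C ?K")
proof -
  let ?a = "inv_arr C (Assoc C D X Y)"
  have K: "?K = (Id C X \<boxtimes>\<^sub>m (ev \<boxtimes>\<^sub>m Id C Y)) \<cdot> ((Id C X \<boxtimes>\<^sub>m ?a) \<cdot>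
      (Assoc C X D (X \<boxtimes> Y) \<cdot> (coev \<boxtimes>\<^sub>m Id C (X \<boxtimes> Y))))"
    using Y by (simp add: sharp_left_def flat_left_def dual_simps arr_interchange')
  have "?K \<cdot> Assoc C (Unit C) X Y = (Id C X \<boxtimes>\<^sub>m (ev \<boxtimes>\<^sub>m Id C Y)) \<cdot> ((Id C X \<boxtimes>\<^sub>m ?a) \<cdot>
      (Assoc C X D (X \<boxtimes> Y) \<cdot> ((coev \<boxtimes>\<^sub>m (Id C X \<boxtimes>\<^sub>m Id C Y)) \<cdot> Assoc C (Unit C) X Y)))"
    unfolding K using Y by (simp add: dual_simps)
  also have "(coev \<boxtimes>\<^sub>m (Id C X \<boxtimes>\<^sub>m Id C Y)) \<cdot> Assoc C (Unit C) X Y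
      = Assoc C (X \<boxtimes> D) X Y \<cdot> ((coev \<boxtimes>\<^sub>m Id C X) \<boxtimes>\<^sub>m Id C Y)"
    using arr_Assoc_natural[of coev "Id C X" "Id C Y"] Y by (simp only: dual_simps)
  also have "Assoc C X D (X \<boxtimes> Y) \<cdot> (Assoc C (X \<boxtimes> D) X Y \<cdot> ((coev \<boxtimes>\<^sub>m Id C X) \<boxtimes>\<^sub>m Id C Y))
      = (Assoc C X D (X \<boxtimes> Y) \<cdot> Assoc C (X \<boxtimes> D) X Y) \<cdot> ((coev \<boxtimes>\<^sub>m Id C X) \<boxtimes>\<^sub>m Id C Y)"
    using Y by (simp add: dual_simps)
  also have "\<dots> = (Id C X \<boxtimes>\<^sub>m Assoc C D X Y) \<cdot> (Assoc C X (D \<boxtimes> X) Y \<cdot>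
      ((Assoc C X D X \<boxtimes>\<^sub>m Id C Y) \<cdot> ((coev \<boxtimes>\<^sub>m Id C X) \<boxtimes>\<^sub>m Id C Y)))"
    unfolding pentagon[OF obj(1,2,1) Y] using Y by (simp add: dual_simps)
  also have "(Id C X \<boxtimes>\<^sub>m ?a) \<cdot> \<dots>
      = Assoc C X (D \<boxtimes> X) Y \<cdot> ((Assoc C X D X \<boxtimes>\<^sub>m Id C Y) \<cdot> ((coev \<boxtimes>\<^sub>m Id C X) \<boxtimes>\<^sub>m Id C Y))"
    using Y by (simp add: dual_simps arr_interchange arr_interchange')
  also have "(Id C X \<boxtimes>\<^sub>m (ev \<boxtimes>\<^sub>m Id C Y)) \<cdot> \<dots> = ((Id C X \<boxtimes>\<^sub>m (ev \<boxtimes>\<^sub>m Id C Y)) \<cdot> Assoc C X (D \<boxtimes> X) Y)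
      \<cdot> ((Assoc C X D X \<boxtimes>\<^sub>m Id C Y) \<cdot> ((coev \<boxtimes>\<^sub>m Id C X) \<boxtimes>\<^sub>m Id C Y))"
    using Y by (simp add: dual_simps)
  also have "(Id C X \<boxtimes>\<^sub>m (ev \<boxtimes>\<^sub>m Id C Y)) \<cdot> Assoc C X (D \<boxtimes> X) Y
      = Assoc C X (Unit C) Y \<cdot> ((Id C X \<boxtimes>\<^sub>m ev) \<boxtimes>\<^sub>m Id C Y)"
    using arr_Assoc_natural[of "Id C X" ev "Id C Y"] Y by (simp only: dual_simps)
  also have "(Assoc C X (Unit C) Y \<cdot> ((Id C X \<boxtimes>\<^sub>m ev) \<boxtimes>\<^sub>m Id C Y))
      \<cdot> ((Assoc C X D X \<boxtimes>\<^sub>m Id C Y) \<cdot> ((coev \<boxtimes>\<^sub>m Id C X) \<boxtimes>\<^sub>m Id C Y))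
      = Assoc C X (Unit C) Y \<cdot> (zig \<boxtimes>\<^sub>m Id C Y)"
    unfolding zig_def using Y by (simp add: dual_simps arr_interchange arr_interchange')
  finally have eq: "?K \<cdot> Assoc C (Unit C) X Y = Assoc C X (Unit C) Y \<cdot> (zig \<boxtimes>\<^sub>m Id C Y)" .
  have zY: "zig \<boxtimes>\<^sub>m Id C Y \<in> Mor C ((Unit C \<boxtimes> X) \<boxtimes> Y) ((X \<boxtimes> Unit C) \<boxtimes> Y)" "iso_arr C (zig \<boxtimes>\<^sub>m Id C Y)"
    using TensArr_closed zig_Mor Id_closed Y iso_Tens zig_iso iso_arr_Id by blast+
  note A = Assoc_closed[OF obj(1) Unit_closed Y] Assoc_iso[OF obj(1) Unit_closed Y]
  have "?K \<in> Mor C (Unit C \<boxtimes> (X \<boxtimes> Y)) (X \<boxtimes> (Unit C \<boxtimes> Y))"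
    using sharp_left_Mor flat_left_Mor Id_closed Tens_closed obj Y by simp
  from iso_of_square[OF this Assoc_closed[OF Unit_closed obj(1) Y] Assoc_iso[OF Unit_closed obj(1) Y]
      Comp_closed[OF zY(1) A(1)] iso_arr_Comp[OF zY A] eq]
  show ?thesis .
qed

text \<open>Naturality of the associator moves \<open>f\<close> past everything, so that the general case reduces to the
  identity.\<close>

lemma sharp_flat_left:
  assumes f: "f \<in> Mor C Z (X \<boxtimes> Y)" and Y: "Y \<in> Obj C"
  shows "sharp_left Z (flat_left Y f)
    = sharp_left (X \<boxtimes> Y) (flat_left Y (Id C (X \<boxtimes> Y))) \<cdot> (Id C (Unit C) \<boxtimes>\<^sub>m f)"
proof -
  have f': "f \<in> Arr C" "src C f = Z" "tgt C f = X \<boxtimes> Y" "Z \<in> Obj C" using f MorD by auto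
  let ?b = "(ev \<boxtimes>\<^sub>m Id C Y) \<cdot> inv_arr C (Assoc C D X Y)"
  have "sharp_left Z (flat_left Y f)
      = (Id C X \<boxtimes>\<^sub>m ?b) \<cdot> (((Id C X \<boxtimes>\<^sub>m (Id C D \<boxtimes>\<^sub>m f)) \<cdot> Assoc C X D Z) \<cdot> (coev \<boxtimes>\<^sub>m Id C Z))"
    using Y f' by (simp add: sharp_left_def flat_left_def dual_simps arr_interchange')
  also have "(Id C X \<boxtimes>\<^sub>m (Id C D \<boxtimes>\<^sub>m f)) \<cdot> Assoc C X D Z
      = Assoc C X D (X \<boxtimes> Y) \<cdot> ((Id C X \<boxtimes>\<^sub>m Id C D) \<boxtimes>\<^sub>m f)"
    using arr_Assoc_natural[of "Id C X" "Id C D" f] f' by (simp only: dual_simps)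
  also have "(Id C X \<boxtimes>\<^sub>m ?b) \<cdot> ((Assoc C X D (X \<boxtimes> Y) \<cdot> ((Id C X \<boxtimes>\<^sub>m Id C D) \<boxtimes>\<^sub>m f)) \<cdot> (coev \<boxtimes>\<^sub>m Id C Z))
      = (Id C X \<boxtimes>\<^sub>m ?b) \<cdot> (Assoc C X D (X \<boxtimes> Y) \<cdot> (coev \<boxtimes>\<^sub>m f))"
    using Y f' by (simp add: dual_simps arr_interchange)
  also have "\<dots> = sharp_left (X \<boxtimes> Y) (flat_left Y (Id C (X \<boxtimes> Y))) \<cdot> (Id C (Unit C) \<boxtimes>\<^sub>m f)"
    using Y f' by (simp add: sharp_left_def flat_left_def dual_simps arr_interchange)
  finally show ?thesis .
qed

lemma flat_left_inject:
  assumes f: "f \<in> Mor C Z (X \<boxtimes> Y)" and g: "g \<in> Mor C Z (X \<boxtimes> Y)" and Y: "Y \<in> Obj C"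
    and eq: "flat_left Y f = flat_left Y g"
  shows "f = g"
proof (rule Unit_Tens_inject[OF f g])
  have K: "sharp_left (X \<boxtimes> Y) (flat_left Y (Id C (X \<boxtimes> Y)))
      \<in> Mor C (Unit C \<boxtimes> (X \<boxtimes> Y)) (X \<boxtimes> (Unit C \<boxtimes> Y))"
    using sharp_left_Mor flat_left_Mor Id_closed Tens_closed obj Y by simp
  show "Id C (Unit C) \<boxtimes>\<^sub>m f = Id C (Unit C) \<boxtimes>\<^sub>m g"
    using Comp_iso_cancel_left[OF K sharp_flat_Id_iso[OF Y] TensArr_closed[OF Id_closed[OF Unit_closed] f]
      TensArr_closed[OF Id_closed[OF Unit_closed] g]] sharp_flat_left[OF f Y] sharp_flat_left[OF g Y] eq
    by simp
qed

lemma flat_sharp_Id_iso: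
  assumes Z: "Z \<in> Obj C"
  shows "iso_arr C (flat_left (D \<boxtimes> Z) (sharp_left Z (Id C (D \<boxtimes> Z))))" (is "iso_arr C ?L")
proof -
  let ?A = "Assoc C X D Z"
  have L: "?L = (ev \<boxtimes>\<^sub>m Id C (D \<boxtimes> Z)) \<cdot> (inv_arr C (Assoc C D X (D \<boxtimes> Z)) \<cdot>
      ((Id C D \<boxtimes>\<^sub>m ?A) \<cdot> (Id C D \<boxtimes>\<^sub>m (coev \<boxtimes>\<^sub>m Id C Z))))"
    using Z by (simp add: sharp_left_def flat_left_def dual_simps arr_interchange)
  have pent: "Id C D \<boxtimes>\<^sub>m ?A = Assoc C D X (D \<boxtimes> Z) \<cdot> (Assoc C (D \<boxtimes> X) D Z \<cdot>
      ((inv_arr C (Assoc C D X D) \<boxtimes>\<^sub>m Id C Z) \<cdot> inv_arr C (Assoc C D (X \<boxtimes> D) Z)))"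
  proof -
    have "Assoc C D X (D \<boxtimes> Z) \<cdot> (Assoc C (D \<boxtimes> X) D Z \<cdot>
        ((inv_arr C (Assoc C D X D) \<boxtimes>\<^sub>m Id C Z) \<cdot> inv_arr C (Assoc C D (X \<boxtimes> D) Z)))
      = (Assoc C D X (D \<boxtimes> Z) \<cdot> Assoc C (D \<boxtimes> X) D Z) \<cdot>
        ((inv_arr C (Assoc C D X D) \<boxtimes>\<^sub>m Id C Z) \<cdot> inv_arr C (Assoc C D (X \<boxtimes> D) Z))"
      using Z by (simp add: dual_simps)
    also have "\<dots> = Id C D \<boxtimes>\<^sub>m ?A"
      unfolding pentagon[OF obj(2,1,2) Z] using Z by (simp add: dual_simps arr_interchange')
    finally show ?thesis by simp
  qed
  have "?L \<cdot> Assoc C D (Unit C) Z = ((ev \<boxtimes>\<^sub>m (Id C D \<boxtimes>\<^sub>m Id C Z)) \<cdot> Assoc C (D \<boxtimes> X) D Z) \<cdot>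
      ((inv_arr C (Assoc C D X D) \<boxtimes>\<^sub>m Id C Z) \<cdot> (inv_arr C (Assoc C D (X \<boxtimes> D) Z) \<cdot>
      ((Id C D \<boxtimes>\<^sub>m (coev \<boxtimes>\<^sub>m Id C Z)) \<cdot> Assoc C D (Unit C) Z)))"
    unfolding L pent using Z by (simp add: dual_simps)
  also have "(Id C D \<boxtimes>\<^sub>m (coev \<boxtimes>\<^sub>m Id C Z)) \<cdot> Assoc C D (Unit C) Z
      = Assoc C D (X \<boxtimes> D) Z \<cdot> ((Id C D \<boxtimes>\<^sub>m coev) \<boxtimes>\<^sub>m Id C Z)"
    using arr_Assoc_natural[of "Id C D" coev "Id C Z"] Z by (simp only: dual_simps)
  also have "(ev \<boxtimes>\<^sub>m (Id C D \<boxtimes>\<^sub>m Id C Z)) \<cdot> Assoc C (D \<boxtimes> X) D Z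
      = Assoc C (Unit C) D Z \<cdot> ((ev \<boxtimes>\<^sub>m Id C D) \<boxtimes>\<^sub>m Id C Z)"
    using arr_Assoc_natural[of ev "Id C D" "Id C Z"] Z by (simp only: dual_simps)
  also have "(Assoc C (Unit C) D Z \<cdot> ((ev \<boxtimes>\<^sub>m Id C D) \<boxtimes>\<^sub>m Id C Z)) \<cdot>
      ((inv_arr C (Assoc C D X D) \<boxtimes>\<^sub>m Id C Z) \<cdot> (inv_arr C (Assoc C D (X \<boxtimes> D) Z) \<cdot>
      (Assoc C D (X \<boxtimes> D) Z \<cdot> ((Id C D \<boxtimes>\<^sub>m coev) \<boxtimes>\<^sub>m Id C Z))))
      = Assoc C (Unit C) D Z \<cdot> (zag \<boxtimes>\<^sub>m Id C Z)"
    unfolding zag_def using Z by (simp add: dual_simps arr_interchange)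
  finally have eq: "?L \<cdot> Assoc C D (Unit C) Z = Assoc C (Unit C) D Z \<cdot> (zag \<boxtimes>\<^sub>m Id C Z)" .
  have zZ: "zag \<boxtimes>\<^sub>m Id C Z \<in> Mor C ((D \<boxtimes> Unit C) \<boxtimes> Z) ((Unit C \<boxtimes> D) \<boxtimes> Z)" "iso_arr C (zag \<boxtimes>\<^sub>m Id C Z)"
    using TensArr_closed zag_Mor Id_closed Z iso_Tens zag_iso iso_arr_Id by blast+
  note A = Assoc_closed[OF Unit_closed obj(2) Z] Assoc_iso[OF Unit_closed obj(2) Z]
  have "?L \<in> Mor C (D \<boxtimes> (Unit C \<boxtimes> Z)) (Unit C \<boxtimes> (D \<boxtimes> Z))"
    using sharp_left_Mor flat_left_Mor Id_closed Tens_closed obj Z by simp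
  from iso_of_square[OF this Assoc_closed[OF obj(2) Unit_closed Z] Assoc_iso[OF obj(2) Unit_closed Z]
      Comp_closed[OF zZ(1) A(1)] iso_arr_Comp[OF zZ A] eq]
  show ?thesis .
qed

lemma flat_sharp_left:
  assumes h: "h \<in> Mor C (D \<boxtimes> Z) Y" and Z: "Z \<in> Obj C"
  shows "flat_left Y (sharp_left Z h)
    = (Id C (Unit C) \<boxtimes>\<^sub>m h) \<cdot> flat_left (D \<boxtimes> Z) (sharp_left Z (Id C (D \<boxtimes> Z)))"
proof -
  have h': "h \<in> Arr C" "src C h = D \<boxtimes> Z" "tgt C h = Y" "Y \<in> Obj C" using h MorD by auto
  let ?b = "Assoc C X D Z \<cdot> (coev \<boxtimes>\<^sub>m Id C Z)"
  have "flat_left Y (sharp_left Z h)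
      = (ev \<boxtimes>\<^sub>m Id C Y) \<cdot> ((inv_arr C (Assoc C D X Y) \<cdot> (Id C D \<boxtimes>\<^sub>m (Id C X \<boxtimes>\<^sub>m h))) \<cdot> (Id C D \<boxtimes>\<^sub>m ?b))"
    using Z h' by (simp add: sharp_left_def flat_left_def dual_simps arr_interchange)
  also have "inv_arr C (Assoc C D X Y) \<cdot> (Id C D \<boxtimes>\<^sub>m (Id C X \<boxtimes>\<^sub>m h))
      = ((Id C D \<boxtimes>\<^sub>m Id C X) \<boxtimes>\<^sub>m h) \<cdot> inv_arr C (Assoc C D X (D \<boxtimes> Z))"
    using inv_Assoc_natural[of "Id C D" "Id C X" h] h' by (simp only: dual_simps)
  also have "(ev \<boxtimes>\<^sub>m Id C Y) \<cdot> ((((Id C D \<boxtimes>\<^sub>m Id C X) \<boxtimes>\<^sub>m h) \<cdot> inv_arr C (Assoc C D X (D \<boxtimes> Z))) \<cdot> (Id C D \<boxtimes>\<^sub>m ?b))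
      = (ev \<boxtimes>\<^sub>m h) \<cdot> (inv_arr C (Assoc C D X (D \<boxtimes> Z)) \<cdot> (Id C D \<boxtimes>\<^sub>m ?b))"
    using Z h' by (simp add: dual_simps arr_interchange')
  also have "\<dots> = (Id C (Unit C) \<boxtimes>\<^sub>m h) \<cdot> flat_left (D \<boxtimes> Z) (sharp_left Z (Id C (D \<boxtimes> Z)))"
    using Z h' by (simp add: sharp_left_def flat_left_def dual_simps arr_interchange')
  finally show ?thesis .
qed

lemma sharp_left_inject:
  assumes h: "h \<in> Mor C (D \<boxtimes> Z) Y" and k: "k \<in> Mor C (D \<boxtimes> Z) Y" and Z: "Z \<in> Obj C"
    and eq: "sharp_left Z h = sharp_left Z k"
  shows "h = k"
proof (rule Unit_Tens_inject[OF h k])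
  have L: "flat_left (D \<boxtimes> Z) (sharp_left Z (Id C (D \<boxtimes> Z)))
      \<in> Mor C (D \<boxtimes> (Unit C \<boxtimes> Z)) (Unit C \<boxtimes> (D \<boxtimes> Z))"
    using sharp_left_Mor flat_left_Mor Id_closed Tens_closed obj Z by simp
  show "Id C (Unit C) \<boxtimes>\<^sub>m h = Id C (Unit C) \<boxtimes>\<^sub>m k"
    using Comp_iso_cancel_right[OF L flat_sharp_Id_iso[OF Z] TensArr_closed[OF Id_closed[OF Unit_closed] h]
      TensArr_closed[OF Id_closed[OF Unit_closed] k]] flat_sharp_left[OF h Z] flat_sharp_left[OF k Z] eq
    by simp
qed

text \<open>In the same way \<open>X\<close> is moved from the right of the source to the target, where it becomes
  \<open>D\<close>: \<open>sharp_right\<close> maps \<open>Hom(W \<otimes> X, Z)\<close> to \<open>Hom(W, Z \<otimes> D)\<close>, up to unitors.\<close>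

definition sharp_right :: "'o \<Rightarrow> 'm \<Rightarrow> 'm" where
  "sharp_right W f = (f \<boxtimes>\<^sub>m Id C D) \<cdot> (inv_arr C (Assoc C W X D) \<cdot> (Id C W \<boxtimes>\<^sub>m coev))"

definition flat_right :: "'o \<Rightarrow> 'm \<Rightarrow> 'm" where
  "flat_right Z h = (Id C Z \<boxtimes>\<^sub>m ev) \<cdot> (Assoc C Z D X \<cdot> (h \<boxtimes>\<^sub>m Id C X))"

lemma sharp_right_Mor:
  "\<lbrakk>f \<in> Mor C (W \<boxtimes> X) Z; W \<in> Obj C\<rbrakk> \<Longrightarrow> sharp_right W f \<in> Mor C (W \<boxtimes> Unit C) (Z \<boxtimes> D)"
  by (auto simp: Mor_iff sharp_right_def dual_simps)

lemma flat_right_Mor: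
  "\<lbrakk>h \<in> Mor C W (Z \<boxtimes> D); Z \<in> Obj C\<rbrakk> \<Longrightarrow> flat_right Z h \<in> Mor C (W \<boxtimes> X) (Z \<boxtimes> Unit C)"
  by (auto simp: Mor_iff flat_right_def dual_simps)

lemma flat_sharp_right_Id_iso:
  assumes W: "W \<in> Obj C"
  shows "iso_arr C (flat_right (W \<boxtimes> X) (sharp_right W (Id C (W \<boxtimes> X))))" (is "iso_arr C ?N")
proof -
  let ?a = "inv_arr C (Assoc C W X D)"
  have N: "?N = (Id C (W \<boxtimes> X) \<boxtimes>\<^sub>m ev) \<cdot> (Assoc C (W \<boxtimes> X) D X \<cdot>
      ((?a \<boxtimes>\<^sub>m Id C X) \<cdot> ((Id C W \<boxtimes>\<^sub>m coev) \<boxtimes>\<^sub>m Id C X)))"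
    using W by (simp add: sharp_right_def flat_right_def dual_simps arr_interchange)
  have "Assoc C W X (Unit C) \<cdot> ?N
      = (Assoc C W X (Unit C) \<cdot> ((Id C W \<boxtimes>\<^sub>m Id C X) \<boxtimes>\<^sub>m ev)) \<cdot> (Assoc C (W \<boxtimes> X) D X \<cdot>
      ((?a \<boxtimes>\<^sub>m Id C X) \<cdot> ((Id C W \<boxtimes>\<^sub>m coev) \<boxtimes>\<^sub>m Id C X)))"
    unfolding N using W by (simp add: dual_simps)
  also have "Assoc C W X (Unit C) \<cdot> ((Id C W \<boxtimes>\<^sub>m Id C X) \<boxtimes>\<^sub>m ev)
      = (Id C W \<boxtimes>\<^sub>m (Id C X \<boxtimes>\<^sub>m ev)) \<cdot> Assoc C W X (D \<boxtimes> X)"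
    using arr_Assoc_natural[of "Id C W" "Id C X" ev] W by (simp only: dual_simps)
  also have "((Id C W \<boxtimes>\<^sub>m (Id C X \<boxtimes>\<^sub>m ev)) \<cdot> Assoc C W X (D \<boxtimes> X)) \<cdot> (Assoc C (W \<boxtimes> X) D X \<cdot>
      ((?a \<boxtimes>\<^sub>m Id C X) \<cdot> ((Id C W \<boxtimes>\<^sub>m coev) \<boxtimes>\<^sub>m Id C X)))
    = (Id C W \<boxtimes>\<^sub>m (Id C X \<boxtimes>\<^sub>m ev)) \<cdot> ((Assoc C W X (D \<boxtimes> X) \<cdot> Assoc C (W \<boxtimes> X) D X) \<cdot>
      ((?a \<boxtimes>\<^sub>m Id C X) \<cdot> ((Id C W \<boxtimes>\<^sub>m coev) \<boxtimes>\<^sub>m Id C X)))"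
    using W by (simp add: dual_simps)
  also have "\<dots> = (Id C W \<boxtimes>\<^sub>m (Id C X \<boxtimes>\<^sub>m ev)) \<cdot> ((Id C W \<boxtimes>\<^sub>m Assoc C X D X) \<cdot>
      (Assoc C W (X \<boxtimes> D) X \<cdot> ((Id C W \<boxtimes>\<^sub>m coev) \<boxtimes>\<^sub>m Id C X)))"
    unfolding pentagon[OF W obj(1,2,1)] using W by (simp add: dual_simps arr_interchange')
  also have "Assoc C W (X \<boxtimes> D) X \<cdot> ((Id C W \<boxtimes>\<^sub>m coev) \<boxtimes>\<^sub>m Id C X)
      = (Id C W \<boxtimes>\<^sub>m (coev \<boxtimes>\<^sub>m Id C X)) \<cdot> Assoc C W (Unit C) X"
    using arr_Assoc_natural[of "Id C W" coev "Id C X"] W by (simp only: dual_simps)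
  also have "(Id C W \<boxtimes>\<^sub>m (Id C X \<boxtimes>\<^sub>m ev)) \<cdot> ((Id C W \<boxtimes>\<^sub>m Assoc C X D X) \<cdot>
      ((Id C W \<boxtimes>\<^sub>m (coev \<boxtimes>\<^sub>m Id C X)) \<cdot> Assoc C W (Unit C) X))
      = (Id C W \<boxtimes>\<^sub>m zig) \<cdot> Assoc C W (Unit C) X"
    unfolding zig_def using W by (simp add: dual_simps arr_interchange')
  finally have eq: "Assoc C W X (Unit C) \<cdot> ?N = (Id C W \<boxtimes>\<^sub>m zig) \<cdot> Assoc C W (Unit C) X" .
  have Wz: "Id C W \<boxtimes>\<^sub>m zig \<in> Mor C (W \<boxtimes> (Unit C \<boxtimes> X)) (W \<boxtimes> (X \<boxtimes> Unit C))" "iso_arr C (Id C W \<boxtimes>\<^sub>m zig)"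
    using TensArr_closed zig_Mor Id_closed W iso_Tens zig_iso iso_arr_Id by blast+
  note A = Assoc_closed[OF W Unit_closed obj(1)] Assoc_iso[OF W Unit_closed obj(1)]
  have "?N \<in> Mor C ((W \<boxtimes> Unit C) \<boxtimes> X) ((W \<boxtimes> X) \<boxtimes> Unit C)"
    using sharp_right_Mor flat_right_Mor Id_closed Tens_closed obj W by simp
  from iso_of_square'[OF this Assoc_closed[OF W obj(1) Unit_closed] Assoc_iso[OF W obj(1) Unit_closed]
      Comp_closed[OF A(1) Wz(1)] iso_arr_Comp[OF A Wz] eq]
  show ?thesis .
qed

lemma flat_sharp_right:
  assumes f: "f \<in> Mor C (W \<boxtimes> X) Z" and W: "W \<in> Obj C"
  shows "flat_right Z (sharp_right W f)
    = (f \<boxtimes>\<^sub>m Id C (Unit C)) \<cdot> flat_right (W \<boxtimes> X) (sharp_right W (Id C (W \<boxtimes> X)))"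
proof -
  have f': "f \<in> Arr C" "src C f = W \<boxtimes> X" "tgt C f = Z" "Z \<in> Obj C" using f MorD by auto
  let ?b = "inv_arr C (Assoc C W X D) \<cdot> (Id C W \<boxtimes>\<^sub>m coev)"
  have "flat_right Z (sharp_right W f)
      = (Id C Z \<boxtimes>\<^sub>m ev) \<cdot> ((Assoc C Z D X \<cdot> ((f \<boxtimes>\<^sub>m Id C D) \<boxtimes>\<^sub>m Id C X)) \<cdot> (?b \<boxtimes>\<^sub>m Id C X))"
    using W f' by (simp add: sharp_right_def flat_right_def dual_simps arr_interchange)
  also have "Assoc C Z D X \<cdot> ((f \<boxtimes>\<^sub>m Id C D) \<boxtimes>\<^sub>m Id C X)
      = (f \<boxtimes>\<^sub>m (Id C D \<boxtimes>\<^sub>m Id C X)) \<cdot> Assoc C (W \<boxtimes> X) D X"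
    using arr_Assoc_natural[of f "Id C D" "Id C X"] f' by (simp only: dual_simps)
  also have "(Id C Z \<boxtimes>\<^sub>m ev) \<cdot> (((f \<boxtimes>\<^sub>m (Id C D \<boxtimes>\<^sub>m Id C X)) \<cdot> Assoc C (W \<boxtimes> X) D X) \<cdot> (?b \<boxtimes>\<^sub>m Id C X))
      = (f \<boxtimes>\<^sub>m ev) \<cdot> (Assoc C (W \<boxtimes> X) D X \<cdot> (?b \<boxtimes>\<^sub>m Id C X))"
    using W f' by (simp add: dual_simps arr_interchange')
  also have "\<dots> = (f \<boxtimes>\<^sub>m Id C (Unit C)) \<cdot> flat_right (W \<boxtimes> X) (sharp_right W (Id C (W \<boxtimes> X)))"
    using W f' by (simp add: sharp_right_def flat_right_def dual_simps arr_interchange')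
  finally show ?thesis .
qed

lemma sharp_right_inject:
  assumes f: "f \<in> Mor C (W \<boxtimes> X) Z" and g: "g \<in> Mor C (W \<boxtimes> X) Z" and W: "W \<in> Obj C"
    and eq: "sharp_right W f = sharp_right W g"
  shows "f = g"
proof (rule Tens_Unit_inject[OF f g])
  have N: "flat_right (W \<boxtimes> X) (sharp_right W (Id C (W \<boxtimes> X)))
      \<in> Mor C ((W \<boxtimes> Unit C) \<boxtimes> X) ((W \<boxtimes> X) \<boxtimes> Unit C)"
    using sharp_right_Mor flat_right_Mor Id_closed Tens_closed obj W by simp
  show "f \<boxtimes>\<^sub>m Id C (Unit C) = g \<boxtimes>\<^sub>m Id C (Unit C)"
    using Comp_iso_cancel_right[OF N flat_sharp_right_Id_iso[OF W]
      TensArr_closed[OF f Id_closed[OF Unit_closed]] TensArr_closed[OF g Id_closed[OF Unit_closed]]]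
      flat_sharp_right[OF f W] flat_sharp_right[OF g W] eq
    by simp
qed

end

section \<open>Constituents and additive functors\<close>

context linear_category
begin

lemma simple_nonzero_class_rep:
  assumes "c \<in> support C Z"
  obtains u where "u \<in> Mor C (class_rep c) Z" "u \<noteq> Zero C (class_rep c) Z"
proof -
  have c: "c \<in> simple_classes C" using assms by (rule subsetD[OF support_subset])
  then show thesis
    using support_iff[OF simple_class_rep(1)[OF c], of Z] simple_class_rep(2)[OF c] assms that by auto
qed

end

context semisimple_linear_category
begin

lemma support_iff_quotient:
  assumes X: "simple_object C X"
  shows "iso_class C X \<in> support C Z \<longleftrightarrow> (\<exists>p \<in> Mor C Z X. p \<noteq> Zero C Z X)"
proof
  assume "iso_class C X \<in> support C Z"
  then obtain u where u: "u \<in> Mor C X Z" "u \<noteq> Zero C X Z" using support_iff X by blast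
  then obtain p where p: "p \<in> Mor C Z X" "p \<cdot> u = Id C X" using simple_retraction X by blast
  have "p \<noteq> Zero C Z X"
    using p(2) Comp_Zero_left[OF u(1) simple_Obj[OF X]] simple_Id_nonzero[OF X] by metis
  then show "\<exists>p \<in> Mor C Z X. p \<noteq> Zero C Z X" using p by blast
next
  assume "\<exists>p \<in> Mor C Z X. p \<noteq> Zero C Z X"
  then obtain p where p: "p \<in> Mor C Z X" "p \<noteq> Zero C Z X" by blast
  then obtain u where u: "u \<in> Mor C X Z" "p \<cdot> u = Id C X" using simple_section X by blast
  have "u \<noteq> Zero C X Z"
    using u(2) Comp_Zero_right[OF p(1) simple_Obj[OF X]] simple_Id_nonzero[OF X] by metis
  then show "iso_class C X \<in> support C Z" using u support_iff X by blast
qed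

end

text \<open>Both \<open>- \<boxtimes> W\<close> and \<open>W \<boxtimes> -\<close> are additive functors, and \<open>mor_eq_functor\<close> and
  \<open>support_functor\<close> are needed for both. They hold because an additive functor maps a decomposition
  of \<open>Z\<close> to a decomposition of the image of \<open>Z\<close>.\<close>

locale additive_endofunctor = semisimple_linear_category C
  for C :: "('o, 'm, 'k::field, 'z) linear_cat_scheme" (structure) +
  fixes F :: "'o \<Rightarrow> 'o" and T :: "'m \<Rightarrow> 'm"
  assumes F_closed: "X \<in> Obj C \<Longrightarrow> F X \<in> Obj C"
    and T_closed: "f \<in> Mor C X Y \<Longrightarrow> T f \<in> Mor C (F X) (F Y)"
    and T_Id: "X \<in> Obj C \<Longrightarrow> T (Id C X) = Id C (F X)"
    and T_Comp: "\<lbrakk>f \<in> Mor C X Y; g \<in> Mor C Y Z\<rbrakk> \<Longrightarrow> T (g \<cdot> f) = T g \<cdot> T f"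
    and T_Plus: "\<lbrakk>f \<in> Mor C X Y; g \<in> Mor C X Y\<rbrakk> \<Longrightarrow> T (Plus C f g) = Plus C (T f) (T g)"
begin

lemma T_Zero:
  assumes "X \<in> Obj C" "Y \<in> Obj C"
  shows "T (Zero C X Y) = Zero C (F X) (F Y)"
proof (rule Plus_right_cancel_Zero)
  note z = Zero_closed[OF assms]
  show "Plus C (T (Zero C X Y)) (T (Zero C X Y)) = T (Zero C X Y)"
    using T_Plus[OF z z] Plus_Zero_left[OF z] by simp
qed (use assms T_closed Zero_closed in auto)

lemma T_iso:
  assumes "isomorphic C X Y"
  shows "isomorphic C (F X) (F Y)"
proof -
  obtain i where i: "i \<in> Mor C X Y" "iso_arr C i" using assms unfolding isomorphic_def by blast
  note j = inv_arr[OF i]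
  have "T (inv_arr C i) \<cdot> T i = Id C (F X)" "T i \<cdot> T (inv_arr C i) = Id C (F Y)"
    using T_Comp[OF i(1) j(1)] T_Comp[OF j(1) i(1)] j(2,3) T_Id MorD(1,2)[OF i(1)] by simp_all
  then show ?thesis
    using isomorphicI[OF T_closed[OF i(1)] iso_arrI[OF T_closed[OF i(1)] T_closed[OF j(1)]]] by blast
qed

lemma mor_eq_functor:
  assumes f: "f \<in> Mor C (F Z) V" and g: "g \<in> Mor C (F Z) V" and Z: "Z \<in> Obj C"
    and eq: "\<And>X u. \<lbrakk>simple_object C X; u \<in> Mor C X Z\<rbrakk> \<Longrightarrow> f \<cdot> T u = g \<cdot> T u"
  shows "f = g"
proof -
  note FZ = F_closed[OF Z]
  obtain Xs where Xs: "\<forall>X \<in> set Xs. simple_object C X" and "is_direct_sum C Z Xs"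
    using semisimple Z by blast
  from this(2) show ?thesis
  proof (cases rule: direct_sumE)
    case (1 \<iota> \<pi>)
    have "f \<cdot> T (Id C Z) = g \<cdot> T (Id C Z)"
    proof (rule "1"(5)[of "\<lambda>e. f \<cdot> T e = g \<cdot> T e"])
      fix i assume i: "i < length Xs"
      note \<iota> = T_closed[OF 1(1)[OF i]] and \<pi> = T_closed[OF 1(2)[OF i]]
      have "f \<cdot> T (\<iota> i) = g \<cdot> T (\<iota> i)" using eq[OF _ 1(1)[OF i]] Xs i by simp
      then show "f \<cdot> T (\<iota> i \<cdot> \<pi> i) = g \<cdot> T (\<iota> i \<cdot> \<pi> i)"
        using T_Comp[OF 1(2)[OF i] 1(1)[OF i]] Comp_assoc[OF \<pi> \<iota> f] Comp_assoc[OF \<pi> \<iota> g] by simp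
    next
      show "f \<cdot> T (Zero C Z Z) = g \<cdot> T (Zero C Z Z)"
        using T_Zero[OF Z Z] Comp_Zero_right[OF f FZ] Comp_Zero_right[OF g FZ] by simp
    next
      fix a b assume a: "a \<in> Mor C Z Z" and b: "b \<in> Mor C Z Z"
        and "f \<cdot> T a = g \<cdot> T a" "f \<cdot> T b = g \<cdot> T b"
      then show "f \<cdot> T (Plus C a b) = g \<cdot> T (Plus C a b)"
        using T_Plus[OF a b] Comp_Plus_right[OF T_closed[OF a] T_closed[OF b]] f g by simp
    qed
    then show ?thesis using T_Id[OF Z] Id_right f g by simp
  qed
qed

text \<open>A simple constituent \<open>U\<close> of \<open>F Z\<close> is a quotient of it, and by \<open>mor_eq_functor\<close> the quotient map
  is nonzero on \<open>F X\<close> for some simple \<open>X\<close> mapping to \<open>Z\<close>. Conversely \<open>F\<close> preserves the retraction of a simple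
  constituent \<open>X\<close> of \<open>Z\<close>.\<close>

lemma support_functor:
  assumes Z: "Z \<in> Obj C"
  shows "support C (F Z) = (\<Union>c \<in> support C Z. support C (F (class_rep c)))"
proof
  note FZ = F_closed[OF Z]
  show "support C (F Z) \<subseteq> (\<Union>c \<in> support C Z. support C (F (class_rep c)))"
  proof
    fix d assume d: "d \<in> support C (F Z)"
    then obtain U where U: "simple_object C U" "d = iso_class C U" unfolding support_def by blast
    then obtain p where p: "p \<in> Mor C (F Z) U" "p \<noteq> Zero C (F Z) U"
      using d support_iff_quotient by blast
    note UO = simple_Obj[OF U(1)]
    obtain X u where X: "simple_object C X" and u: "u \<in> Mor C X Z"
      and ne: "p \<cdot> T u \<noteq> Zero C (F Z) U \<cdot> T u"
      using mor_eq_functor[OF p(1) Zero_closed[OF FZ UO] Z] p(2) by blast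
    note XO = simple_Obj[OF X] and Tu = T_closed[OF u]
    have ne': "p \<cdot> T u \<noteq> Zero C (F X) U" using ne Comp_Zero_left[OF Tu UO] by simp
    have "u \<noteq> Zero C X Z"
      using ne' T_Zero[OF XO Z] Comp_Zero_right[OF p(1) F_closed[OF XO]] by auto
    then have c: "iso_class C X \<in> support C Z" using support_iff X u by blast
    have "d \<in> support C (F X)"
      using support_iff_quotient[OF U(1)] U(2) ne' Comp_closed[OF Tu p(1)] by blast
    then have "d \<in> support C (F (class_rep (iso_class C X)))"
      using support_isomorphic[OF T_iso[OF class_rep_iso_class(2)[OF XO]]] by blast
    then show "d \<in> (\<Union>c \<in> support C Z. support C (F (class_rep c)))" using c by blast
  qed
  show "(\<Union>c \<in> support C Z. support C (F (class_rep c))) \<subseteq> support C (F Z)"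
  proof
    fix d assume "d \<in> (\<Union>c \<in> support C Z. support C (F (class_rep c)))"
    then obtain c where c: "c \<in> support C Z" "d \<in> support C (F (class_rep c))" by blast
    let ?X = "class_rep c"
    have X: "simple_object C ?X"
      using simple_class_rep(1)[OF subsetD[OF support_subset c(1)]] .
    obtain u where u: "u \<in> Mor C ?X Z" "u \<noteq> Zero C ?X Z" using simple_nonzero_class_rep c by blast
    obtain q where q: "q \<in> Mor C Z ?X" "q \<cdot> u = Id C ?X" using simple_retraction X u by blast
    obtain U h where U: "simple_object C U" "d = iso_class C U"
      and h: "h \<in> Mor C U (F ?X)" "h \<noteq> Zero C U (F ?X)"
      using c(2) unfolding support_def by auto
    note Tu = T_closed[OF u(1)] and Tq = T_closed[OF q(1)]
    have "T q \<cdot> T u = Id C (F ?X)"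
      using T_Comp[OF u(1) q(1)] q(2) T_Id[OF simple_Obj[OF X]] by simp
    then have "T q \<cdot> (T u \<cdot> h) = h"
      using Comp_assoc[OF h(1) Tu Tq] Id_left[OF h(1)] by simp
    then have "T u \<cdot> h \<noteq> Zero C U (F Z)"
      using h(2) Comp_Zero_right[OF Tq simple_Obj[OF U(1)]] by auto
    then show "d \<in> support C (F Z)"
      using support_iff[OF U(1)] U(2) Comp_closed[OF h(1) Tu] by blast
  qed
qed

end

section \<open>Duals of simple objects\<close>

context fusion_category
begin

lemma left_dualE:
  assumes "is_left_dual C D X"
  obtains ev coev where "left_dual C D X ev coev"
proof -
  obtain ev coev where
    "X \<in> Obj C" "D \<in> Obj C" "ev \<in> Mor C (D \<boxtimes> X) (Unit C)" "coev \<in> Mor C (Unit C) (X \<boxtimes> D)"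
    "RUnit C X \<cdot> ((Id C X \<boxtimes>\<^sub>m ev) \<cdot> (Assoc C X D X \<cdot> (coev \<boxtimes>\<^sub>m Id C X))) = LUnit C X"
    "LUnit C D \<cdot> ((ev \<boxtimes>\<^sub>m Id C D) \<cdot>
       (inv_arr C (Assoc C D X D) \<cdot> (Id C D \<boxtimes>\<^sub>m coev))) = RUnit C D"
    using assms unfolding is_left_dual_def by blast
  then have "left_dual C D X ev coev"
    by (intro left_dual.intro left_dual_axioms.intro tensor_category_axioms)
  then show thesis using that by blast
qed

text \<open>The map \<open>e \<mapsto> sharp_left X (ev \<cdot> (e \<boxtimes> Id))\<close> embeds the endomorphisms of the dual into
  \<open>Hom(1 \<otimes> X, X \<otimes> 1)\<close>, which is a line if \<open>X\<close> is simple. So the idempotent belonging to a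
  simple summand of the dual is a scalar, and the summand is everything.\<close>

lemma dual_simple:
  assumes X: "simple_object C X" and dual: "is_left_dual C D X"
  shows "simple_object C D"
proof -
  obtain ev coev where "left_dual C D X ev coev" using left_dualE dual by blast
  then interpret left_dual C D X ev coev .
  let ?I = "Id C (Unit C)"
  define T where "T = (\<lambda>e. ev \<cdot> (e \<boxtimes>\<^sub>m Id C X))"
  define S where "S = (\<lambda>e. (RUnit C X \<cdot> sharp_left X (T e)) \<cdot> inv_arr C (LUnit C X))"
  note I = Id_closed[OF obj(1)] and ID = Id_closed[OF obj(2)]
  note l = LUnit_closed[OF obj(1)] LUnit_iso[OF obj(1)]
  note r = RUnit_closed[OF obj(1)] RUnit_iso[OF obj(1)]
  have T_Mor: "T e \<in> Mor C (D \<boxtimes> X) (Unit C)" if "e \<in> Mor C D D" for e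
    unfolding T_def using Comp_closed[OF TensArr_closed[OF that I] ev] .
  note sh = sharp_left_Mor[OF T_Mor obj(1)]
  have S_Mor: "S e \<in> Mor C X X" if "e \<in> Mor C D D" for e
    unfolding S_def using Comp_closed[OF inv_arr(1)[OF l] Comp_closed[OF sh[OF that] r(1)]] .
  have zagT: "(T e \<boxtimes>\<^sub>m Id C D) \<cdot> (inv_arr C (Assoc C D X D) \<cdot> (Id C D \<boxtimes>\<^sub>m coev)) = zag \<cdot> (e \<boxtimes>\<^sub>m ?I)"
    if "e \<in> Mor C D D" for e
  proof -
    have e: "e \<in> Arr C" "src C e = D" "tgt C e = D" using that by (simp_all add: Mor_iff)
    have "(T e \<boxtimes>\<^sub>m Id C D) \<cdot> (inv_arr C (Assoc C D X D) \<cdot> (Id C D \<boxtimes>\<^sub>m coev))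
        = (ev \<boxtimes>\<^sub>m Id C D) \<cdot> ((((e \<boxtimes>\<^sub>m Id C X) \<boxtimes>\<^sub>m Id C D) \<cdot> inv_arr C (Assoc C D X D)) \<cdot> (Id C D \<boxtimes>\<^sub>m coev))"
      unfolding T_def using e by (simp add: dual_simps arr_interchange')
    also have "((e \<boxtimes>\<^sub>m Id C X) \<boxtimes>\<^sub>m Id C D) \<cdot> inv_arr C (Assoc C D X D)
        = inv_arr C (Assoc C D X D) \<cdot> (e \<boxtimes>\<^sub>m (Id C X \<boxtimes>\<^sub>m Id C D))"
      using inv_Assoc_natural[of e "Id C X" "Id C D"] e by (simp only: dual_simps)
    also have "(ev \<boxtimes>\<^sub>m Id C D) \<cdot> ((inv_arr C (Assoc C D X D) \<cdot> (e \<boxtimes>\<^sub>m (Id C X \<boxtimes>\<^sub>m Id C D))) \<cdot> (Id C D \<boxtimes>\<^sub>m coev))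
        = zag \<cdot> (e \<boxtimes>\<^sub>m ?I)"
      unfolding zag_def using e by (simp add: dual_simps arr_interchange)
    finally show ?thesis .
  qed
  have T_inj: "e = e'" if e: "e \<in> Mor C D D" and e': "e' \<in> Mor C D D" and "T e = T e'" for e e'
  proof (rule Tens_Unit_inject[OF e e'])
    show "e \<boxtimes>\<^sub>m ?I = e' \<boxtimes>\<^sub>m ?I"
      using Comp_iso_cancel_left[OF zag_Mor zag_iso TensArr_closed[OF e Id_closed[OF Unit_closed]]
        TensArr_closed[OF e' Id_closed[OF Unit_closed]]] zagT[OF e] zagT[OF e'] that(3) by simp
  qed
  have S_inj: "e = e'" if e: "e \<in> Mor C D D" and e': "e' \<in> Mor C D D" and eq: "S e = S e'" for e e'
  proof (rule T_inj[OF e e'], rule sharp_left_inject[OF T_Mor[OF e] T_Mor[OF e'] obj(1)])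
    have "RUnit C X \<cdot> sharp_left X (T e) = RUnit C X \<cdot> sharp_left X (T e')"
      using Comp_iso_cancel_right[OF inv_arr(1)[OF l] iso_arr_inv[OF l]
          Comp_closed[OF sh[OF e] r(1)] Comp_closed[OF sh[OF e'] r(1)]] eq
      unfolding S_def by blast
    then show "sharp_left X (T e) = sharp_left X (T e')"
      using Comp_iso_cancel_left[OF r sh[OF e] sh[OF e']] by blast
  qed
  have S_Scale: "S (Scale C c e) = Scale C c (S e)" if e: "e \<in> Mor C D D" for c e
  proof -
    have "T (Scale C c e) = Scale C c (T e)"
      unfolding T_def Tens_Scale_left[OF e I] using Comp_Scale_right[OF TensArr_closed[OF e I] ev] .
    moreover have "sharp_left X (Scale C c (T e)) = Scale C c (sharp_left X (T e))"
    proof -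
      have b: "Assoc C X D X \<cdot> (coev \<boxtimes>\<^sub>m Id C X) \<in> Mor C (Unit C \<boxtimes> X) (X \<boxtimes> (D \<boxtimes> X))"
        by (simp add: Mor_iff dual_simps)
      show ?thesis
        unfolding sharp_left_def Tens_Scale_right[OF I T_Mor[OF e]]
        using Comp_Scale_left[OF b TensArr_closed[OF I T_Mor[OF e]]] .
    qed
    ultimately show ?thesis
      unfolding S_def
      using Comp_Scale_right[OF sh[OF e] r(1)]
        Comp_Scale_left[OF inv_arr(1)[OF l] Comp_closed[OF sh[OF e] r(1)]] by simp
  qed
  have "\<not> zero_object C D"
  proof
    assume "zero_object C D"
    then have Z: "Id C D = Zero C D D" using zero_object_iff obj by blast
    have "coev = (Id C X \<boxtimes>\<^sub>m Id C D) \<cdot> coev" by (simp add: dual_simps)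
    also have "\<dots> = Zero C (Unit C) (X \<boxtimes> D)"
      unfolding Z Tens_Zero_right[OF I obj(2,2)] using Comp_Zero_left[OF coev] obj Tens_closed by simp
    finally have "zig = Zero C (Unit C \<boxtimes> X) (X \<boxtimes> Unit C)"
      unfolding zig_def
      using Tens_Zero_left[OF I Unit_closed Tens_closed[OF obj(1,2)]]
        Comp_Zero_right[OF Assoc_closed[OF obj(1,2,1)] Tens_closed[OF Unit_closed obj(1)]]
        Comp_Zero_right[OF TensArr_closed[OF I ev] Tens_closed[OF Unit_closed obj(1)]] by simp
    then have "LUnit C X = Zero C (Unit C \<boxtimes> X) X"
      using zigzag1 Comp_Zero_right[OF r(1) Tens_closed[OF Unit_closed obj(1)]] by (simp add: zig_def)
    then show False
      using iso_nonzero[OF X inv_arr(1)[OF l] iso_arr_inv[OF l]] inv_arr(3)[OF l]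
        Comp_Zero_left[OF inv_arr(1)[OF l] obj(1)] simple_Id_nonzero[OF X] by simp
  qed
  then have "support C D \<noteq> {}" using support_nonempty obj by blast
  then obtain Y u where Y: "simple_object C Y" and u: "u \<in> Mor C Y D" "u \<noteq> Zero C Y D"
    unfolding support_def by blast
  then obtain p where p: "p \<in> Mor C D Y" "p \<cdot> u = Id C Y" using simple_retraction by blast
  define e where "e = u \<cdot> p"
  have e: "e \<in> Mor C D D" unfolding e_def using Comp_closed[OF p(1) u(1)] .
  obtain c1 where c1: "S (Id C D) = Scale C c1 (Id C X)" using schur_scalar[OF X S_Mor[OF ID]] by blast
  obtain c2 where c2: "S e = Scale C c2 (Id C X)" using schur_scalar[OF X S_Mor[OF e]] by blast
  have "c1 \<noteq> 0"
  proof
    assume "c1 = 0"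
    then have "S (Id C D) = S (Scale C 0 (Id C D))"
      unfolding S_Scale[OF ID] using c1 Scale_0[OF I] Scale_0[OF S_Mor[OF ID]] by simp
    then have "Id C D = Zero C D D"
      using S_inj[OF ID Scale_closed[OF ID]] Scale_0[OF ID] by metis
    then show False using \<open>\<not> zero_object C D\<close> zero_object_iff obj by blast
  qed
  then have "S e = S (Scale C (c2 / c1) (Id C D))"
    unfolding S_Scale[OF ID] c1 c2 using Scale_Scale[OF I, of "c2 / c1" c1] by simp
  then have e_scalar: "e = Scale C (c2 / c1) (Id C D)" using S_inj[OF e Scale_closed[OF ID]] by blast
  have "u = e \<cdot> u"
    unfolding e_def using Comp_assoc[OF u(1) p(1) u(1)] p(2) Id_right[OF u(1)] by simp
  also have "\<dots> = Scale C (c2 / c1) u"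
    unfolding e_scalar using Comp_Scale_left[OF u(1) ID] Id_left[OF u(1)] by simp
  finally have "c2 / c1 = 1"
    using Scale_cancel[OF u, of "c2 / c1" 1] Scale_one[OF u(1)] by simp
  then have "u \<cdot> p = Id C D" using e_scalar Scale_one[OF ID] by (simp add: e_def)
  then have "isomorphic C Y D" using isomorphicI[OF u(1) iso_arrI[OF u(1) p(1,2)]] by blast
  then show ?thesis using simple_isomorphic Y by blast
qed


section \<open>The polygroup of simple classes\<close>

lemma Tens_left_functor:
  assumes W: "W \<in> Obj C"
  shows "additive_endofunctor C (\<lambda>Z. Z \<boxtimes> W) (\<lambda>f. f \<boxtimes>\<^sub>m Id C W)"
proof (unfold_locales, goal_cases)
  case 1 then show ?case by (rule Tens_closed[OF _ W])
next
  case 2 then show ?case by (rule TensArr_closed[OF _ Id_closed[OF W]])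
next
  case 3 then show ?case by (rule Tens_Id[OF _ W])
next
  case 4 then show ?case using Tens_Comp[OF 4 Id_closed[OF W] Id_closed[OF W]] Id_left[OF Id_closed[OF W]] by simp
next
  case 5 then show ?case by (rule Tens_Plus_left[OF _ _ Id_closed[OF W]])
qed

lemma Tens_right_functor:
  assumes W: "W \<in> Obj C"
  shows "additive_endofunctor C (\<lambda>Z. W \<boxtimes> Z) (\<lambda>f. Id C W \<boxtimes>\<^sub>m f)"
proof (unfold_locales, goal_cases)
  case 1 then show ?case by (rule Tens_closed[OF W])
next
  case 2 then show ?case by (rule TensArr_closed[OF Id_closed[OF W]])
next
  case 3 then show ?case by (rule Tens_Id[OF W])
next
  case 4 then show ?case using Tens_Comp[OF Id_closed[OF W] Id_closed[OF W] 4] Id_left[OF Id_closed[OF W]] by simp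
next
  case 5 then show ?case by (rule Tens_Plus_right[OF Id_closed[OF W]])
qed

lemmas mor_eq_Tens_left = additive_endofunctor.mor_eq_functor[OF Tens_left_functor]
  and mor_eq_Tens_right = additive_endofunctor.mor_eq_functor[OF Tens_right_functor]
  and support_Tens_left = additive_endofunctor.support_functor[OF Tens_left_functor]
  and support_Tens_right = additive_endofunctor.support_functor[OF Tens_right_functor]

definition class_mult :: "'o set \<Rightarrow> 'o set \<Rightarrow> 'o set set" where
  "class_mult a b = support C (class_rep a \<boxtimes> class_rep b)"

lemma class_rep_Obj: "c \<in> simple_classes C \<Longrightarrow> class_rep c \<in> Obj C"
  using simple_class_rep simple_Obj by blast

lemma dual_class_dual:
  assumes c: "c \<in> simple_classes C"
  obtains D where "is_left_dual C D (class_rep c)" "simple_object C D" "dual_class C c = iso_class C D"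
proof -
  let ?D = "SOME D. is_left_dual C D (class_rep c)"
  have D: "is_left_dual C ?D (class_rep c)"
    using left_duals[OF class_rep_Obj[OF c]] by (rule someI_ex)
  moreover have "simple_object C ?D" using dual_simple simple_class_rep c D by blast
  ultimately show thesis using that unfolding dual_class_def by blast
qed

lemma support_Tens_simple:
  assumes "simple_object C X" "W \<in> Obj C"
  shows "support C (X \<boxtimes> W) = support C (class_rep (iso_class C X) \<boxtimes> W)"
    and "support C (W \<boxtimes> X) = support C (W \<boxtimes> class_rep (iso_class C X))"
  using support_Tens_left[of W X] support_Tens_right[of W X] support_simple[OF assms(1)] assms(2)
    simple_Obj[OF assms(1)] by auto

text \<open>Frobenius reciprocity, for the left and the right factor.\<close>

lemma class_mult_reverse_left:
  assumes x: "x \<in> simple_classes C" and y: "y \<in> simple_classes C" and z: "z \<in> class_mult x y"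
  shows "y \<in> class_mult (dual_class C x) z"
proof -
  let ?x = "class_rep x" and ?y = "class_rep y" and ?z = "class_rep z"
  obtain D where D: "is_left_dual C D ?x" "simple_object C D" "dual_class C x = iso_class C D"
    using dual_class_dual x by blast
  obtain ev coev where "left_dual C D ?x ev coev" using left_dualE D by blast
  then interpret left_dual C D ?x ev coev .
  obtain f where f: "f \<in> Mor C ?z (?x \<boxtimes> ?y)" "f \<noteq> Zero C ?z (?x \<boxtimes> ?y)"
    using simple_nonzero_class_rep z unfolding class_mult_def by blast
  note yO = class_rep_Obj[OF y]
  have zO: "?z \<in> Obj C" using f MorD by blast
  note DO = simple_Obj[OF D(2)]
  have O: "?x \<boxtimes> ?y \<in> Obj C" "D \<boxtimes> ?z \<in> Obj C" using Tens_closed obj yO zO DO by blast+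
  note g = flat_left_Mor[OF f(1) yO]
  have "flat_left ?y (Zero C ?z (?x \<boxtimes> ?y)) = Zero C (D \<boxtimes> ?z) (Unit C \<boxtimes> ?y)"
    unfolding flat_left_def Tens_Zero_right[OF Id_closed[OF DO] zO O(1)]
    using Comp_Zero_right[OF inv_arr(1)[OF Assoc_closed Assoc_iso, OF DO obj(1) yO DO obj(1) yO] O(2)]
      Comp_Zero_right[OF TensArr_closed[OF ev Id_closed[OF yO]] O(2)] by simp
  then have "flat_left ?y f \<noteq> Zero C (D \<boxtimes> ?z) (Unit C \<boxtimes> ?y)"
    using flat_left_inject[OF f(1) Zero_closed[OF zO O(1)] yO] f(2) by auto
  then have "LUnit C ?y \<cdot> flat_left ?y f \<noteq> Zero C (D \<boxtimes> ?z) ?y"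
    using nonzero_Comp_iso_left[OF LUnit_closed[OF yO] LUnit_iso[OF yO] g] by blast
  then have "iso_class C ?y \<in> support C (D \<boxtimes> ?z)"
    using support_iff_quotient[OF simple_class_rep(1)[OF y]] Comp_closed[OF g LUnit_closed[OF yO]] by blast
  then show ?thesis
    unfolding class_mult_def D(3) using simple_class_rep(2)[OF y] support_Tens_simple(1)[OF D(2) zO] by simp
qed

lemma class_mult_reverse_right:
  assumes x: "x \<in> simple_classes C" and y: "y \<in> simple_classes C" and z: "z \<in> class_mult x y"
  shows "x \<in> class_mult z (dual_class C y)"
proof -
  let ?x = "class_rep x" and ?y = "class_rep y" and ?z = "class_rep z"
  obtain D where D: "is_left_dual C D ?y" "simple_object C D" "dual_class C y = iso_class C D"
    using dual_class_dual y by blast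
  obtain ev coev where "left_dual C D ?y ev coev" using left_dualE D by blast
  then interpret left_dual C D ?y ev coev .
  have zc: "z \<in> simple_classes C"
    using z unfolding class_mult_def by (rule subsetD[OF support_subset])
  note zs = simple_class_rep[OF zc]
  obtain f where f: "f \<in> Mor C (?x \<boxtimes> ?y) ?z" "f \<noteq> Zero C (?x \<boxtimes> ?y) ?z"
    using support_iff_quotient[OF zs(1)] z zs(2) unfolding class_mult_def by auto
  note xO = class_rep_Obj[OF x] and zO = class_rep_Obj[OF zc] and DO = simple_Obj[OF D(2)]
  have O: "?x \<boxtimes> ?y \<in> Obj C" "?z \<boxtimes> D \<in> Obj C" "?x \<boxtimes> Unit C \<in> Obj C"
    using Tens_closed obj xO zO DO Unit_closed by blast+
  note g = sharp_right_Mor[OF f(1) xO]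
  note r = RUnit_closed[OF xO] RUnit_iso[OF xO]
  have "inv_arr C (Assoc C ?x ?y D) \<cdot> (Id C ?x \<boxtimes>\<^sub>m coev) \<in> Mor C (?x \<boxtimes> Unit C) ((?x \<boxtimes> ?y) \<boxtimes> D)"
    using xO by (simp add: Mor_iff dual_simps)
  then have "sharp_right ?x (Zero C (?x \<boxtimes> ?y) ?z) = Zero C (?x \<boxtimes> Unit C) (?z \<boxtimes> D)"
    unfolding sharp_right_def Tens_Zero_left[OF Id_closed[OF DO] O(1) zO]
    using Comp_Zero_left O(2) by blast
  then have "sharp_right ?x f \<noteq> Zero C (?x \<boxtimes> Unit C) (?z \<boxtimes> D)"
    using sharp_right_inject[OF f(1) Zero_closed[OF O(1) zO] xO] f(2) by auto
  then have "sharp_right ?x f \<cdot> inv_arr C (RUnit C ?x) \<noteq> Zero C ?x (?z \<boxtimes> D)"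
    using nonzero_Comp_iso_right[OF inv_arr(1)[OF r] iso_arr_inv[OF r] g] by blast
  then have "iso_class C ?x \<in> support C (?z \<boxtimes> D)"
    using support_iff[OF simple_class_rep(1)[OF x]] Comp_closed[OF inv_arr(1)[OF r] g] by blast
  then show ?thesis
    unfolding class_mult_def D(3) using simple_class_rep(2)[OF x] support_Tens_simple(2)[OF D(2) zO] by simp
qed

end

sublocale fusion_category \<subseteq> simples:
  polygroup "simple_classes C" "class_mult" "iso_class C (Unit C)" "dual_class C"
proof
  show "class_mult x y \<subseteq> simple_classes C" for x y
    unfolding class_mult_def by (rule support_subset)
  show unit: "iso_class C (Unit C) \<in> simple_classes C"
    using simple_Unit unfolding simple_classes_def by blast
  show "dual_class C x \<in> simple_classes C" if "x \<in> simple_classes C" for x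
    using dual_class_dual[OF that] unfolding simple_classes_def by blast
  show "(\<Union>w \<in> class_mult x y. class_mult w z) = (\<Union>w \<in> class_mult y z. class_mult x w)"
    if "x \<in> simple_classes C" "y \<in> simple_classes C" "z \<in> simple_classes C" for x y z
  proof -
    note O = that[THEN class_rep_Obj]
    have "(\<Union>w \<in> class_mult x y. class_mult w z) = support C ((class_rep x \<boxtimes> class_rep y) \<boxtimes> class_rep z)"
      unfolding class_mult_def using support_Tens_left[OF O(3) Tens_closed[OF O(1,2)]] by simp
    also have "\<dots> = support C (class_rep x \<boxtimes> (class_rep y \<boxtimes> class_rep z))"
      using support_isomorphic[OF isomorphicI[OF Assoc_closed[OF O] Assoc_iso[OF O]]] .
    also have "\<dots> = (\<Union>w \<in> class_mult y z. class_mult x w)"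
      unfolding class_mult_def using support_Tens_right[OF O(1) Tens_closed[OF O(2,3)]] by simp
    finally show ?thesis .
  qed
  show "class_mult (iso_class C (Unit C)) x = {x}" if x: "x \<in> simple_classes C" for x
  proof -
    note O = class_rep_Obj[OF x]
    have "class_mult (iso_class C (Unit C)) x = support C (Unit C \<boxtimes> class_rep x)"
      unfolding class_mult_def using support_Tens_simple(1)[OF simple_Unit O] by simp
    also have "\<dots> = support C (class_rep x)"
      using support_isomorphic[OF isomorphicI[OF LUnit_closed[OF O] LUnit_iso[OF O]]] .
    finally show ?thesis using support_simple simple_class_rep[OF x] by simp
  qed
  show "class_mult x (iso_class C (Unit C)) = {x}" if x: "x \<in> simple_classes C" for x
  proof -
    note O = class_rep_Obj[OF x]
    have "class_mult x (iso_class C (Unit C)) = support C (class_rep x \<boxtimes> Unit C)"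
      unfolding class_mult_def using support_Tens_simple(2)[OF simple_Unit O] by simp
    also have "\<dots> = support C (class_rep x)"
      using support_isomorphic[OF isomorphicI[OF RUnit_closed[OF O] RUnit_iso[OF O]]] .
    finally show ?thesis using support_simple simple_class_rep[OF x] by simp
  qed
qed (use class_mult_reverse_left class_mult_reverse_right in blast)+

section \<open>Spans of sets of basis elements\<close>

lemma zspan_iff: "c \<in> zspan S \<longleftrightarrow> Poly_Mapping.keys c \<subseteq> S"
  by (simp add: zspan_def)

lemma frag_of_in_zspan: "frag_of x \<in> zspan S \<longleftrightarrow> x \<in> S"
  by (simp add: zspan_iff)

lemma zspan_subset_iff: "zspan S \<subseteq> zspan T \<longleftrightarrow> S \<subseteq> T"
proof
  assume *: "zspan S \<subseteq> zspan T"
  show "S \<subseteq> T"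
  proof
    fix x assume "x \<in> S"
    then have "frag_of x \<in> zspan S" by (simp only: frag_of_in_zspan)
    from subsetD[OF * this] show "x \<in> T" by (simp only: frag_of_in_zspan)
  qed
qed (auto simp: zspan_iff)

lemma zspan_eq_iff: "zspan S = zspan T \<longleftrightarrow> S = T"
  using zspan_subset_iff[of S T] zspan_subset_iff[of T S] by auto

lemma zspan_Inter: "zspan (\<Inter>\<S>) = \<Inter> (zspan ` \<S>)"
  by (simp add: set_eq_iff zspan_iff le_Inf_iff)

lemma zspan_eq_zero_iff: "zspan S = {0} \<longleftrightarrow> S = {}"
proof
  assume "zspan S = {0}"
  then show "S = {}" using frag_of_in_zspan[of _ S] frag_of_nonzero by auto
qed (auto simp: zspan_iff)

definition frag_restrict :: "'b set \<Rightarrow> ('b \<Rightarrow>\<^sub>0 int) \<Rightarrow> ('b \<Rightarrow>\<^sub>0 int)" where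
  "frag_restrict S c = frag_extend (\<lambda>x. if x \<in> S then frag_of x else 0) c"

lemma lookup_frag_restrict:
  "Poly_Mapping.lookup (frag_restrict S c) k = (if k \<in> S then Poly_Mapping.lookup c k else 0)"
proof -
  have "Poly_Mapping.keys c \<subseteq> UNIV" by simp
  then show ?thesis
    unfolding frag_restrict_def
    by (induction c rule: frag_induction) (auto simp: frag_extend_diff lookup_minus)
qed

lemma keys_frag_restrict: "Poly_Mapping.keys (frag_restrict S c) \<subseteq> S"
  by (auto simp: in_keys_iff lookup_frag_restrict split: if_splits)

text \<open>For disjoint sets of basis elements, a coefficient of a sum comes from a single summand.\<close>

lemma zspan_sum_coeff:
  assumes "finite F" "zspan S \<in> F" and F: "F = zspan ` \<S>" and disj: "disjoint \<S>"
    and x: "x \<in> (\<Pi>\<^sub>E N \<in> F. N)" and k: "k \<in> S"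
  shows "Poly_Mapping.lookup (\<Sum>N \<in> F. x N) k = Poly_Mapping.lookup (x (zspan S)) k"
proof -
  have "Poly_Mapping.lookup (x N) k = 0" if N: "N \<in> F - {zspan S}" for N
  proof -
    obtain T where T: "T \<in> \<S>" "N = zspan T" using N F by blast
    have "S \<in> \<S>" using assms(2) F by (auto simp: zspan_eq_iff)
    moreover have "T \<noteq> S" using T N by blast
    ultimately have "k \<notin> T" using pairwiseD[OF disj T(1)] k by (auto simp: disjnt_iff)
    moreover have "x N \<in> zspan T" using x N T by (auto simp: PiE_iff)
    ultimately show ?thesis by (auto simp: zspan_iff in_keys_iff)
  qed
  then show ?thesis
    using sum.remove[OF assms(1,2), of x] by (simp add: lookup_add lookup_sum)
qed

text \<open>If the sets overlap in \<open>k\<close>, then \<open>frag_of k\<close> can be placed in two different summands, against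
  injectivity. If they partition \<open>T\<close>, the coefficients of the sum determine all summands and can
  be prescribed.\<close>

lemma internal_direct_sum_zspan_iff:
  fixes \<S> :: "'b set set"
  assumes fin: "finite \<S>"
  shows "internal_direct_sum (zspan T) (zspan ` \<S>) \<longleftrightarrow> disjoint \<S> \<and> \<Union>\<S> = T"
proof
  let ?F = "zspan ` \<S>" and ?s = "\<lambda>x. \<Sum>N \<in> zspan ` \<S>. x N"
  have finF: "finite ?F" using fin by simp
  assume *: "disjoint \<S> \<and> \<Union>\<S> = T"
  then have disj: "disjoint \<S>" and un: "\<Union>\<S> = T" by auto
  have "inj_on ?s (\<Pi>\<^sub>E N \<in> ?F. N)"
  proof (rule inj_onI)
    fix x y assume x: "x \<in> (\<Pi>\<^sub>E N \<in> ?F. N)" and y: "y \<in> (\<Pi>\<^sub>E N \<in> ?F. N)" and eq: "?s x = ?s y"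
    show "x = y"
    proof (rule PiE_ext[OF x y])
      fix N assume N: "N \<in> ?F"
      then obtain S where S: "S \<in> \<S>" "N = zspan S" by blast
      show "x N = y N"
      proof (rule poly_mapping_eqI)
        fix k
        show "Poly_Mapping.lookup (x N) k = Poly_Mapping.lookup (y N) k"
        proof (cases "k \<in> S")
          case True
          then show ?thesis
            using zspan_sum_coeff[OF finF _ refl disj x True] zspan_sum_coeff[OF finF _ refl disj y True]
              N S eq by simp
        next
          case False
          have "x N \<in> zspan S" "y N \<in> zspan S" using x y N S by (auto simp: PiE_iff)
          then have "k \<notin> Poly_Mapping.keys (x N)" "k \<notin> Poly_Mapping.keys (y N)"
            using False by (auto simp: zspan_iff)
          then show ?thesis by (simp add: in_keys_iff)
        qed
      qed
    qed
  qed
  moreover have "?s x \<in> zspan T" if x: "x \<in> (\<Pi>\<^sub>E N \<in> ?F. N)" for x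
  proof -
    have "Poly_Mapping.keys (x N) \<subseteq> T" if N: "N \<in> ?F" for N
    proof -
      obtain S where S: "S \<in> \<S>" "N = zspan S" using N by blast
      then have "x N \<in> zspan S" using x N by (auto simp: PiE_iff)
      then show ?thesis using S(1) un unfolding zspan_iff by blast
    qed
    then have "(\<Union>N \<in> ?F. Poly_Mapping.keys (x N)) \<subseteq> T" by blast
    then show ?thesis unfolding zspan_iff using keys_sum[of x ?F] by (rule order_trans[rotated])
  qed
  moreover have "c \<in> ?s ` (\<Pi>\<^sub>E N \<in> ?F. N)" if c: "c \<in> zspan T" for c
  proof -
    define x where "x = (\<lambda>N \<in> ?F. frag_restrict {k. frag_of k \<in> N} c)"
    have x_zspan: "x (zspan S) = frag_restrict S c" if "S \<in> \<S>" for S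
      using that by (simp add: x_def frag_of_in_zspan)
    have x: "x \<in> (\<Pi>\<^sub>E N \<in> ?F. N)"
    proof (rule PiE_I)
      fix N assume "N \<in> ?F"
      then obtain S where S: "S \<in> \<S>" "N = zspan S" by blast
      then show "x N \<in> N" using x_zspan keys_frag_restrict by (simp add: zspan_iff)
    qed (simp add: x_def)
    have "?s x = c"
    proof (rule poly_mapping_eqI)
      fix k
      show "Poly_Mapping.lookup (?s x) k = Poly_Mapping.lookup c k"
      proof (cases "k \<in> T")
        case True
        then obtain S where S: "S \<in> \<S>" "k \<in> S" using un by blast
        then show ?thesis
          using zspan_sum_coeff[OF finF _ refl disj x S(2)] x_zspan by (simp add: lookup_frag_restrict)
      next
        case False
        have "Poly_Mapping.lookup (x N) k = 0" if N: "N \<in> ?F" for N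
        proof -
          obtain S where S: "S \<in> \<S>" "N = zspan S" using N by blast
          then have "k \<notin> S" using False un by blast
          then show ?thesis using S x_zspan by (simp add: lookup_frag_restrict)
        qed
        moreover have "Poly_Mapping.lookup c k = 0"
          using c False by (auto simp: zspan_iff in_keys_iff)
        ultimately show ?thesis by (simp add: lookup_sum)
      qed
    qed
    then show ?thesis using x by blast
  qed
  ultimately show "internal_direct_sum (zspan T) ?F"
    unfolding internal_direct_sum_def bij_betw_def using finF by blast
next
  let ?F = "zspan ` \<S>" and ?s = "\<lambda>x. \<Sum>N \<in> zspan ` \<S>. x N"
  assume "internal_direct_sum (zspan T) ?F"
  then have finF: "finite ?F" and inj: "inj_on ?s (\<Pi>\<^sub>E N \<in> ?F. N)"
    and im: "?s ` (\<Pi>\<^sub>E N \<in> ?F. N) = zspan T"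
    unfolding internal_direct_sum_def bij_betw_def by auto
  \<comment> \<open>The basis element \<open>k\<close>, placed in the summand spanned by \<open>S\<close>.\<close>
  define unit_at where "unit_at = (\<lambda>(k :: 'b) S. \<lambda>N \<in> ?F. if N = zspan S then frag_of k else 0)"
  have unit_at: "unit_at k S \<in> (\<Pi>\<^sub>E N \<in> ?F. N)" "?s (unit_at k S) = frag_of k"
    if "k \<in> S" "S \<in> \<S>" for k S
  proof -
    show "unit_at k S \<in> (\<Pi>\<^sub>E N \<in> ?F. N)"
      using that by (auto simp: unit_at_def zspan_iff zspan_eq_iff)
    have "?s (unit_at k S) = (\<Sum>N \<in> ?F. if N = zspan S then frag_of k else 0)"
      by (rule sum.cong) (auto simp: unit_at_def)
    then show "?s (unit_at k S) = frag_of k" using that finF by simp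
  qed
  have "S = S'" if S: "S \<in> \<S>" "S' \<in> \<S>" "k \<in> S" "k \<in> S'" for S S' k
  proof (rule ccontr)
    assume "S \<noteq> S'"
    have "unit_at k S = unit_at k S'"
      by (rule inj_onD[OF inj]) (use unit_at S in auto)
    then have "unit_at k S (zspan S) = unit_at k S' (zspan S)" by simp
    then show False using S \<open>S \<noteq> S'\<close> by (simp add: unit_at_def zspan_eq_iff)
  qed
  then have "disjoint \<S>" unfolding pairwise_def disjnt_def by blast
  moreover have "\<Union>\<S> \<subseteq> T"
  proof
    fix k assume "k \<in> \<Union>\<S>"
    then obtain S where S: "S \<in> \<S>" "k \<in> S" by blast
    have "?s (unit_at k S) \<in> ?s ` (\<Pi>\<^sub>E N \<in> ?F. N)"
      using unit_at(1)[OF S(2,1)] by (rule imageI)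
    then have "frag_of k \<in> zspan T"
      unfolding im unit_at(2)[OF S(2,1)] .
    then show "k \<in> T" by (simp only: frag_of_in_zspan)
  qed
  moreover have "T \<subseteq> \<Union>\<S>"
  proof
    fix k assume "k \<in> T"
    then have "frag_of k \<in> zspan T" by (simp only: frag_of_in_zspan)
    then obtain x where x: "x \<in> (\<Pi>\<^sub>E N \<in> ?F. N)" "frag_of k = ?s x"
      using im by (metis (no_types, lifting) imageE)
    then have "k \<in> Poly_Mapping.keys (?s x)" using keys_frag_of by (metis insertI1)
    then obtain N where N: "N \<in> ?F" "k \<in> Poly_Mapping.keys (x N)" using keys_sum[of x ?F] by blast
    then obtain S where S: "S \<in> \<S>" "N = zspan S" by blast
    then have "x N \<in> zspan S" using x(1) N by (auto simp: PiE_iff)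
    then show "k \<in> \<Union>\<S>" using S N by (auto simp: zspan_iff)
  qed
  ultimately show "disjoint \<S> \<and> \<Union>\<S> = T" by blast
qed


section \<open>The universal grading group\<close>

context fusion_category
begin

lemma finite_simple_classes: "finite (simple_classes C)"
  using finitely_many_simples by (simp add: simple_classes_def)

lemma K0_mult_frag_of:
  "frag_of x \<otimes>\<^bsub>K0 C\<^esub> frag_of y = K0_class C (class_rep x \<boxtimes> class_rep y)"
  by (simp add: K0_def)

lemma keys_K0_mult_frag_of:
  assumes "x \<in> simple_classes C" "y \<in> simple_classes C"
  shows "Poly_Mapping.keys (frag_of x \<otimes>\<^bsub>K0 C\<^esub> frag_of y) = class_mult x y"
  using keys_K0_class Tens_closed class_rep_Obj assms
  by (simp add: K0_mult_frag_of class_mult_def)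

text \<open>For spans of sets of basis elements, closure under the multiplication of the Grothendieck ring
  only involves the supports of products of basis elements, hence only the polygroup.\<close>

lemma K0_mult_zspan_iff:
  assumes S: "S \<subseteq> simple_classes C" and T: "T \<subseteq> simple_classes C"
  shows "(\<forall>x \<in> zspan S. \<forall>y \<in> zspan T. x \<otimes>\<^bsub>K0 C\<^esub> y \<in> zspan U) \<longleftrightarrow>
    (\<forall>x \<in> S. \<forall>y \<in> T. class_mult x y \<subseteq> U)"
proof
  assume *: "\<forall>x \<in> zspan S. \<forall>y \<in> zspan T. x \<otimes>\<^bsub>K0 C\<^esub> y \<in> zspan U"
  show "\<forall>x \<in> S. \<forall>y \<in> T. class_mult x y \<subseteq> U"
  proof (intro ballI)
    fix x y assume xy: "x \<in> S" "y \<in> T"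
    have "frag_of x \<in> zspan S" "frag_of y \<in> zspan T" using xy by (simp_all only: frag_of_in_zspan)
    then have "frag_of x \<otimes>\<^bsub>K0 C\<^esub> frag_of y \<in> zspan U" using * by blast
    then show "class_mult x y \<subseteq> U"
      using keys_K0_mult_frag_of[of x y] xy S T by (auto simp: zspan_iff)
  qed
next
  assume *: "\<forall>x \<in> S. \<forall>y \<in> T. class_mult x y \<subseteq> U"
  show "\<forall>x \<in> zspan S. \<forall>y \<in> zspan T. x \<otimes>\<^bsub>K0 C\<^esub> y \<in> zspan U"
  proof (intro ballI)
    fix x y assume x: "x \<in> zspan S" and y: "y \<in> zspan T"
    let ?m = "\<lambda>a b. K0_class C (class_rep a \<boxtimes> class_rep b)"
    have "Poly_Mapping.keys (frag_extend (?m a) y) \<subseteq> U" if a: "a \<in> Poly_Mapping.keys x" for a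
    proof -
      have "Poly_Mapping.keys (?m a b) \<subseteq> U" if b: "b \<in> Poly_Mapping.keys y" for b
      proof -
        have ab: "a \<in> S" "b \<in> T" using a b x y by (auto simp: zspan_iff)
        then have "Poly_Mapping.keys (?m a b) = class_mult a b"
          using keys_K0_mult_frag_of[of a b] S T by (auto simp: K0_mult_frag_of)
        then show ?thesis using * ab by blast
      qed
      then show ?thesis using keys_frag_extend[of "?m a" y] by blast
    qed
    then have "Poly_Mapping.keys (frag_extend (\<lambda>a. frag_extend (?m a) y) x) \<subseteq> U"
      using keys_frag_extend[of "\<lambda>a. frag_extend (?m a) y" x] by blast
    then show "x \<otimes>\<^bsub>K0 C\<^esub> y \<in> zspan U" by (simp add: K0_def zspan_iff)
  qed
qed

lemma add_monoid_K0: "add_monoid (K0 C) = free_Abelian_group (simple_classes C)"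
  by (simp add: K0_def free_Abelian_group_def zspan_def)

lemma subring_zspan_iff:
  assumes S: "S \<subseteq> simple_classes C"
  shows "subring (zspan S) (K0 C) \<longleftrightarrow>
    iso_class C (Unit C) \<in> S \<and> (\<forall>x \<in> S. \<forall>y \<in> S. class_mult x y \<subseteq> S)"
proof
  assume "subring (zspan S) (K0 C)"
  then interpret subring "zspan S" "K0 C" .
  have "iso_class C (Unit C) \<in> S"
    using one_closed by (simp add: K0_def zspan_iff)
  moreover have "\<forall>x \<in> zspan S. \<forall>y \<in> zspan S. x \<otimes>\<^bsub>K0 C\<^esub> y \<in> zspan S" by blast
  ultimately show "iso_class C (Unit C) \<in> S \<and> (\<forall>x \<in> S. \<forall>y \<in> S. class_mult x y \<subseteq> S)"
    using K0_mult_zspan_iff[OF S S] by blast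
next
  assume *: "iso_class C (Unit C) \<in> S \<and> (\<forall>x \<in> S. \<forall>y \<in> S. class_mult x y \<subseteq> S)"
  have sub: "zspan S \<subseteq> zspan (simple_classes C)" using S by (simp add: zspan_subset_iff)
  show "subring (zspan S) (K0 C)"
  proof (intro subring.intro)
    show "subgroup (zspan S) (add_monoid (K0 C))"
      unfolding add_monoid_K0
    proof (rule subgroup.intro)
      show "zspan S \<subseteq> carrier (free_Abelian_group (simple_classes C))"
        using sub by (simp add: zspan_def)
    next
      fix x y assume "x \<in> zspan S" "y \<in> zspan S"
      then show "x \<otimes>\<^bsub>free_Abelian_group (simple_classes C)\<^esub> y \<in> zspan S"
        using keys_add[of x y] by (auto simp: zspan_iff)
    next
      fix x assume x: "x \<in> zspan S"
      then have "Poly_Mapping.keys x \<subseteq> simple_classes C" using S by (auto simp: zspan_iff)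
      then show "inv\<^bsub>free_Abelian_group (simple_classes C)\<^esub> x \<in> zspan S"
        using x by (simp add: zspan_iff)
    qed (simp add: zspan_iff)
    show "submonoid (zspan S) (K0 C)"
    proof (rule submonoid.intro)
      show "zspan S \<subseteq> carrier (K0 C)" using sub by (simp add: K0_def)
      show "\<one>\<^bsub>K0 C\<^esub> \<in> zspan S" using * by (simp add: K0_def zspan_iff)
      show "x \<otimes>\<^bsub>K0 C\<^esub> y \<in> zspan S" if "x \<in> zspan S" "y \<in> zspan S" for x y
        using that K0_mult_zspan_iff[OF S S] * by blast
    qed
  qed
qed

lemma K0_dual_frag_of: "K0_dual C (frag_of x) = frag_of (dual_class C x)"
  by (simp add: K0_dual_def)

lemma K0_dual_zspan_iff:
  "(\<forall>x \<in> zspan S. K0_dual C x \<in> zspan S) \<longleftrightarrow> (\<forall>x \<in> S. dual_class C x \<in> S)"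
proof
  assume *: "\<forall>x \<in> zspan S. K0_dual C x \<in> zspan S"
  show "\<forall>x \<in> S. dual_class C x \<in> S"
  proof
    fix x assume "x \<in> S"
    then have "frag_of x \<in> zspan S" by (simp only: frag_of_in_zspan)
    then have "K0_dual C (frag_of x) \<in> zspan S" using * by blast
    then show "dual_class C x \<in> S" unfolding K0_dual_frag_of by (simp only: frag_of_in_zspan)
  qed
next
  assume *: "\<forall>x \<in> S. dual_class C x \<in> S"
  show "\<forall>x \<in> zspan S. K0_dual C x \<in> zspan S"
  proof
    fix x assume "x \<in> zspan S"
    then have "(\<Union>a \<in> Poly_Mapping.keys x. Poly_Mapping.keys (frag_of (dual_class C a))) \<subseteq> S"
      using * by (auto simp: zspan_iff)
    then show "K0_dual C x \<in> zspan S"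
      unfolding K0_dual_def zspan_iff
      using keys_frag_extend[of "\<lambda>a. frag_of (dual_class C a)" x] by blast
  qed
qed

text \<open>The subrings over which \<open>R_ad\<close> is the intersection are the spans of the \<open>adjoint_closed\<close> sets.\<close>

lemma R_ad_eq: "R_ad C = zspan simples.adjoint_core"
proof -
  let ?P = "\<lambda>H. subring H (K0 C) \<and> (\<exists>S \<subseteq> simple_classes C. H = zspan S) \<and>
     (\<forall>x \<in> H. K0_dual C x \<in> H) \<and>
     (\<forall>X \<in> simple_classes C. frag_of X \<otimes>\<^bsub>K0 C\<^esub> K0_dual C (frag_of X) \<in> H)"
  have *: "?P (zspan S) \<longleftrightarrow> simples.adjoint_closed S" if S: "S \<subseteq> simple_classes C" for S
  proof -
    have "frag_of X \<otimes>\<^bsub>K0 C\<^esub> K0_dual C (frag_of X) \<in> zspan S \<longleftrightarrow> class_mult X (dual_class C X) \<subseteq> S"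
      if X: "X \<in> simple_classes C" for X
      unfolding K0_dual_frag_of zspan_iff
      using keys_K0_mult_frag_of[OF X simples.bar_closed[OF X]] by simp
    then have "(\<forall>X \<in> simple_classes C. frag_of X \<otimes>\<^bsub>K0 C\<^esub> K0_dual C (frag_of X) \<in> zspan S) \<longleftrightarrow>
        (\<forall>X \<in> simple_classes C. class_mult X (dual_class C X) \<subseteq> S)"
      by (rule ball_cong[OF refl])
    moreover have "\<exists>T \<subseteq> simple_classes C. zspan S = zspan T" using S by blast
    ultimately show ?thesis
      by (simp only: simples.adjoint_closed_def subring_zspan_iff[OF S] K0_dual_zspan_iff S simp_thms
        conj_assoc)
  qed
  have "{H. ?P H} = zspan ` {S. simples.adjoint_closed S}"
  proof (intro equalityI subsetI)
    fix H assume "H \<in> {H. ?P H}"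
    then have H: "?P H" by simp
    then obtain S where "S \<subseteq> simple_classes C" "H = zspan S" by blast
    then show "H \<in> zspan ` {S. simples.adjoint_closed S}" using * H by blast
  next
    fix H assume "H \<in> zspan ` {S. simples.adjoint_closed S}"
    then obtain S where S: "simples.adjoint_closed S" "H = zspan S" by blast
    then have "S \<subseteq> simple_classes C" unfolding simples.adjoint_closed_def by blast
    then show "H \<in> {H. ?P H}" using * S by blast
  qed
  then have "R_ad C = \<Inter> (zspan ` {S. simples.adjoint_closed S})" unfolding R_ad_def by simp
  also have "\<dots> = zspan (\<Inter> {S. simples.adjoint_closed S})"
    by (rule zspan_Inter[symmetric])
  finally show ?thesis by (simp add: simples.adjoint_core_def)
qed

text \<open>Left multiplication by the adjoint subring generates whole degrees, and right multiplication
  does not leave them by \<open>degree_mult_core\<close>.\<close>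

lemma based_subbimodule_zspan_iff:
  assumes S: "S \<subseteq> simple_classes C"
  shows "based_subbimodule C (zspan S) \<longleftrightarrow> (\<forall>x \<in> S. simples.degree x \<subseteq> S)"
proof -
  have core: "simples.adjoint_core \<subseteq> simple_classes C" using simples.core_subset by blast
  have "based_subbimodule C (zspan S) \<longleftrightarrow>
      (\<forall>r \<in> zspan simples.adjoint_core. \<forall>m \<in> zspan S. r \<otimes>\<^bsub>K0 C\<^esub> m \<in> zspan S) \<and>
      (\<forall>m \<in> zspan S. \<forall>r \<in> zspan simples.adjoint_core. m \<otimes>\<^bsub>K0 C\<^esub> r \<in> zspan S)"
    unfolding based_subbimodule_def R_ad_eq using S by blast
  also have "\<dots> \<longleftrightarrow> (\<forall>a \<in> simples.adjoint_core. \<forall>x \<in> S. class_mult a x \<subseteq> S) \<and>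
      (\<forall>x \<in> S. \<forall>a \<in> simples.adjoint_core. class_mult x a \<subseteq> S)"
    unfolding K0_mult_zspan_iff[OF core S] K0_mult_zspan_iff[OF S core] ..
  also have "\<dots> \<longleftrightarrow> (\<forall>x \<in> S. simples.degree x \<subseteq> S)"
  proof
    assume "(\<forall>a \<in> simples.adjoint_core. \<forall>x \<in> S. class_mult a x \<subseteq> S) \<and>
      (\<forall>x \<in> S. \<forall>a \<in> simples.adjoint_core. class_mult x a \<subseteq> S)"
    then show "\<forall>x \<in> S. simples.degree x \<subseteq> S" unfolding simples.degree_def by blast
  next
    assume *: "\<forall>x \<in> S. simples.degree x \<subseteq> S"
    have "class_mult x a \<subseteq> S" if "x \<in> S" "a \<in> simples.adjoint_core" for x a
    proof
      fix z assume z: "z \<in> class_mult x a"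
      have x: "x \<in> simple_classes C" using that S by blast
      then have "z \<in> simple_classes C" using z simples.mult_closed simples.core_subset that by blast
      moreover have "simples.degree z = simples.degree x"
        using simples.degree_mult_core[OF x that(2) z] .
      ultimately have "z \<in> simples.degree x" using simples.degree_self by blast
      then show "z \<in> S" using * that by blast
    qed
    then show "(\<forall>a \<in> simples.adjoint_core. \<forall>x \<in> S. class_mult a x \<subseteq> S) \<and>
      (\<forall>x \<in> S. \<forall>a \<in> simples.adjoint_core. class_mult x a \<subseteq> S)"
      using * unfolding simples.degree_def by blast
  qed
  finally show ?thesis .
qed

text \<open>A union of several degrees splits into one of them and the rest. A single degree does not
  split, because each nonempty part stable under the adjoint subring is already everything.\<close>

lemma indecomposable_subbimodule_iff:
  "indecomposable_subbimodule C M \<longleftrightarrow> (\<exists>x \<in> simple_classes C. M = zspan (simples.degree x))"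
proof
  assume M: "indecomposable_subbimodule C M"
  then obtain S where S: "S \<subseteq> simple_classes C" "M = zspan S"
    unfolding indecomposable_subbimodule_def based_subbimodule_def by blast
  have union: "\<forall>x \<in> S. simples.degree x \<subseteq> S"
    using M based_subbimodule_zspan_iff[OF S(1)] S(2) unfolding indecomposable_subbimodule_def by blast
  have "S \<noteq> {}" using M S(2) zspan_eq_zero_iff unfolding indecomposable_subbimodule_def by blast
  then obtain x where x: "x \<in> S" by blast
  then have xP: "x \<in> simple_classes C" using S by blast
  let ?S1 = "simples.degree x" and ?S2 = "S - simples.degree x"
  have "?S2 = {}"
  proof (rule ccontr)
    assume ne: "?S2 \<noteq> {}"
    have sub: "?S1 \<subseteq> simple_classes C" "?S2 \<subseteq> simple_classes C"
      using S simples.degree_subset[OF xP] by blast+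
    have "simples.degree y \<subseteq> ?S1" if "y \<in> ?S1" for y
      using simples.degree_mono[OF xP that] .
    then have 1: "based_subbimodule C (zspan ?S1)" using based_subbimodule_zspan_iff[OF sub(1)] by blast
    have "simples.degree y \<subseteq> ?S2" if y: "y \<in> ?S2" for y
    proof
      fix z assume z: "z \<in> simples.degree y"
      have yP: "y \<in> simple_classes C" using y S by blast
      then have "simples.degree z = simples.degree y" using simples.degree_eqI z by blast
      moreover have "simples.degree z = simples.degree x" if "z \<in> simples.degree x"
        using simples.degree_eqI xP that by blast
      ultimately show "z \<in> ?S2" using z y union simples.degree_self[OF yP] by blast
    qed
    then have 2: "based_subbimodule C (zspan ?S2)" using based_subbimodule_zspan_iff[OF sub(2)] by blast
    have "x \<in> ?S1" using simples.degree_self[OF xP] .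
    then have "?S1 \<noteq> {}" "?S1 \<noteq> ?S2" by blast+
    moreover have "internal_direct_sum (zspan S) (zspan ` {?S1, ?S2})"
      using internal_direct_sum_zspan_iff[of "{?S1, ?S2}" S] union x
      by (auto simp: pairwise_def disjnt_def)
    ultimately have "\<exists>M1 M2. based_subbimodule C M1 \<and> based_subbimodule C M2 \<and> M1 \<noteq> {0} \<and>
        M2 \<noteq> {0} \<and> M1 \<noteq> M2 \<and> internal_direct_sum M {M1, M2}"
      using 1 2 ne
      by (intro exI[of _ "zspan ?S1"] exI[of _ "zspan ?S2"])
        (simp only: S(2) zspan_eq_zero_iff zspan_eq_iff image_insert image_empty simp_thms not_False_eq_True)
    then show False using M unfolding indecomposable_subbimodule_def by blast
  qed
  then have "S = ?S1" using union x by blast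
  then show "\<exists>x \<in> simple_classes C. M = zspan (simples.degree x)" using S(2) xP by blast
next
  assume "\<exists>x \<in> simple_classes C. M = zspan (simples.degree x)"
  then obtain x where x: "x \<in> simple_classes C" and M: "M = zspan (simples.degree x)" by blast
  note sub = simples.degree_subset[OF x]
  show "indecomposable_subbimodule C M"
    unfolding indecomposable_subbimodule_def
  proof (intro conjI notI)
    have "simples.degree y \<subseteq> simples.degree x" if "y \<in> simples.degree x" for y
      using simples.degree_mono[OF x that] .
    then show "based_subbimodule C M" unfolding M using based_subbimodule_zspan_iff[OF sub] by blast
    show False if "M = {0}"
      using that simples.degree_self[OF x] unfolding M zspan_eq_zero_iff by blast
  next
    assume "\<exists>M1 M2. based_subbimodule C M1 \<and> based_subbimodule C M2 \<and> M1 \<noteq> {0} \<and> M2 \<noteq> {0} \<and>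
          M1 \<noteq> M2 \<and> internal_direct_sum M {M1, M2}"
    then obtain M1 M2 where b: "based_subbimodule C M1" "based_subbimodule C M2"
      and ne: "M1 \<noteq> {0}" "M2 \<noteq> {0}" "M1 \<noteq> M2" and sum: "internal_direct_sum M {M1, M2}" by blast
    obtain S1 S2 where S1: "S1 \<subseteq> simple_classes C" "M1 = zspan S1"
      and S2: "S2 \<subseteq> simple_classes C" "M2 = zspan S2"
      using b unfolding based_subbimodule_def by blast
    have "disjoint {S1, S2} \<and> \<Union>{S1, S2} = simples.degree x"
      using internal_direct_sum_zspan_iff[of "{S1, S2}" "simples.degree x"] sum M S1 S2 by simp
    moreover have "S1 \<noteq> S2" using ne S1 S2 by blast
    ultimately have disj: "S1 \<inter> S2 = {}" and un: "S1 \<union> S2 = simples.degree x"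
      by (auto simp: pairwise_def disjnt_def)
    have "x \<in> S" if S: "S \<subseteq> simple_classes C" "S \<noteq> {}" "S \<subseteq> simples.degree x"
      "based_subbimodule C (zspan S)" for S
    proof -
      obtain y where y: "y \<in> S" using S by blast
      then have "simples.degree y = simples.degree x" using simples.degree_eqI[OF x] S by blast
      moreover have "simples.degree y \<subseteq> S" using based_subbimodule_zspan_iff[OF S(1)] S y by blast
      ultimately show ?thesis using simples.degree_self[OF x] by blast
    qed
    from this[of S1] this[of S2] show False
      using b ne S1 S2 un disj zspan_eq_zero_iff by blast
  qed
qed

text \<open>A decomposition into indecomposable subbimodules consists of spans of degrees that partition
  the simple classes, so every degree must be used. This proves existence and uniqueness.\<close>

lemma grading_components_eq: "grading_components C = (\<lambda>x. zspan (simples.degree x)) ` simple_classes C"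
proof -
  let ?D = "simples.degree ` simple_classes C"
  have disj: "disjoint ?D"
  proof -
    have "simples.degree x = simples.degree y"
      if "x \<in> simple_classes C" "y \<in> simple_classes C" "z \<in> simples.degree x" "z \<in> simples.degree y" for x y z
      using simples.degree_eqI that by metis
    then show ?thesis unfolding pairwise_def disjnt_def by blast
  qed
  have un: "\<Union>?D = simple_classes C"
    using simples.degree_self simples.degree_subset by blast
  have fin: "finite ?D" using finite_simple_classes by blast
  have K0: "carrier (K0 C) = zspan (simple_classes C)" by (simp add: K0_def)
  have "(\<forall>M \<in> F. indecomposable_subbimodule C M) \<and> internal_direct_sum (carrier (K0 C)) F
      \<longleftrightarrow> F = zspan ` ?D" for F
  proof
    assume F: "F = zspan ` ?D"
    show "(\<forall>M \<in> F. indecomposable_subbimodule C M) \<and> internal_direct_sum (carrier (K0 C)) F"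
      unfolding F K0 internal_direct_sum_zspan_iff[OF fin] indecomposable_subbimodule_iff
      using disj un by blast
  next
    assume *: "(\<forall>M \<in> F. indecomposable_subbimodule C M) \<and> internal_direct_sum (carrier (K0 C)) F"
    then have "F \<subseteq> zspan ` ?D" unfolding indecomposable_subbimodule_iff by blast
    then obtain \<S> where \<S>: "\<S> \<subseteq> ?D" "F = zspan ` \<S>" by (rule subset_imageE)
    have "finite \<S>" using \<S>(1) fin by (rule finite_subset)
    then have union: "\<Union>\<S> = simple_classes C"
      using * internal_direct_sum_zspan_iff unfolding K0 \<S>(2) by blast
    have "simples.degree x \<in> \<S>" if x: "x \<in> simple_classes C" for x
    proof -
      obtain S where S: "S \<in> \<S>" "x \<in> S" using union x by blast
      then obtain y where "y \<in> simple_classes C" "S = simples.degree y" using \<S> by blast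
      then have "simples.degree x = S" using simples.degree_eqI S by blast
      then show ?thesis using S by blast
    qed
    then show "F = zspan ` ?D" using \<S> by blast
  qed
  then have "grading_components C = zspan ` ?D" unfolding grading_components_def by simp
  then show ?thesis by (simp add: image_image)
qed

end

sublocale fusion_category \<subseteq> universal: universal_grading
  "simple_classes C" class_mult "iso_class C (Unit C)" "dual_class C"
  "universal_grading_group C" "\<lambda>x. zspan (simples.degree x)"
proof
  show "carrier (universal_grading_group C) = (\<lambda>x. zspan (simples.degree x)) ` simple_classes C"
    by (simp add: universal_grading_group_def grading_components_eq)
  show "\<one>\<^bsub>universal_grading_group C\<^esub> = zspan (simples.degree (iso_class C (Unit C)))"
    by (simp add: universal_grading_group_def R_ad_eq simples.degree_unit)
  show "zspan (simples.degree x) = zspan (simples.degree y) \<longleftrightarrow> simples.degree x = simples.degree y" for x y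
    by (rule zspan_eq_iff)
  fix x y z assume x: "x \<in> simple_classes C" and y: "y \<in> simple_classes C" and z: "z \<in> class_mult x y"
  let ?g = "\<lambda>x. zspan (simples.degree x)"
  have zP: "z \<in> simple_classes C" using z simples.mult_closed x y by blast
  note sub = simples.degree_subset[OF x] simples.degree_subset[OF y]
  have "(THE c. c \<in> grading_components C \<and> (\<forall>u \<in> ?g x. \<forall>v \<in> ?g y. u \<otimes>\<^bsub>K0 C\<^esub> v \<in> c)) = ?g z"
  proof (rule the_equality)
    have "class_mult x' y' \<subseteq> simples.degree z"
      if x': "x' \<in> simples.degree x" and y': "y' \<in> simples.degree y" for x' y'
    proof
      fix z' assume z': "z' \<in> class_mult x' y'"
      have "z' \<in> simple_classes C" using z' simples.mult_closed x' y' sub by blast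
      moreover have "simples.degree z' = simples.degree z"
        using simples.degree_mult_cong[OF x x' y y' z z'] .
      ultimately show "z' \<in> simples.degree z" using simples.degree_self by blast
    qed
    then show "?g z \<in> grading_components C \<and> (\<forall>u \<in> ?g x. \<forall>v \<in> ?g y. u \<otimes>\<^bsub>K0 C\<^esub> v \<in> ?g z)"
      unfolding K0_mult_zspan_iff[OF sub] grading_components_eq using zP by blast
  next
    fix c assume c: "c \<in> grading_components C \<and> (\<forall>u \<in> ?g x. \<forall>v \<in> ?g y. u \<otimes>\<^bsub>K0 C\<^esub> v \<in> c)"
    then obtain w where w: "w \<in> simple_classes C" "c = ?g w" unfolding grading_components_eq by blast
    have "\<forall>x' \<in> simples.degree x. \<forall>y' \<in> simples.degree y. class_mult x' y' \<subseteq> simples.degree w"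
      using c unfolding w(2) K0_mult_zspan_iff[OF sub] by blast
    then have "z \<in> simples.degree w" using z simples.degree_self[OF x] simples.degree_self[OF y] by blast
    then show "c = ?g z" unfolding w(2) using simples.degree_eqI[OF w(1)] by simp
  qed
  then show "?g x \<otimes>\<^bsub>universal_grading_group C\<^esub> ?g y = ?g z"
    by (simp add: universal_grading_group_def)
qed

section \<open>Automorphisms of the identity functor\<close>

context fusion_category
begin

text \<open>This characterises the endomorphism of \<open>Z\<close> with prescribed scalars on the simple constituents
  without a choice of a decomposition of \<open>Z\<close>.\<close>

definition acts_by :: "('o set \<Rightarrow> 'k) \<Rightarrow> 'o \<Rightarrow> 'm \<Rightarrow> bool" where
  "acts_by \<phi> Z e \<longleftrightarrow> e \<in> Mor C Z Z \<and>
     (\<forall>X u. simple_object C X \<longrightarrow> u \<in> Mor C X Z \<longrightarrow> e \<cdot> u = Scale C (\<phi> (iso_class C X)) u)"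

lemma acts_by_unique: "\<lbrakk>acts_by \<phi> Z e; acts_by \<phi> Z e'\<rbrakk> \<Longrightarrow> e = e'"
  using mor_eq_on_simples[of e Z Z e'] unfolding acts_by_def by metis

text \<open>On a decomposition \<open>Id = \<Sum> \<iota> i \<cdot> \<pi> i\<close> the endomorphism is the sum of the \<open>\<iota> i \<cdot> \<pi> i\<close>, each scaled by the
  value at the class of the summand: a simple object with a nonzero map to this summand lies in
  the same class.\<close>

lemma acts_by_exists:
  assumes Z: "Z \<in> Obj C"
  shows "\<exists>e. acts_by \<phi> Z e"
proof -
  obtain Xs where Xs: "\<forall>X \<in> set Xs. simple_object C X" and "is_direct_sum C Z Xs"
    using semisimple Z by blast
  from this(2) show ?thesis
  proof (cases rule: direct_sumE)
    case (1 \<iota> \<pi>)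
    let ?Q = "\<lambda>g. \<exists>e \<in> Mor C Z Z. \<forall>X u. simple_object C X \<longrightarrow> u \<in> Mor C X Z \<longrightarrow>
      e \<cdot> u = Scale C (\<phi> (iso_class C X)) (g \<cdot> u)"
    have "?Q (Id C Z)"
    proof (rule "1"(5)[of ?Q])
      fix i assume i: "i < length Xs"
      note \<iota> = 1(1)[OF i] and \<pi> = 1(2)[OF i]
      have s: "simple_object C (Xs ! i)" using Xs i by simp
      let ?c = "\<phi> (iso_class C (Xs ! i))" and ?g = "\<iota> i \<cdot> \<pi> i"
      have g: "?g \<in> Mor C Z Z" using Comp_closed[OF \<pi> \<iota>] .
      have "Scale C ?c ?g \<cdot> u = Scale C (\<phi> (iso_class C X)) (?g \<cdot> u)"
        if X: "simple_object C X" and u: "u \<in> Mor C X Z" for X u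
      proof -
        note XO = simple_Obj[OF X] and pu = Comp_closed[OF u \<pi>]
        have gu: "?g \<cdot> u = \<iota> i \<cdot> (\<pi> i \<cdot> u)" using Comp_assoc[OF u \<pi> \<iota>] .
        show ?thesis
        proof (cases "\<pi> i \<cdot> u = Zero C X (Xs ! i)")
          case True
          then have "?g \<cdot> u = Zero C X Z" using gu Comp_Zero_right[OF \<iota> XO] by simp
          then show ?thesis using Comp_Scale_left[OF u g] Scale_Zero[OF XO Z] by simp
        next
          case False
          then have "isomorphic C X (Xs ! i)" using schur_iso[OF X s pu] isomorphicI[OF pu] by blast
          then have "iso_class C X = iso_class C (Xs ! i)"
            using iso_class_eq_iff[OF XO simple_Obj[OF s]] by blast
          then show ?thesis using Comp_Scale_left[OF u g] by simp
        qed
      qed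
      then show "?Q ?g" using Scale_closed[OF g] by blast
    next
      have "Zero C Z Z \<cdot> u = Scale C (\<phi> (iso_class C X)) (Zero C Z Z \<cdot> u)"
        if "simple_object C X" "u \<in> Mor C X Z" for X u
        using Comp_Zero_left[OF that(2) Z] Scale_Zero[OF simple_Obj[OF that(1)] Z] by simp
      then show "?Q (Zero C Z Z)" using Zero_closed[OF Z Z] by blast
    next
      fix g h assume g: "g \<in> Mor C Z Z" and h: "h \<in> Mor C Z Z" and "?Q g" "?Q h"
      then obtain d e where d: "d \<in> Mor C Z Z" "\<And>X u. \<lbrakk>simple_object C X; u \<in> Mor C X Z\<rbrakk>
          \<Longrightarrow> d \<cdot> u = Scale C (\<phi> (iso_class C X)) (g \<cdot> u)"
        and e: "e \<in> Mor C Z Z" "\<And>X u. \<lbrakk>simple_object C X; u \<in> Mor C X Z\<rbrakk>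
          \<Longrightarrow> e \<cdot> u = Scale C (\<phi> (iso_class C X)) (h \<cdot> u)" by metis
      have "Plus C d e \<cdot> u = Scale C (\<phi> (iso_class C X)) (Plus C g h \<cdot> u)"
        if "simple_object C X" "u \<in> Mor C X Z" for X u
        using Comp_Plus_left[OF that(2) d(1) e(1)] Comp_Plus_left[OF that(2) g h] d(2)[OF that] e(2)[OF that]
          Scale_Plus[OF Comp_closed[OF that(2) g] Comp_closed[OF that(2) h]] by simp
      then show "?Q (Plus C g h)" using Plus_closed[OF d(1) e(1)] by blast
    qed
    then obtain e where e: "e \<in> Mor C Z Z" "\<And>X u. \<lbrakk>simple_object C X; u \<in> Mor C X Z\<rbrakk>
          \<Longrightarrow> e \<cdot> u = Scale C (\<phi> (iso_class C X)) (Id C Z \<cdot> u)" by blast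
    have "acts_by \<phi> Z e" unfolding acts_by_def using e Id_left by simp
    then show ?thesis ..
  qed
qed

definition scalar_end :: "('o set \<Rightarrow> 'k) \<Rightarrow> 'o \<Rightarrow> 'm" where
  "scalar_end \<phi> Z = (THE e. acts_by \<phi> Z e)"

lemma scalar_end_acts:
  assumes "Z \<in> Obj C"
  shows "acts_by \<phi> Z (scalar_end \<phi> Z)"
proof -
  obtain e where e: "acts_by \<phi> Z e" using acts_by_exists[OF assms] by blast
  then show ?thesis unfolding scalar_end_def by (rule theI) (rule acts_by_unique[OF _ e])
qed

lemma scalar_end_Mor: "Z \<in> Obj C \<Longrightarrow> scalar_end \<phi> Z \<in> Mor C Z Z"
  using scalar_end_acts unfolding acts_by_def by blast

lemma scalar_end_Comp:
  "\<lbrakk>simple_object C X; u \<in> Mor C X Z\<rbrakk> \<Longrightarrow> scalar_end \<phi> Z \<cdot> u = Scale C (\<phi> (iso_class C X)) u"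
  using scalar_end_acts MorD(2) unfolding acts_by_def by blast

lemma scalar_end_eqI: "\<lbrakk>Z \<in> Obj C; acts_by \<phi> Z e\<rbrakk> \<Longrightarrow> scalar_end \<phi> Z = e"
  using scalar_end_acts acts_by_unique by blast

lemma scalar_end_simple:
  "simple_object C X \<Longrightarrow> scalar_end \<phi> X = Scale C (\<phi> (iso_class C X)) (Id C X)"
  using scalar_end_Comp[OF _ Id_closed[OF simple_Obj]] Id_right[OF scalar_end_Mor[OF simple_Obj]] by metis

lemma scalar_end_mult:
  assumes Z: "Z \<in> Obj C" and eq: "\<And>c. c \<in> simple_classes C \<Longrightarrow> \<chi> c = \<phi> c * \<psi> c"
  shows "scalar_end \<chi> Z = scalar_end \<phi> Z \<cdot> scalar_end \<psi> Z"
proof (rule scalar_end_eqI[OF Z])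
  note m = scalar_end_Mor[OF Z]
  have "(scalar_end \<phi> Z \<cdot> scalar_end \<psi> Z) \<cdot> u = Scale C (\<chi> (iso_class C X)) u"
    if X: "simple_object C X" and u: "u \<in> Mor C X Z" for X u
  proof -
    have c: "iso_class C X \<in> simple_classes C" using X by (simp add: simple_classes_def)
    have "(scalar_end \<phi> Z \<cdot> scalar_end \<psi> Z) \<cdot> u = scalar_end \<phi> Z \<cdot> Scale C (\<psi> (iso_class C X)) u"
      using Comp_assoc[OF u m m] scalar_end_Comp[OF X u] by simp
    also have "\<dots> = Scale C (\<psi> (iso_class C X)) (Scale C (\<phi> (iso_class C X)) u)"
      using Comp_Scale_right[OF u m] scalar_end_Comp[OF X u] by simp
    also have "\<dots> = Scale C (\<chi> (iso_class C X)) u"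
      using Scale_Scale[OF u] eq[OF c] by (simp add: mult.commute)
    finally show ?thesis .
  qed
  then show "acts_by \<chi> Z (scalar_end \<phi> Z \<cdot> scalar_end \<psi> Z)"
    unfolding acts_by_def using Comp_closed[OF m m] by blast
qed

lemma scalar_end_Id:
  assumes Z: "Z \<in> Obj C" and eq: "\<And>c. c \<in> simple_classes C \<Longrightarrow> \<phi> c = 1"
  shows "scalar_end \<phi> Z = Id C Z"
proof (rule scalar_end_eqI[OF Z])
  have "Id C Z \<cdot> u = Scale C (\<phi> (iso_class C X)) u" if "simple_object C X" "u \<in> Mor C X Z" for X u
    using Id_left[OF that(2)] Scale_one[OF that(2)] eq that(1) by (simp add: simple_classes_def)
  then show "acts_by \<phi> Z (Id C Z)" unfolding acts_by_def using Id_closed[OF Z] by blast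
qed

lemma scalar_end_iso:
  assumes Z: "Z \<in> Obj C" and nz: "\<And>c. c \<in> simple_classes C \<Longrightarrow> \<phi> c \<noteq> 0"
  shows "iso_arr C (scalar_end \<phi> Z)"
proof (rule iso_arrI[OF scalar_end_Mor[OF Z] scalar_end_Mor[OF Z, of "\<lambda>c. inverse (\<phi> c)"]])
  have "scalar_end (\<lambda>_. 1) Z = Id C Z" by (rule scalar_end_Id[OF Z refl])
  then show "scalar_end (\<lambda>c. inverse (\<phi> c)) Z \<cdot> scalar_end \<phi> Z = Id C Z"
    "scalar_end \<phi> Z \<cdot> scalar_end (\<lambda>c. inverse (\<phi> c)) Z = Id C Z"
    using scalar_end_mult[OF Z, of "\<lambda>_. 1" "\<lambda>c. inverse (\<phi> c)" \<phi>]
      scalar_end_mult[OF Z, of "\<lambda>_. 1" \<phi> "\<lambda>c. inverse (\<phi> c)"] nz by simp_all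
qed

lemma scalar_end_natural:
  assumes f: "f \<in> Mor C Z W"
  shows "scalar_end \<phi> W \<cdot> f = f \<cdot> scalar_end \<phi> Z"
proof -
  have O: "Z \<in> Obj C" "W \<in> Obj C" using f MorD by auto
  note Zm = scalar_end_Mor[OF O(1), of \<phi>] and Wm = scalar_end_Mor[OF O(2), of \<phi>]
  show ?thesis
  proof (rule mor_eq_on_simples[OF Comp_closed[OF f Wm] Comp_closed[OF Zm f]])
    fix X u assume X: "simple_object C X" and u: "u \<in> Mor C X Z"
    show "(scalar_end \<phi> W \<cdot> f) \<cdot> u = (f \<cdot> scalar_end \<phi> Z) \<cdot> u"
      using Comp_assoc[OF u f Wm] Comp_assoc[OF u Zm f] scalar_end_Comp[OF X u]
        scalar_end_Comp[OF X Comp_closed[OF u f]] Comp_Scale_right[OF u f] by simp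
  qed
qed

text \<open>On \<open>X \<boxtimes> Y\<close> with simple \<open>X\<close> and \<open>Y\<close> all simple constituents are scaled by the same factor.\<close>

lemma scalar_end_Tens_simple:
  assumes ch: "simples.is_character \<phi>" and X: "simple_object C X" and Y: "simple_object C Y"
  shows "scalar_end \<phi> (X \<boxtimes> Y) = scalar_end \<phi> X \<boxtimes>\<^sub>m scalar_end \<phi> Y"
proof (rule scalar_end_eqI)
  let ?x = "iso_class C X" and ?y = "iso_class C Y"
  note XO = simple_Obj[OF X] and YO = simple_Obj[OF Y]
  note XYO = Tens_closed[OF XO YO] and IX = Id_closed[OF XO] and IY = Id_closed[OF YO]
  show "X \<boxtimes> Y \<in> Obj C" by (rule XYO)
  have xy: "?x \<in> simple_classes C" "?y \<in> simple_classes C" using X Y by (auto simp: simple_classes_def)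
  have "scalar_end \<phi> X \<boxtimes>\<^sub>m scalar_end \<phi> Y = Scale C (\<phi> ?x * \<phi> ?y) (Id C (X \<boxtimes> Y))"
    using scalar_end_simple[OF X] scalar_end_simple[OF Y] Tens_Scale_left[OF IX Scale_closed[OF IY]]
      Tens_Scale_right[OF IX IY] Tens_Id[OF XO YO] Scale_Scale[OF Id_closed[OF XYO]] by simp
  moreover have "Scale C (\<phi> ?x * \<phi> ?y) (Id C (X \<boxtimes> Y)) \<cdot> u = Scale C (\<phi> (iso_class C U)) u"
    if U: "simple_object C U" and u: "u \<in> Mor C U (X \<boxtimes> Y)" for U u
  proof (cases "u = Zero C U (X \<boxtimes> Y)")
    case True
    note UO = simple_Obj[OF U]
    show ?thesis
      using Comp_Scale_left[OF u Id_closed[OF XYO]] Id_left[OF u] Scale_Zero[OF UO XYO] True by simp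
  next
    case False
    then have "iso_class C U \<in> support C (X \<boxtimes> Y)" using support_iff[OF U] u by blast
    also have "support C (X \<boxtimes> Y) = class_mult ?x ?y"
      unfolding class_mult_def
      using support_Tens_simple(1)[OF X YO] support_Tens_simple(2)[OF Y class_rep_Obj[OF xy(1)]] by simp
    finally have "\<phi> (iso_class C U) = \<phi> ?x * \<phi> ?y"
      using simples.is_characterD(2)[OF ch xy] by blast
    then show ?thesis using Comp_Scale_left[OF u Id_closed[OF XYO]] Id_left[OF u] by simp
  qed
  ultimately show "acts_by \<phi> (X \<boxtimes> Y) (scalar_end \<phi> X \<boxtimes>\<^sub>m scalar_end \<phi> Y)"
    unfolding acts_by_def using Scale_closed[OF Id_closed[OF XYO]] by simp
qed

text \<open>Both sides are determined by their composites with \<open>u \<boxtimes> v\<close> for \<open>u\<close> and \<open>v\<close> with simple sources,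
  and there naturality reduces the claim to simple objects.\<close>

lemma scalar_end_Tens:
  assumes ch: "simples.is_character \<phi>" and Z: "Z \<in> Obj C" and W: "W \<in> Obj C"
  shows "scalar_end \<phi> (Z \<boxtimes> W) = scalar_end \<phi> Z \<boxtimes>\<^sub>m scalar_end \<phi> W"
proof -
  let ?s = "scalar_end \<phi>"
  note ZWO = Tens_closed[OF Z W]
  note ZW = scalar_end_Mor[OF ZWO, of \<phi>]
    and Z_W = TensArr_closed[OF scalar_end_Mor[OF Z, of \<phi>] scalar_end_Mor[OF W, of \<phi>]]
  show ?thesis
  proof (rule mor_eq_Tens_left[OF W ZW Z_W Z])
    fix X u assume X: "simple_object C X" and u: "u \<in> Mor C X Z"
    note XO = simple_Obj[OF X] and IW = Id_closed[OF W]
    note uW = TensArr_closed[OF u IW]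
    show "?s (Z \<boxtimes> W) \<cdot> (u \<boxtimes>\<^sub>m Id C W) = (?s Z \<boxtimes>\<^sub>m ?s W) \<cdot> (u \<boxtimes>\<^sub>m Id C W)"
    proof (rule mor_eq_Tens_right[OF XO Comp_closed[OF uW ZW] Comp_closed[OF uW Z_W] W])
      fix Y v assume Y: "simple_object C Y" and v: "v \<in> Mor C Y W"
      note YO = simple_Obj[OF Y] and IX = Id_closed[OF XO]
      note Xv = TensArr_closed[OF IX v] and uv = TensArr_closed[OF u v]
      have comp: "(u \<boxtimes>\<^sub>m Id C W) \<cdot> (Id C X \<boxtimes>\<^sub>m v) = u \<boxtimes>\<^sub>m v"
        using Tens_Comp[OF IX u v IW] Id_right[OF u] Id_left[OF v] by simp
      have "(?s (Z \<boxtimes> W) \<cdot> (u \<boxtimes>\<^sub>m Id C W)) \<cdot> (Id C X \<boxtimes>\<^sub>m v) = ?s (Z \<boxtimes> W) \<cdot> (u \<boxtimes>\<^sub>m v)"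
        using Comp_assoc[OF Xv uW ZW] comp by simp
      also have "\<dots> = (u \<boxtimes>\<^sub>m v) \<cdot> (?s X \<boxtimes>\<^sub>m ?s Y)"
        using scalar_end_natural[OF uv] scalar_end_Tens_simple[OF ch X Y] by simp
      also have "\<dots> = (?s Z \<boxtimes>\<^sub>m ?s W) \<cdot> (u \<boxtimes>\<^sub>m v)"
        using Tens_Comp[OF scalar_end_Mor[OF XO] u scalar_end_Mor[OF YO] v]
          Tens_Comp[OF u scalar_end_Mor[OF Z] v scalar_end_Mor[OF W]]
          scalar_end_natural[OF u] scalar_end_natural[OF v] by simp
      also have "\<dots> = ((?s Z \<boxtimes>\<^sub>m ?s W) \<cdot> (u \<boxtimes>\<^sub>m Id C W)) \<cdot> (Id C X \<boxtimes>\<^sub>m v)"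
        using Comp_assoc[OF Xv uW Z_W] comp by simp
      finally show "(?s (Z \<boxtimes> W) \<cdot> (u \<boxtimes>\<^sub>m Id C W)) \<cdot> (Id C X \<boxtimes>\<^sub>m v)
          = ((?s Z \<boxtimes>\<^sub>m ?s W) \<cdot> (u \<boxtimes>\<^sub>m Id C W)) \<cdot> (Id C X \<boxtimes>\<^sub>m v)" .
    qed
  qed
qed

lemma scalar_end_in_Aut:
  assumes ch: "simples.is_character \<phi>"
  shows "(\<lambda>Z \<in> Obj C. scalar_end \<phi> Z) \<in> carrier (Aut_tensor_id C)"
proof -
  have "scalar_end \<phi> (Unit C) = Id C (Unit C)"
    using scalar_end_simple[OF simple_Unit, of \<phi>] simples.character_unit[OF ch]
      Scale_one[OF Id_closed[OF Unit_closed]] by simp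
  then show ?thesis
    using scalar_end_Mor scalar_end_iso simples.is_characterD(1)[OF ch] scalar_end_Tens[OF ch]
      scalar_end_natural Tens_closed Unit_closed
    by (simp add: Aut_tensor_id_def)
qed

text \<open>A nonzero morphism from a constituent \<open>Z\<close> to \<open>X \<boxtimes> Y\<close> transports the scalar of \<open>X \<boxtimes> Y\<close>, which is
  the product of those of \<open>X\<close> and \<open>Y\<close>, to the scalar of \<open>Z\<close>.\<close>

lemma Aut_is_scalar:
  assumes \<Phi>: "\<Phi> \<in> carrier (Aut_tensor_id C)"
  obtains \<phi> where "simples.is_character \<phi>" "\<And>Z. Z \<in> Obj C \<Longrightarrow> \<Phi> Z = scalar_end \<phi> Z"
proof -
  have mor: "\<Phi> Z \<in> Mor C Z Z" "iso_arr C (\<Phi> Z)" if "Z \<in> Obj C" for Z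
    using \<Phi> that by (auto simp: Aut_tensor_id_def)
  have nat: "\<Phi> Z \<cdot> f = f \<cdot> \<Phi> W" if "f \<in> Mor C W Z" for f W Z
    using \<Phi> that MorD(1,2)[OF that] by (auto simp: Aut_tensor_id_def)
  have tens: "\<Phi> (Z \<boxtimes> W) = \<Phi> Z \<boxtimes>\<^sub>m \<Phi> W" if "Z \<in> Obj C" "W \<in> Obj C" for Z W
    using \<Phi> that by (auto simp: Aut_tensor_id_def)
  have "\<exists>c. \<Phi> (class_rep x) = Scale C c (Id C (class_rep x))" if x: "x \<in> simple_classes C" for x
    using schur_scalar[OF simple_class_rep(1)[OF x] mor(1)[OF class_rep_Obj[OF x]]] by blast
  then obtain \<phi> where \<phi>: "\<And>x. x \<in> simple_classes C
      \<Longrightarrow> \<Phi> (class_rep x) = Scale C (\<phi> x) (Id C (class_rep x))" by metis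
  have simple: "\<Phi> X = Scale C (\<phi> (iso_class C X)) (Id C X)" if X: "simple_object C X" for X
  proof -
    note XO = simple_Obj[OF X]
    let ?Y = "class_rep (iso_class C X)"
    have x: "iso_class C X \<in> simple_classes C" using X by (simp add: simple_classes_def)
    note IX = Id_closed[OF XO] and IY = Id_closed[OF class_rep_Obj[OF x]]
    obtain i where i: "i \<in> Mor C X ?Y" "iso_arr C i"
      using class_rep_iso_class(2)[OF XO] unfolding isomorphic_def by blast
    have "i \<cdot> \<Phi> X = Scale C (\<phi> (iso_class C X)) (Id C ?Y) \<cdot> i" using nat[OF i(1)] \<phi>[OF x] by simp
    also have "\<dots> = i \<cdot> Scale C (\<phi> (iso_class C X)) (Id C X)"
      using Comp_Scale_left[OF i(1) IY] Comp_Scale_right[OF IX i(1)] Id_left[OF i(1)] Id_right[OF i(1)]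
      by simp
    finally show ?thesis using Comp_iso_cancel_left[OF i mor(1)[OF XO] Scale_closed[OF IX]] by blast
  qed
  have "simples.is_character \<phi>"
    unfolding simples.is_character_def
  proof (intro conjI ballI)
    fix x assume x: "x \<in> simple_classes C"
    note X = simple_class_rep(1)[OF x] and XO = class_rep_Obj[OF x]
    have "\<Phi> (class_rep x) \<noteq> Zero C (class_rep x) (class_rep x)"
      using iso_nonzero[OF X mor(1)[OF XO] mor(2)[OF XO]] .
    then show "\<phi> x \<noteq> 0" using \<phi>[OF x] Scale_0[OF Id_closed[OF XO]] by auto
  next
    fix x y z assume x: "x \<in> simple_classes C" and y: "y \<in> simple_classes C" and z: "z \<in> class_mult x y"
    note XO = class_rep_Obj[OF x] and YO = class_rep_Obj[OF y]
    let ?X = "class_rep x" and ?Y = "class_rep y" and ?Z = "class_rep z"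
    have zP: "z \<in> simple_classes C" using z simples.mult_closed[OF x y] by blast
    note XYO = Tens_closed[OF XO YO] and IX = Id_closed[OF XO] and IY = Id_closed[OF YO]
      and IZ = Id_closed[OF class_rep_Obj[OF zP]]
    obtain u where u: "u \<in> Mor C ?Z (?X \<boxtimes> ?Y)" "u \<noteq> Zero C ?Z (?X \<boxtimes> ?Y)"
      using simple_nonzero_class_rep z unfolding class_mult_def by blast
    have "\<Phi> (?X \<boxtimes> ?Y) = Scale C (\<phi> x * \<phi> y) (Id C (?X \<boxtimes> ?Y))"
      using tens[OF XO YO] \<phi>[OF x] \<phi>[OF y] Tens_Scale_left[OF IX Scale_closed[OF IY]]
        Tens_Scale_right[OF IX IY] Tens_Id[OF XO YO] Scale_Scale[OF Id_closed[OF XYO]] by simp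
    then have "Scale C (\<phi> x * \<phi> y) u = \<Phi> (?X \<boxtimes> ?Y) \<cdot> u"
      using Comp_Scale_left[OF u(1) Id_closed[OF XYO]] Id_left[OF u(1)] by simp
    also have "\<dots> = u \<cdot> \<Phi> ?Z" by (rule nat[OF u(1)])
    also have "\<dots> = Scale C (\<phi> z) u"
      using \<phi>[OF zP] Comp_Scale_right[OF IZ u(1)] Id_right[OF u(1)] by simp
    finally show "\<phi> x * \<phi> y = \<phi> z" using Scale_cancel[OF u] by blast
  qed
  moreover have "\<Phi> Z = scalar_end \<phi> Z" if Z: "Z \<in> Obj C" for Z
  proof (rule scalar_end_eqI[OF Z, symmetric])
    have "\<Phi> Z \<cdot> u = Scale C (\<phi> (iso_class C X)) u" if X: "simple_object C X" and u: "u \<in> Mor C X Z" for X u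
      using nat[OF u] simple[OF X] Comp_Scale_right[OF Id_closed[OF simple_Obj[OF X]] u] Id_right[OF u]
      by simp
    then show "acts_by \<phi> Z (\<Phi> Z)" unfolding acts_by_def using mor(1)[OF Z] by blast
  qed
  ultimately show thesis using that by blast
qed

lemma scalar_end_cong:
  assumes Z: "Z \<in> Obj C" and eq: "\<And>c. c \<in> simple_classes C \<Longrightarrow> \<phi> c = \<psi> c"
  shows "scalar_end \<phi> Z = scalar_end \<psi> Z"
proof (rule scalar_end_eqI[OF Z])
  show "acts_by \<phi> Z (scalar_end \<psi> Z)"
    using scalar_end_acts[OF Z, of \<psi>] eq unfolding acts_by_def simple_classes_def by auto
qed

lemma character_cong:
  assumes "simples.is_character \<phi>" and eq: "\<And>c. c \<in> simple_classes C \<Longrightarrow> \<phi> c = \<psi> c"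
  shows "simples.is_character \<psi>"
  unfolding simples.is_character_def
proof (intro conjI ballI)
  show "\<psi> x \<noteq> 0" if "x \<in> simple_classes C" for x
    using simples.is_characterD(1)[OF assms(1) that] eq[OF that] by simp
  show "\<psi> x * \<psi> y = \<psi> z"
    if "x \<in> simple_classes C" "y \<in> simple_classes C" "z \<in> class_mult x y" for x y z
    using simples.is_characterD(2)[OF assms(1) that] eq that simples.mult_closed[OF that(1,2)] by auto
qed

theorem characters_iso_Aut: "(simples.characters :: ('o set \<Rightarrow> 'k) monoid) \<cong> Aut_tensor_id C"
proof -
  let ?M = "simples.characters :: ('o set \<Rightarrow> 'k) monoid"
  define \<rho> where "\<rho> = (\<lambda>\<phi> :: 'o set \<Rightarrow> 'k. \<lambda>Z \<in> Obj C. scalar_end \<phi> Z)"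
  have carr: "\<phi> \<in> carrier ?M \<longleftrightarrow> \<phi> \<in> extensional (simple_classes C) \<and> simples.is_character \<phi>" for \<phi>
    by (simp add: simples.characters_def)
  have hom: "\<rho> \<in> hom ?M (Aut_tensor_id C)"
  proof (rule homI)
    fix \<phi> assume "\<phi> \<in> carrier ?M"
    then show "\<rho> \<phi> \<in> carrier (Aut_tensor_id C)"
      unfolding \<rho>_def using scalar_end_in_Aut carr by blast
  next
    fix \<phi> \<psi> assume "\<phi> \<in> carrier ?M" "\<psi> \<in> carrier ?M"
    have "scalar_end (\<phi> \<otimes>\<^bsub>?M\<^esub> \<psi>) Z = scalar_end \<phi> Z \<cdot> scalar_end \<psi> Z" if "Z \<in> Obj C" for Z
      by (rule scalar_end_mult[OF that]) (simp add: simples.characters_def)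
    then show "\<rho> (\<phi> \<otimes>\<^bsub>?M\<^esub> \<psi>) = \<rho> \<phi> \<otimes>\<^bsub>Aut_tensor_id C\<^esub> \<rho> \<psi>"
      by (auto simp: \<rho>_def Aut_tensor_id_def fun_eq_iff)
  qed
  have "\<rho> \<in> iso ?M (Aut_tensor_id C)"
  proof (rule isoI[OF hom])
    show "bij_betw \<rho> (carrier ?M) (carrier (Aut_tensor_id C))"
      unfolding bij_betw_def
    proof
      show "inj_on \<rho> (carrier ?M)"
      proof (rule inj_onI)
        fix \<phi> \<psi> assume \<phi>: "\<phi> \<in> carrier ?M" and \<psi>: "\<psi> \<in> carrier ?M" and eq: "\<rho> \<phi> = \<rho> \<psi>"
        show "\<phi> = \<psi>"
        proof (rule extensionalityI[of _ "simple_classes C"])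
          fix x assume x: "x \<in> simple_classes C"
          note X = simple_class_rep[OF x] and XO = class_rep_Obj[OF x]
          have "scalar_end \<phi> (class_rep x) = scalar_end \<psi> (class_rep x)"
            using fun_cong[OF eq, of "class_rep x"] XO by (simp add: \<rho>_def)
          then have "Scale C (\<phi> x) (Id C (class_rep x)) = Scale C (\<psi> x) (Id C (class_rep x))"
            using scalar_end_simple[OF X(1)] X(2) by simp
          then show "\<phi> x = \<psi> x"
            using Scale_cancel[OF Id_closed[OF XO] simple_Id_nonzero[OF X(1)]] by blast
        qed (use \<phi> \<psi> carr in auto)
      qed
      have "\<Phi> \<in> \<rho> ` carrier ?M" if \<Phi>: "\<Phi> \<in> carrier (Aut_tensor_id C)" for \<Phi>
      proof -
        obtain \<phi> where ch: "simples.is_character \<phi>" and eq: "\<And>Z. Z \<in> Obj C \<Longrightarrow> \<Phi> Z = scalar_end \<phi> Z"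
          using Aut_is_scalar[OF \<Phi>] by blast
        let ?\<phi> = "restrict \<phi> (simple_classes C)"
        have "?\<phi> \<in> carrier ?M" using character_cong[OF ch, of ?\<phi>] carr by simp
        moreover have "\<Phi> = \<rho> ?\<phi>"
        proof (rule extensionalityI[of _ "Obj C"])
          show "\<Phi> \<in> extensional (Obj C)" using \<Phi> by (simp add: Aut_tensor_id_def)
          show "\<rho> ?\<phi> \<in> extensional (Obj C)" by (simp add: \<rho>_def)
          show "\<Phi> Z = \<rho> ?\<phi> Z" if "Z \<in> Obj C" for Z
            using eq[OF that] scalar_end_cong[OF that, of \<phi> ?\<phi>] that by (simp add: \<rho>_def)
        qed
        ultimately show ?thesis by blast
      qed
      then show "\<rho> ` carrier ?M = carrier (Aut_tensor_id C)"
        using hom by (auto simp: hom_def)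
    qed
  qed
  then show ?thesis by (rule is_isoI)
qed

end

theorem proposition3p9:
  fixes C :: "('o, 'm, 'k::{alg_closed_field, field_char_0}) tensor_cat"
  assumes "fusion_category C"
  shows "(character_group (abelianization (universal_grading_group C)) ::
            (('o set \<Rightarrow>\<^sub>0 int) set set \<Rightarrow> 'k) monoid)
         \<cong> Aut_tensor_id C"
proof -
  interpret fusion_category C by (rule assms)
  show ?thesis
    by (rule iso_trans[OF universal.characters_of_abelianization characters_iso_Aut])
qed

end
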